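(* Let $R$ be a commutative Noetherian ring, let $I$ be an ideal of $R$ contained in the Jacobson radical of $R$, and let $\hat{R}$ denote the $I$-adic completion of $R$. Then $R$ is $I$-Cohen Macaulay if and only if $\hat{R}$ is $I\hat{R}$-Cohen Macaulay and $\operatorname{grade}(I,R)=\operatorname{grade}(I\hat{R},\hat{R})$.
   Context: For a proper ideal $J$ of a commutative Noetherian ring $A$, the ring $A$ is called $J$-Cohen Macaulay if $\operatorname{grade}(J,A)+\dim(A/J)=\dim(A)$, where $\operatorname{grade}(J,A)$ is the length of a maximal $A$-regular sequence contained in $J$ and $\dim$ denotes Krull dimension. *)

theory Defs
  imports "HOL-Algebra.Algebra" "HOL-Library.Extended_Nat"
begin

definition jacobson_radical :: "('a, 'b) ring_scheme \<Rightarrow> 'a set" where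
  "jacobson_radical A = {x \<in> carrier A. \<forall>M. maximalideal M A \<longrightarrow> x \<in> M}"

text \<open>
  Krull dimension: the supremum of the lengths n of strict chains of prime ideals
  p 0 < ... < p n.  A Noetherian ring may have infinite Krull dimension, so the value is
  an extended natural number.  The zero ring, which has no proper ideals, gets dimension 0.
\<close>

definition krull_dim :: "('a, 'b) ring_scheme \<Rightarrow> enat" where
  "krull_dim A = Sup {enat n | n. \<exists>p :: nat \<Rightarrow> 'a set.
     (\<forall>i\<le>n. primeideal (p i) A) \<and> (\<forall>i<n. p i \<subset> p (Suc i))}"

definition nonzerodivisor :: "('a, 'b) ring_scheme \<Rightarrow> 'a \<Rightarrow> bool" where
  "nonzerodivisor A x \<longleftrightarrow>
     x \<in> carrier A \<and> (\<forall>a \<in> carrier A. x \<otimes>\<^bsub>A\<^esub> a = \<zero>\<^bsub>A\<^esub> \<longrightarrow> a = \<zero>\<^bsub>A\<^esub>)"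

definition regular_sequence :: "('a, 'b) ring_scheme \<Rightarrow> 'a list \<Rightarrow> bool" where
  "regular_sequence A xs \<longleftrightarrow>
     set xs \<subseteq> carrier A \<and>
     (\<forall>i < length xs. let K = Idl\<^bsub>A\<^esub> (set (take i xs))
        in nonzerodivisor (A Quot K) (K +>\<^bsub>A\<^esub> (xs ! i))) \<and>
     Idl\<^bsub>A\<^esub> (set xs) \<noteq> carrier A"

definition maximal_regular_sequence_in ::
    "('a, 'b) ring_scheme \<Rightarrow> 'a set \<Rightarrow> 'a list \<Rightarrow> bool" where
  "maximal_regular_sequence_in A J xs \<longleftrightarrow>
     regular_sequence A xs \<and> set xs \<subseteq> J \<and>
     (\<forall>y \<in> J. \<not> regular_sequence A (xs @ [y]))"

text \<open>
  For a proper ideal J of a commutative Noetherian ring, maximal regular sequences in J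
  exist and all have the same length (Rees); outside that setting the value is unspecified.
\<close>

definition grade :: "'a set \<Rightarrow> ('a, 'b) ring_scheme \<Rightarrow> nat" where
  "grade J A = (THE n. \<exists>xs. maximal_regular_sequence_in A J xs \<and> length xs = n)"

definition cohen_macaulay_wrt :: "'a set \<Rightarrow> ('a, 'b) ring_scheme \<Rightarrow> bool" where
  "cohen_macaulay_wrt J A \<longleftrightarrow>
     ideal J A \<and> J \<noteq> carrier A \<and>
     enat (grade J A) + krull_dim (A Quot J) = krull_dim A"

abbreviation ideal_power :: "('a, 'b) ring_scheme \<Rightarrow> 'a set \<Rightarrow> nat \<Rightarrow> 'a set" where
  "ideal_power A I n \<equiv> I [^]\<^bsub>ideals_set A\<^esub> n"

text \<open>
  The inverse limit of the rings A / I^n: sequences s of cosets s n in A / I^n such that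
  the projection from A / I^(n+1) to A / I^n, which sends a coset C to I^n + C,
  maps s (n+1) to s n.  (Unqualified mult and zero denote unrelated library constants.)
\<close>

definition adic_completion :: "('a, 'b) ring_scheme \<Rightarrow> 'a set \<Rightarrow> (nat \<Rightarrow> 'a set) ring" where
  "adic_completion A I =
     \<lparr>carrier = {s. (\<forall>n. s n \<in> carrier (A Quot ideal_power A I n)) \<and>
                    (\<forall>n. ideal_power A I n <+>\<^bsub>A\<^esub> s (Suc n) = s n)},
      monoid.mult = (\<lambda>s t n. s n \<otimes>\<^bsub>A Quot ideal_power A I n\<^esub> t n),
      one = (\<lambda>n. \<one>\<^bsub>A Quot ideal_power A I n\<^esub>),
      ring.zero = (\<lambda>n. \<zero>\<^bsub>A Quot ideal_power A I n\<^esub>),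
      add = (\<lambda>s t n. s n \<oplus>\<^bsub>A Quot ideal_power A I n\<^esub> t n)\<rparr>"

definition to_completion :: "('a, 'b) ring_scheme \<Rightarrow> 'a set \<Rightarrow> 'a \<Rightarrow> nat \<Rightarrow> 'a set" where
  "to_completion A I x = (\<lambda>n. ideal_power A I n +>\<^bsub>A\<^esub> x)"

definition extended_ideal :: "('a, 'b) ring_scheme \<Rightarrow> 'a set \<Rightarrow> (nat \<Rightarrow> 'a set) set" where
  "extended_ideal A I = Idl\<^bsub>adic_completion A I\<^esub> (to_completion A I ` I)"

end

theory Submission
  imports Defs
begin

text \<open>
  All three invariants agree for \<open>R\<close> and its completion \<open>C\<close>: grade, \<open>dim R\<close> and \<open>dim (R / I)\<close>.
  The canonical map \<open>\<phi>\<close> satisfies \<open>C = \<phi> R + I\<^sup>n C\<close> and \<open>\<phi>\<^sup>-\<^sup>1 (I\<^sup>n C) = I\<^sup>n\<close>, because \<open>I\<close> is finitely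
  generated, and \<open>C\<close> is Noetherian by Cohen's theorem and Kaplansky's argument for power series.
  Maximal ideals \<open>m\<close> of \<open>R\<close> and \<open>m C\<close> of \<open>C\<close> correspond, and by Krull's height theorem \<open>ht m \<le> d\<close>
  holds iff \<open>m\<^sup>N \<subseteq> (x\<^sub>1, \<dots>, x\<^sub>d) + m\<^sup>N\<^sup>+\<^sup>1\<close> for some \<open>N\<close> and \<open>x\<^sub>i \<in> m\<close>, a condition on
  \<open>R / m\<^sup>N\<^sup>+\<^sup>1 = C / m\<^sup>N\<^sup>+\<^sup>1 C\<close>.  A weak form of the Artin-Rees lemma and Krull's intersection theorem show
  that \<open>\<phi>\<close> maps a maximal regular sequence in \<open>I\<close> to a maximal one in \<open>I C\<close>, and by Rees's theorem
  the length of such a sequence is the grade.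

  A ring with carrier is written as the quotient of a free commutative ring, which is a type of class
  \<open>comm_ring_1\<close>, by the kernel \<open>K\<close> of an evaluation map.  Ideals of the ring become ideals of the free
  ring containing \<open>K\<close>, and every notion is relative to a base ideal \<open>K\<close>.
\<close>

section \<open>Ideals of a commutative ring relative to a base ideal\<close>

text \<open>Passing to a quotient only enlarges the base ideal, so inductions that divide by one
  element after another stay in a single type; localizations are likewise replaced by saturated
  ideals. The argument does not go through flatness of the completion. Three devices stand in for
  it: a non-zero-divisor is carried over by approximation modulo powers of \<open>I\<close>; every
  ideal of \<open>R\<close> is contracted from \<open>C\<close>, being closed in the adic topology;
  and maximality of a regular sequence is turned into a witness, an element outside
  \<open>(xs)\<close> that \<open>I\<close> multiplies into \<open>(xs)\<close>, because a statement
  about all elements of \<open>I C\<close> would not transfer. The obstacle for dimension is that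
  primes of \<open>C\<close> need not come from \<open>R\<close>. Chains of primes in the two rings
  are therefore never compared, only the parameter criterion at maximal ideals is. Dimensions may be
  infinite, so they are compared through their finite upper bounds \<open>d\<close>.\<close>

definition rideal :: "'p::comm_ring_1 set \<Rightarrow> bool" where
  "rideal J \<longleftrightarrow> 0 \<in> J \<and> (\<forall>a\<in>J. \<forall>b\<in>J. a + b \<in> J) \<and> (\<forall>r. \<forall>a\<in>J. r * a \<in> J)"

definition gen :: "'p::comm_ring_1 set \<Rightarrow> 'p set" where
  "gen Z = {x. \<forall>J. rideal J \<and> Z \<subseteq> J \<longrightarrow> x \<in> J}"

abbreviation prods :: "'p::comm_ring_1 set \<Rightarrow> 'p set \<Rightarrow> 'p set" where
  "prods J L \<equiv> {a * b |a b. a \<in> J \<and> b \<in> L}"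

definition rprime :: "'p::comm_ring_1 set \<Rightarrow> bool" where
  "rprime p \<longleftrightarrow> rideal p \<and> 1 \<notin> p \<and> (\<forall>a b. a * b \<in> p \<longrightarrow> a \<in> p \<or> b \<in> p)"

text \<open>Stated by inverses in the residue field, the form in which maximality is used to undo a
  localization at \<open>m\<close>.\<close>

definition rmaximal :: "'p::comm_ring_1 set \<Rightarrow> bool" where
  "rmaximal m \<longleftrightarrow> rideal m \<and> 1 \<notin> m \<and> (\<forall>a. a \<notin> m \<longrightarrow> (\<exists>u. u * a - 1 \<in> m))"

text \<open>Ideals of the quotient by \<open>K\<close> are the ideals above \<open>K\<close>. The
  ambient ring will be a polynomial ring in possibly infinitely many variables, hence finiteness is
  asked only relative to \<open>K\<close>.\<close>

definition noeth :: "'p::comm_ring_1 set \<Rightarrow> bool" where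
  "noeth K \<longleftrightarrow> rideal K \<and>
     (\<forall>J. rideal J \<and> K \<subseteq> J \<longrightarrow> (\<exists>F. finite F \<and> J = gen (K \<union> F)))"

lemma ridealI:
  assumes "0 \<in> J" "\<And>a b. a \<in> J \<Longrightarrow> b \<in> J \<Longrightarrow> a + b \<in> J" "\<And>r a. a \<in> J \<Longrightarrow> r * a \<in> J"
  shows "rideal J"
  using assms by (auto simp: rideal_def)

lemma rideal_0: "rideal J \<Longrightarrow> 0 \<in> J" by (simp add: rideal_def)
lemma rideal_add: "rideal J \<Longrightarrow> a \<in> J \<Longrightarrow> b \<in> J \<Longrightarrow> a + b \<in> J" by (simp add: rideal_def)
lemma rideal_mult: "rideal J \<Longrightarrow> a \<in> J \<Longrightarrow> r * a \<in> J" by (simp add: rideal_def)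
lemma rideal_mult2: "rideal J \<Longrightarrow> a \<in> J \<Longrightarrow> a * r \<in> J"
  using rideal_mult[of J a r] by (simp add: mult.commute)
lemma rideal_uminus: "rideal J \<Longrightarrow> a \<in> J \<Longrightarrow> - a \<in> J" using rideal_mult[of J a "-1"] by simp
lemma rideal_diff: "rideal J \<Longrightarrow> a \<in> J \<Longrightarrow> b \<in> J \<Longrightarrow> a - b \<in> J"
  using rideal_add[of J a "-b"] rideal_uminus[of J b] by simp
lemma rideal_addD: "rideal J \<Longrightarrow> a + b \<in> J \<Longrightarrow> b \<in> J \<Longrightarrow> a \<in> J"
  using rideal_diff[of J "a+b" b] by simp
lemma rideal_addD': "rideal J \<Longrightarrow> a + b \<in> J \<Longrightarrow> a \<in> J \<Longrightarrow> b \<in> J"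
  using rideal_diff[of J "a+b" a] by simp
lemma rideal_diffD: "rideal J \<Longrightarrow> a - b \<in> J \<Longrightarrow> b \<in> J \<Longrightarrow> a \<in> J"
  using rideal_add[of J "a-b" b] by simp
lemma rideal_diffD': "rideal J \<Longrightarrow> a - b \<in> J \<Longrightarrow> a \<in> J \<Longrightarrow> b \<in> J"
  using rideal_diff[of J a "a-b"] by simp
lemma rideal_one: "rideal J \<Longrightarrow> 1 \<in> J \<Longrightarrow> J = UNIV"
  using rideal_mult[of J 1] by auto
lemma rideal_UNIV: "rideal UNIV" by (simp add: rideal_def)
lemma rideal_colon: "rideal J \<Longrightarrow> rideal {a. a * z \<in> J}"
  by (auto simp: rideal_def algebra_simps)
lemma rideal_colon': "rideal J \<Longrightarrow> rideal {a. z * a \<in> J}"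
  using rideal_colon[of J z] by (simp add: mult.commute)

lemma rideal_gen: "rideal (gen Z)"
  by (auto simp: gen_def rideal_def)

lemma gen_superset: "Z \<subseteq> gen Z" by (auto simp: gen_def)

lemma gen_base: "x \<in> Z \<Longrightarrow> x \<in> gen Z" using gen_superset by blast

lemma gen_least: "rideal J \<Longrightarrow> Z \<subseteq> J \<Longrightarrow> gen Z \<subseteq> J" by (auto simp: gen_def)

lemma gen_mono: "Z \<subseteq> Y \<Longrightarrow> gen Z \<subseteq> gen Y"
  by (rule gen_least[OF rideal_gen]) (use gen_superset in blast)

lemma gen_rideal: "rideal J \<Longrightarrow> gen J = J"
  using gen_least[of J J] gen_superset by auto

lemma gen_gen_Un: "gen (gen Z \<union> Y) = gen (Z \<union> Y)"
proof
  show "gen (gen Z \<union> Y) \<subseteq> gen (Z \<union> Y)"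
    using gen_least[OF rideal_gen] gen_mono[of Z "Z \<union> Y"] gen_superset[of "Z \<union> Y"]
    by (metis Un_subset_iff)
  show "gen (Z \<union> Y) \<subseteq> gen (gen Z \<union> Y)"
    by (rule gen_mono) (use gen_superset in blast)
qed

lemma gen_gen_insert: "gen (insert x (gen Z)) = gen (insert x Z)"
  using gen_gen_Un[of Z "{x}"] by simp

lemma gen_Un_iff:
  assumes "rideal J" "rideal L"
  shows "z \<in> gen (J \<union> L) \<longleftrightarrow> (\<exists>a\<in>J. \<exists>b\<in>L. z = a + b)"
proof
  let ?S = "{z. \<exists>a\<in>J. \<exists>b\<in>L. z = a + b}"
  have "rideal ?S"
  proof (rule ridealI)
    show "0 \<in> ?S" using rideal_0[OF assms(1)] rideal_0[OF assms(2)] by force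
  next
    fix u v assume "u \<in> ?S" "v \<in> ?S"
    then obtain a b c d where "a \<in> J" "b \<in> L" "c \<in> J" "d \<in> L" "u = a + b" "v = c + d" by auto
    then have "a + c \<in> J" "b + d \<in> L" "u + v = (a + c) + (b + d)"
      using assms by (auto intro: rideal_add simp: algebra_simps)
    then show "u + v \<in> ?S" by blast
  next
    fix r u assume "u \<in> ?S"
    then obtain a b where "a \<in> J" "b \<in> L" "u = a + b" by auto
    then have "r * a \<in> J" "r * b \<in> L" "r * u = r * a + r * b"
      using assms by (auto intro: rideal_mult simp: distrib_left)
    then show "r * u \<in> ?S" by blast
  qed
  moreover have "J \<union> L \<subseteq> ?S"
  proof
    fix z assume "z \<in> J \<union> L"
    then show "z \<in> ?S"
    proof
      assume "z \<in> J"
      moreover have "z = z + 0" by simp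
      ultimately show "z \<in> ?S" using rideal_0[OF assms(2)] by blast
    next
      assume "z \<in> L"
      moreover have "z = 0 + z" by simp
      ultimately show "z \<in> ?S" using rideal_0[OF assms(1)] by blast
    qed
  qed
  ultimately show "z \<in> gen (J \<union> L) \<Longrightarrow> \<exists>a\<in>J. \<exists>b\<in>L. z = a + b"
    using gen_least by blast
next
  assume "\<exists>a\<in>J. \<exists>b\<in>L. z = a + b"
  then show "z \<in> gen (J \<union> L)" using rideal_add[OF rideal_gen] gen_base by (metis UnI1 UnI2)
qed

lemma gen_singleton: "gen {x} = range (\<lambda>a. a * x)"
proof
  have "rideal (range (\<lambda>a. a * x))"
    by (rule ridealI) (auto simp: image_iff distrib_right[symmetric] mult.assoc[symmetric]
        intro: exI[of _ 0])
  then show "gen {x} \<subseteq> range (\<lambda>a. a * x)"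
    by (rule gen_least) (use range_eqI[of x "\<lambda>a. a * x" 1] in simp)
  show "range (\<lambda>a. a * x) \<subseteq> gen {x}" using rideal_mult[OF rideal_gen, of x "{x}"] gen_base by auto
qed

lemma gen_insert_iff: "z \<in> gen (insert x Z) \<longleftrightarrow> (\<exists>a. z - a * x \<in> gen Z)"
proof -
  have "gen (insert x Z) = gen (gen Z \<union> gen {x})"
  proof -
    have "gen (insert x Z) = gen (gen {x} \<union> Z)" unfolding gen_gen_Un by simp
    also have "gen {x} \<union> Z = Z \<union> gen {x}" by blast
    also have "gen \<dots> = gen (gen Z \<union> gen {x})" unfolding gen_gen_Un ..
    finally show ?thesis .
  qed
  then have *: "z \<in> gen (insert x Z) \<longleftrightarrow> (\<exists>c\<in>gen Z. \<exists>b\<in>gen {x}. z = c + b)"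
    by (simp only: gen_Un_iff[OF rideal_gen rideal_gen])
  show ?thesis unfolding * gen_singleton
  proof
    assume "\<exists>c\<in>gen Z. \<exists>b\<in>range (\<lambda>a. a * x). z = c + b"
    then obtain c a where "c \<in> gen Z" "z = c + a * x" by blast
    then show "\<exists>a. z - a * x \<in> gen Z" by (intro exI[of _ a]) simp
  next
    assume "\<exists>a. z - a * x \<in> gen Z"
    then obtain a where "z - a * x \<in> gen Z" by blast
    then show "\<exists>c\<in>gen Z. \<exists>b\<in>range (\<lambda>a. a * x). z = c + b"
      by (intro bexI[of _ "z - a * x"] bexI[of _ "a * x"]) auto
  qed
qed

lemma gen_insert_ideal_iff: "rideal J \<Longrightarrow> z \<in> gen (insert x J) \<longleftrightarrow> (\<exists>a. z - a * x \<in> J)"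
  by (simp add: gen_insert_iff gen_rideal)

lemma gen_finite_subset: "z \<in> gen (K \<union> Z) \<Longrightarrow> \<exists>F. finite F \<and> F \<subseteq> Z \<and> z \<in> gen (K \<union> F)"
proof -
  let ?U = "{z. \<exists>F. finite F \<and> F \<subseteq> Z \<and> z \<in> gen (K \<union> F)}"
  have "rideal ?U"
  proof (rule ridealI)
    show "0 \<in> ?U" using rideal_0[OF rideal_gen] by blast
  next
    fix a b assume "a \<in> ?U" "b \<in> ?U"
    then obtain F G where FG: "finite F" "F \<subseteq> Z" "a \<in> gen (K \<union> F)"
      "finite G" "G \<subseteq> Z" "b \<in> gen (K \<union> G)" by blast
    have "gen (K \<union> F) \<subseteq> gen (K \<union> (F \<union> G))" "gen (K \<union> G) \<subseteq> gen (K \<union> (F \<union> G))"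
      by (rule gen_mono, blast)+
    then have "a + b \<in> gen (K \<union> (F \<union> G))" using FG by (meson rideal_add rideal_gen subsetD)
    then show "a + b \<in> ?U" using FG by (auto intro!: exI[of _ "F \<union> G"])
  next
    fix r a assume "a \<in> ?U" then show "r * a \<in> ?U" by (blast intro: rideal_mult[OF rideal_gen])
  qed
  moreover have "K \<union> Z \<subseteq> ?U"
  proof
    fix z assume "z \<in> K \<union> Z"
    then show "z \<in> ?U"
    proof
      assume "z \<in> K" then show ?thesis by (auto intro!: exI[of _ "{}"] gen_base)
    next
      assume "z \<in> Z" then show ?thesis by (auto intro!: exI[of _ "{z}"] gen_base)
    qed
  qed
  ultimately show "z \<in> gen (K \<union> Z) \<Longrightarrow> ?thesis" using gen_least by blast
qed

section \<open>Noetherian quotients\<close>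

lemma noeth_rideal: "noeth K \<Longrightarrow> rideal K" by (simp add: noeth_def)

lemma noeth_fg:
  assumes "noeth K" "rideal J" "K \<subseteq> J"
  obtains F where "finite F" "J = gen (K \<union> F)" "F \<subseteq> J"
proof -
  obtain F where "finite F" "J = gen (K \<union> F)" using assms by (auto simp: noeth_def)
  moreover have "F \<subseteq> J" using gen_superset[of "K \<union> F"] calculation by blast
  ultimately show ?thesis using that by blast
qed

lemma noeth_mono: assumes "noeth K" "rideal L" "K \<subseteq> L" shows "noeth L"
  unfolding noeth_def
proof (intro conjI allI impI)
  fix J assume J: "rideal J \<and> L \<subseteq> J"
  then obtain F where F: "finite F" "J = gen (K \<union> F)" "F \<subseteq> J" using noeth_fg[of K J] assms by auto
  have "gen (L \<union> F) \<subseteq> J" using J F by (intro gen_least) auto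
  moreover have "J \<subseteq> gen (L \<union> F)" using gen_mono[of "K \<union> F" "L \<union> F"] F assms by auto
  ultimately show "\<exists>F. finite F \<and> J = gen (L \<union> F)" using F by blast
qed (rule assms)

text \<open>The generators can be taken inside the given \<open>Z\<close>, since each of finitely
  many generators of the ideal involves only finitely many elements of \<open>Z\<close>. This serves
  for generators that must be values of a function or lie in a power of an ideal.\<close>

lemma noeth_finite_subset:
  assumes "noeth K"
  obtains F where "finite F" "F \<subseteq> Z" "Z \<subseteq> gen (K \<union> F)"
proof -
  obtain G where G: "finite G" "gen (K \<union> Z) = gen (K \<union> G)" "G \<subseteq> gen (K \<union> Z)"
    using noeth_fg[OF assms rideal_gen, of "K \<union> Z"] gen_superset[of "K \<union> Z"] by auto
  have "\<exists>F. finite F \<and> F \<subseteq> Z \<and> H \<subseteq> gen (K \<union> F)" if "finite H" "H \<subseteq> gen (K \<union> Z)" for H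
    using that
  proof (induction H)
    case empty then show ?case by (auto intro: exI[of _ "{}"])
  next
    case (insert h H)
    then obtain F where F: "finite F" "F \<subseteq> Z" "H \<subseteq> gen (K \<union> F)" by auto
    obtain F' where F': "finite F'" "F' \<subseteq> Z" "h \<in> gen (K \<union> F')"
      using gen_finite_subset[of h K Z] insert.prems by auto
    have "gen (K \<union> F) \<subseteq> gen (K \<union> (F \<union> F'))" "gen (K \<union> F') \<subseteq> gen (K \<union> (F \<union> F'))"
      by (rule gen_mono, blast)+
    then have "insert h H \<subseteq> gen (K \<union> (F \<union> F'))" using F F' by blast
    then show ?case using F F' by (auto intro!: exI[of _ "F \<union> F'"])
  qed
  then obtain F where F: "finite F" "F \<subseteq> Z" "G \<subseteq> gen (K \<union> F)" using G by meson
  have "K \<union> G \<subseteq> gen (K \<union> F)" using F gen_superset[of "K \<union> F"] by auto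
  then have "gen (K \<union> G) \<subseteq> gen (K \<union> F)" by (rule gen_least[OF rideal_gen])
  then have "Z \<subseteq> gen (K \<union> F)" using G gen_superset[of "K \<union> Z"] by auto
  then show ?thesis using that F by blast
qed

lemma noeth_chain:
  assumes "noeth K" "\<And>n. rideal (J n)" "\<And>n::nat. J n \<subseteq> J (Suc n)" "\<And>n. K \<subseteq> J n"
  obtains N where "\<And>n. n \<ge> N \<Longrightarrow> J n = J N"
proof -
  have mono: "i \<le> j \<Longrightarrow> J i \<subseteq> J j" for i j using lift_Suc_mono_le[of J] assms(3) by blast
  obtain F where F: "finite F" "F \<subseteq> (\<Union>n. J n)" "(\<Union>n. J n) \<subseteq> gen (K \<union> F)"
    using noeth_finite_subset[OF assms(1)] by metis
  have "\<exists>N. F \<subseteq> J N" using F(1,2)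
  proof (induction F)
    case (insert x F)
    then obtain N M where "F \<subseteq> J N" "x \<in> J M" by auto
    then have "insert x F \<subseteq> J (max N M)"
      using mono[of N "max N M"] mono[of M "max N M"] by auto
    then show ?case by blast
  qed simp
  then obtain N where N: "F \<subseteq> J N" by blast
  have "gen (K \<union> F) \<subseteq> J N" using N assms by (intro gen_least) auto
  then have "J n = J N" if "n \<ge> N" for n using F(3) mono[OF that] by blast
  then show ?thesis using that by blast
qed

lemma noeth_wf:
  assumes "noeth K"
  shows "wf {(L, J). rideal J \<and> rideal L \<and> K \<subseteq> J \<and> J \<subset> L}"
  unfolding wf_iff_no_infinite_down_chain
proof
  assume "\<exists>f. \<forall>i. (f (Suc i), f i) \<in> {(L, J). rideal J \<and> rideal L \<and> K \<subseteq> J \<and> J \<subset> L}"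
  then obtain f :: "nat \<Rightarrow> 'a set" where
    f: "(f (Suc i), f i) \<in> {(L, J). rideal J \<and> rideal L \<and> K \<subseteq> J \<and> J \<subset> L}" for i
    by blast
  have fi: "rideal (f i)" "K \<subseteq> f i" "f i \<subset> f (Suc i)" for i using f[of i] by simp_all
  have "f i \<subseteq> f (Suc i)" for i using fi(3)[of i] by blast
  then obtain N where "\<And>n. n \<ge> N \<Longrightarrow> f n = f N"
    by (rule noeth_chain[OF assms fi(1) _ fi(2)]) blast
  then show False using fi(3)[of N] by (metis le_SucI order_refl psubset_eq)
qed

lemma noeth_max:
  assumes "noeth K" "P J" "\<And>J. P J \<Longrightarrow> rideal J" "\<And>J. P J \<Longrightarrow> K \<subseteq> J"
  obtains M where "P M" "J \<subseteq> M" "\<And>L. P L \<Longrightarrow> M \<subseteq> L \<Longrightarrow> L = M"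
proof -
  obtain M where M: "M \<in> {M. P M \<and> J \<subseteq> M}"
     "\<And>L. (L, M) \<in> {(L, J). rideal J \<and> rideal L \<and> K \<subseteq> J \<and> J \<subset> L} \<Longrightarrow> L \<notin> {M. P M \<and> J \<subseteq> M}"
    using wfE_min[OF noeth_wf[OF assms(1)], of J "{M. P M \<and> J \<subseteq> M}"] assms(2) by blast
  show ?thesis
  proof (rule that[of M])
    fix L assume L: "P L" "M \<subseteq> L"
    then have "L \<in> {M. P M \<and> J \<subseteq> M}" using M(1) by auto
    then have "\<not> M \<subset> L" using M(1) M(2)[of L] L assms(3,4) by auto
    then show "L = M" using L by blast
  qed (use M in auto)
qed

section \<open>Prime and maximal ideals\<close>

lemma rprime_rideal: "rprime p \<Longrightarrow> rideal p" by (simp add: rprime_def)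
lemma rprime_one: "rprime p \<Longrightarrow> 1 \<notin> p" by (simp add: rprime_def)
lemma rprime_multD: "rprime p \<Longrightarrow> a * b \<in> p \<Longrightarrow> a \<notin> p \<Longrightarrow> b \<in> p" by (auto simp: rprime_def)
lemma rprime_powD: "rprime p \<Longrightarrow> a ^ n \<in> p \<Longrightarrow> a \<in> p"
  by (induction n) (auto simp: rprime_def)

lemma rmaximal_rprime: assumes "rmaximal m" shows "rprime m"
  unfolding rprime_def
proof (intro conjI allI impI)
  fix a b assume ab: "a * b \<in> m"
  have I: "rideal m" using assms by (simp add: rmaximal_def)
  show "a \<in> m \<or> b \<in> m"
  proof (rule ccontr)
    assume c: "\<not> (a \<in> m \<or> b \<in> m)"
    then obtain u where u: "u * a - 1 \<in> m" using assms by (auto simp: rmaximal_def)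
    have "u * (a * b) - (u * a - 1) * b \<in> m"
      by (rule rideal_diff[OF I rideal_mult[OF I ab] rideal_mult2[OF I u]])
    then show False using c by (simp add: algebra_simps)
  qed
qed (use assms in \<open>auto simp: rmaximal_def\<close>)

lemma maximal_imp_rmaximal:
  assumes "rideal m" "1 \<notin> m" "\<And>L. rideal L \<Longrightarrow> 1 \<notin> L \<Longrightarrow> m \<subseteq> L \<Longrightarrow> L = m"
  shows "rmaximal m"
  unfolding rmaximal_def
proof (intro conjI allI impI)
  fix a assume a: "a \<notin> m"
  have "1 \<in> gen (insert a m)"
  proof (rule ccontr)
    assume "1 \<notin> gen (insert a m)"
    then have "gen (insert a m) = m"
      using assms(3)[OF rideal_gen] gen_superset[of "insert a m"] by blast
    then show False using a gen_superset[of "insert a m"] by blast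
  qed
  then obtain u where "1 - u * a \<in> m" using gen_insert_ideal_iff[OF assms(1)] by blast
  then show "\<exists>u. u * a - 1 \<in> m" using rideal_uminus[OF assms(1), of "1 - u * a"] by auto
qed (use assms in auto)

lemma rmaximal_maximal:
  assumes "rmaximal m" "rideal L" "1 \<notin> L" "m \<subseteq> L" shows "L = m"
proof (rule ccontr)
  assume "L \<noteq> m"
  then obtain a where "a \<in> L" "a \<notin> m" using assms by blast
  then obtain u where "u * a - 1 \<in> L" using assms unfolding rmaximal_def by blast
  then show False using assms \<open>a \<in> L\<close> by (meson rideal_diffD' rideal_mult)
qed

lemma ex_rmaximal:
  assumes "noeth K" "rideal J" "K \<subseteq> J" "1 \<notin> J"
  obtains m where "rmaximal m" "J \<subseteq> m"
proof -
  obtain M where M: "rideal M \<and> J \<subseteq> M \<and> 1 \<notin> M" "J \<subseteq> M"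
     "\<And>L. rideal L \<and> J \<subseteq> L \<and> 1 \<notin> L \<Longrightarrow> M \<subseteq> L \<Longrightarrow> L = M"
    using noeth_max[OF assms(1), of "\<lambda>M. rideal M \<and> J \<subseteq> M \<and> 1 \<notin> M" J] assms by blast
  then have "rmaximal M" by (intro maximal_imp_rmaximal) auto
  then show ?thesis using that M by blast
qed

subsection \<open>Powers and saturations\<close>

text \<open>Powers are formed in the ambient ring; the power in the quotient by \<open>K\<close> is
  \<open>gen (K \<union> ipow J n)\<close>.\<close>

fun ipow :: "'p::comm_ring_1 set \<Rightarrow> nat \<Rightarrow> 'p set" where
  "ipow J 0 = UNIV"
| "ipow J (Suc n) = gen (prods J (ipow J n))"

definition multset :: "'p::comm_ring_1 set \<Rightarrow> bool" where
  "multset S \<longleftrightarrow> 1 \<in> S \<and> (\<forall>s\<in>S. \<forall>t\<in>S. s * t \<in> S)"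

text \<open>For an ideal \<open>J\<close>, this is the contraction of the ideal that
  \<open>J\<close> generates in the localization at \<open>S\<close>.\<close>

definition sat :: "'p::comm_ring_1 set \<Rightarrow> 'p set \<Rightarrow> 'p set" where
  "sat S J = {a. \<exists>s\<in>S. s * a \<in> J}"

lemma rideal_ipow: "rideal (ipow J n)"
  by (cases n) (auto simp: rideal_UNIV rideal_gen)

lemma ipow_mult: "a \<in> J \<Longrightarrow> b \<in> ipow J n \<Longrightarrow> a * b \<in> ipow J (Suc n)"
  by (auto intro!: gen_base)

lemma ipow_power: "a \<in> J \<Longrightarrow> a ^ n \<in> ipow J n"
  by (induction n) (auto intro!: ipow_mult simp del: ipow.simps(2))

lemma ipow_Suc_subset: "ipow J (Suc n) \<subseteq> ipow J n"
  unfolding ipow.simps(2) by (rule gen_least[OF rideal_ipow]) (auto intro: rideal_mult[OF rideal_ipow])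

lemma ipow_antimono: "m \<le> n \<Longrightarrow> ipow J n \<subseteq> ipow J m"
  using lift_Suc_antimono_le[of "ipow J"] ipow_Suc_subset by blast

lemma ipow_mono: "J \<subseteq> L \<Longrightarrow> ipow J n \<subseteq> ipow L n"
  by (induction n) (simp, simp, rule gen_mono, blast)

lemma ipow_1: "rideal J \<Longrightarrow> ipow J (Suc 0) = J"
proof -
  assume J: "rideal J"
  have "{a * b |a b. a \<in> J} = J"
    using rideal_mult2[OF J] by (auto, metis mult.right_neutral)
  then show ?thesis using gen_rideal[OF J] by simp
qed

lemma ipow_subset: "rideal J \<Longrightarrow> n > 0 \<Longrightarrow> ipow J n \<subseteq> J"
  using ipow_antimono[of "Suc 0" n J] ipow_1[of J] by auto

lemma ipow_subset_prime: assumes "rprime p" "ipow J n \<subseteq> p" shows "J \<subseteq> p"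
  using ipow_power rprime_powD[OF assms(1)] assms(2) by blast

lemma ipow_add_subset:
  assumes "rideal M" "\<And>a b. a \<in> ipow J k \<Longrightarrow> b \<in> ipow J l \<Longrightarrow> a * b \<in> M"
  shows "ipow J (k + l) \<subseteq> M"
proof -
  have "a * b \<in> ipow J (k + l) \<and> ipow J (k + l) \<subseteq> gen (prods (ipow J k) (ipow J l))"
    if "b \<in> ipow J l" "a \<in> ipow J k" for a b
    using that
  proof (induction k arbitrary: a b)
    case 0
    have "c \<in> gen (prods (ipow J 0) (ipow J l))" if "c \<in> ipow J l" for c
      using that by (intro gen_base CollectI exI[of _ 1] exI[of _ c]) auto
    then show ?case using rideal_mult[OF rideal_ipow 0(1)] by auto
  next
    case (Suc k)
    let ?C = "{a. \<forall>b\<in>ipow J l. a * b \<in> ipow J (Suc k + l)}"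
    have C: "rideal ?C"
      using rideal_ipow[of J "Suc k + l"] unfolding rideal_def
      by (auto simp: algebra_simps)
    have "c * d * b \<in> ipow J (Suc k + l)" if "c \<in> J" "d \<in> ipow J k" "b \<in> ipow J l" for c d b
      using ipow_mult[of c J "d * b" "k + l"] Suc.IH[of b d] that by (simp add: mult.assoc)
    then have "ipow J (Suc k) \<subseteq> ?C"
      unfolding ipow.simps(2) by (intro gen_least[OF C]) auto
    moreover
    let ?G = "gen (prods (ipow J (Suc k)) (ipow J l))"
    have "c * d \<in> ?G" if c: "c \<in> J" and d: "d \<in> ipow J (k + l)" for c d
    proof -
      have "gen (prods (ipow J k) (ipow J l)) \<subseteq> {d. c * d \<in> ?G}"
      proof (rule gen_least[OF rideal_colon'[OF rideal_gen]], safe)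
        fix a b assume "a \<in> ipow J k" "b \<in> ipow J l"
        then have "(c * a) * b \<in> ?G" using ipow_mult[OF c] by (intro gen_base) blast
        then show "c * (a * b) \<in> ?G" by (simp add: mult.assoc)
      qed
      moreover have "d \<in> gen (prods (ipow J k) (ipow J l))"
        using Suc.IH[of 0 0] d rideal_0[OF rideal_ipow] by blast
      ultimately show ?thesis by blast
    qed
    then have "ipow J (Suc k + l) \<subseteq> ?G"
      unfolding add_Suc ipow.simps(2) by (intro gen_least[OF rideal_gen]) blast
    ultimately show ?case using Suc.prems by blast
  qed
  \<comment> \<open>The inclusion does not mention the two elements, so 0 serves for both.\<close>
  from this[OF rideal_0[OF rideal_ipow] rideal_0[OF rideal_ipow]]
  have "ipow J (k + l) \<subseteq> gen (prods (ipow J k) (ipow J l))" by blast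
  also have "\<dots> \<subseteq> M" using assms by (intro gen_least) auto
  finally show ?thesis .
qed

lemma multset_prime: "rprime p \<Longrightarrow> multset (- p)" by (auto simp: rprime_def multset_def)

lemma sat_superset: "multset S \<Longrightarrow> J \<subseteq> sat S J" by (force simp: multset_def sat_def)

lemma rideal_sat: assumes "multset S" "rideal J" shows "rideal (sat S J)"
proof (rule ridealI)
  show "0 \<in> sat S J" using sat_superset[OF assms(1)] rideal_0[OF assms(2)] by blast
next
  fix a b assume "a \<in> sat S J" "b \<in> sat S J"
  then obtain s t where "s \<in> S" "t \<in> S" "s * a \<in> J" "t * b \<in> J" by (auto simp: sat_def)
  then have "s * t \<in> S" "t * (s * a) + s * (t * b) \<in> J"
    using assms by (auto simp: multset_def intro!: rideal_add rideal_mult)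
  then show "a + b \<in> sat S J" by (auto simp: sat_def algebra_simps intro!: bexI[of _ "s * t"])
next
  fix r a assume "a \<in> sat S J"
  then obtain s where s: "s \<in> S" "s * a \<in> J" by (auto simp: sat_def)
  then have "s * (r * a) \<in> J" using rideal_mult[OF assms(2), of "s * a" r] by (simp add: algebra_simps)
  then show "r * a \<in> sat S J" using s by (auto simp: sat_def)
qed

lemma sat_mono: "J \<subseteq> L \<Longrightarrow> sat S J \<subseteq> sat S L" by (auto simp: sat_def)

lemma sat_sat: assumes "multset S" "s \<in> S" "s * a \<in> sat S J" shows "a \<in> sat S J"
proof -
  obtain t where "t \<in> S" "t * (s * a) \<in> J" using assms by (auto simp: sat_def)
  then have "t * s \<in> S" "(t * s) * a \<in> J" using assms by (auto simp: multset_def mult.assoc)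
  then show ?thesis by (auto simp: sat_def)
qed

lemma sat_closed: "multset S \<Longrightarrow> \<forall>s\<in>S. \<forall>a. s * a \<in> sat S J \<longrightarrow> a \<in> sat S J"
  using sat_sat by blast

text \<open>A maximal \<open>S\<close>-saturated ideal containing no power of \<open>J\<close> would be prime and disjoint
  from \<open>S\<close>.\<close>

lemma ipow_subset_sat:
  assumes N: "noeth M" and S: "multset S"
    and J: "\<And>r. rprime r \<Longrightarrow> M \<subseteq> r \<Longrightarrow> r \<inter> S = {} \<Longrightarrow> J \<subseteq> r"
  obtains k where "ipow J k \<subseteq> sat S M"
proof (rule ccontr)
  assume "\<not> thesis"
  then have no: "\<not> ipow J k \<subseteq> sat S M" for k using that by blast
  note M = noeth_rideal[OF N]
  let ?P = "\<lambda>L. rideal L \<and> sat S M \<subseteq> L \<and> (\<forall>s\<in>S. \<forall>a. s * a \<in> L \<longrightarrow> a \<in> L) \<and> (\<forall>k. \<not> ipow J k \<subseteq> L)"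
  have MS: "M \<subseteq> sat S M" by (rule sat_superset[OF S])
  have P0: "?P (sat S M)"
    using rideal_sat[OF S M] sat_closed[OF S] no by simp
  obtain r where r: "?P r" "\<And>L. ?P L \<Longrightarrow> r \<subseteq> L \<Longrightarrow> L = r"
  proof (rule noeth_max[OF N, of ?P "sat S M"])
    show "?P (sat S M)" by (rule P0)
    show "rideal L" if "?P L" for L using that by simp
    show "M \<subseteq> L" if "?P L" for L using MS that by (meson order_trans)
  qed metis
  have ri: "rideal r" using r(1) by simp
  have cl: "a \<in> r" if "s \<in> S" "s * a \<in> r" for s a
    using conjunct1[OF conjunct2[OF conjunct2[OF r(1)]]] that by blast
  have big: "\<exists>k. ipow J k \<subseteq> sat S (gen (insert a r))" if "a \<notin> r" for a
  proof (rule ccontr)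
    assume "\<not> ?thesis"
    then have no': "\<not> ipow J k \<subseteq> sat S (gen (insert a r))" for k by simp
    have sub: "insert a r \<subseteq> sat S (gen (insert a r))"
      using gen_superset sat_superset[OF S] by (rule order_trans)
    then have "sat S M \<subseteq> sat S (gen (insert a r))" using r(1) by (simp add: subset_iff)
    then have "?P (sat S (gen (insert a r)))"
      using rideal_sat[OF S rideal_gen] sat_closed[OF S] no' by simp
    then have "sat S (gen (insert a r)) = r" by (rule r(2)) (use sub in simp)
    then show False using sub that by simp
  qed
  have disj: "r \<inter> S = {}"
  proof (rule ccontr)
    assume "r \<inter> S \<noteq> {}"
    then obtain s where "s \<in> S" "s * 1 \<in> r" by auto
    then have "1 \<in> r" by (rule cl)
    then have "r = UNIV" by (rule rideal_one[OF ri])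
    then show False using r(1) by simp
  qed
  have "rprime r" unfolding rprime_def
  proof (intro conjI allI impI)
    show "1 \<notin> r" using disj S by (auto simp: multset_def)
    fix a b assume ab: "a * b \<in> r"
    show "a \<in> r \<or> b \<in> r"
    proof (rule ccontr)
      assume "\<not> (a \<in> r \<or> b \<in> r)"
      then obtain k l where kl: "ipow J k \<subseteq> sat S (gen (insert a r))" "ipow J l \<subseteq> sat S (gen (insert b r))"
        using big by blast
      have "u * v \<in> r" if uv: "u \<in> ipow J k" "v \<in> ipow J l" for u v
      proof -
        obtain s t where st: "s \<in> S" "t \<in> S" "s * u \<in> gen (insert a r)" "t * v \<in> gen (insert b r)"
          using subsetD[OF kl(1) uv(1)] subsetD[OF kl(2) uv(2)] unfolding sat_def by blast
        then obtain c d where cd: "s * u - c * a \<in> r" "t * v - d * b \<in> r"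
          using gen_insert_ideal_iff[OF ri] by blast
        have "(s * u - c * a) * (t * v) + c * a * (t * v - d * b) + c * d * (a * b) \<in> r"
          by (intro rideal_add[OF ri] rideal_mult2[OF ri cd(1)] rideal_mult[OF ri cd(2)] rideal_mult[OF ri ab])
        also have "(s * u - c * a) * (t * v) + c * a * (t * v - d * b) + c * d * (a * b) = s * (t * (u * v))"
          by (simp add: algebra_simps)
        finally have "s * (t * (u * v)) \<in> r" .
        then show "u * v \<in> r" by (rule cl[OF st(2) cl[OF st(1)]])
      qed
      then have "ipow J (k + l) \<subseteq> r" by (intro ipow_add_subset[OF ri])
      then show False using r(1) by simp
    qed
  qed (rule ri)
  moreover have "M \<subseteq> r" using MS r(1) by (meson order_trans)
  ultimately have "J \<subseteq> r" by (rule J[OF _ _ disj])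
  then have "ipow J (Suc 0) \<subseteq> r" using ipow_mono[of J r "Suc 0"] ipow_1[OF ri] by simp
  then show False using conjunct2[OF conjunct2[OF conjunct2[OF r(1)]]] by metis
qed

text \<open>Saturating at \<open>{1}\<close> changes nothing, and a prime never meets
  \<open>{1}\<close>.\<close>

lemma ipow_subset_of_primes:
  assumes "noeth M" "\<And>r. rprime r \<Longrightarrow> M \<subseteq> r \<Longrightarrow> J \<subseteq> r"
  obtains k where "ipow J k \<subseteq> M"
proof -
  have "multset {1}" by (simp add: multset_def)
  then obtain k where "ipow J k \<subseteq> sat {1} M" using ipow_subset_sat[of M "{1}" J] assms by blast
  then show ?thesis using that by (auto simp: sat_def)
qed

section \<open>Nakayama's lemma and the descending chain condition modulo a power of a prime\<close>

text \<open>The point is that the coefficient of \<open>x\<close> stays in \<open>p\<close>. In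
  Nakayama's lemma this keeps \<open>s - c\<close> outside \<open>p\<close>; for the completion,
  with a power of the ideal in place of \<open>p\<close>, it makes the coefficients small enough to
  be summed.\<close>

lemma gen_insert_prod:
  assumes "z \<in> gen (L \<union> prods p (insert x Z))" "rideal p"
  shows "\<exists>c\<in>p. z - c * x \<in> gen (L \<union> prods p Z)"
proof -
  let ?G = "gen (L \<union> prods p Z)"
  let ?C = "{z. \<exists>c\<in>p. z - c * x \<in> ?G}"
  have "rideal ?C"
  proof (rule ridealI)
    show "0 \<in> ?C" using rideal_0[OF rideal_gen] rideal_0[OF assms(2)] by force
  next
    fix a b assume "a \<in> ?C" "b \<in> ?C"
    then obtain c d where cd: "c \<in> p" "d \<in> p" "a - c * x \<in> ?G" "b - d * x \<in> ?G" by blast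
    have "(a - c * x) + (b - d * x) \<in> ?G" by (rule rideal_add[OF rideal_gen cd(3,4)])
    also have "(a - c * x) + (b - d * x) = a + b - (c + d) * x" by (simp add: algebra_simps)
    finally show "a + b \<in> ?C" using rideal_add[OF assms(2) cd(1,2)] by blast
  next
    fix r a assume "a \<in> ?C"
    then obtain c where c: "c \<in> p" "a - c * x \<in> ?G" by blast
    have "r * (a - c * x) \<in> ?G" by (rule rideal_mult[OF rideal_gen c(2)])
    also have "r * (a - c * x) = r * a - (r * c) * x" by (simp add: algebra_simps)
    finally show "r * a \<in> ?C" using rideal_mult[OF assms(2) c(1)] by blast
  qed
  moreover have "w \<in> ?C" if w: "w \<in> L \<union> prods p (insert x Z)" for w
  proof -
    consider "w \<in> L" | a where "a \<in> p" "w = a * x" | a y where "a \<in> p" "y \<in> Z" "w = a * y"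
      using w by blast
    then show ?thesis
    proof cases
      case 1
      then have "w - 0 * x \<in> ?G" by (simp add: gen_base)
      then show ?thesis using rideal_0[OF assms(2)] by blast
    next
      case 2
      then have "w - a * x \<in> ?G" by (simp add: rideal_0[OF rideal_gen])
      then show ?thesis using 2 by blast
    next
      case 3
      then have "w - 0 * x \<in> ?G" by (auto intro!: gen_base)
      then show ?thesis using rideal_0[OF assms(2)] by blast
    qed
  qed
  then have "L \<union> prods p (insert x Z) \<subseteq> ?C" by (rule subsetI)
  ultimately have "gen (L \<union> prods p (insert x Z)) \<subseteq> ?C" by (rule gen_least)
  then show ?thesis using assms(1) by blast
qed

lemma gen_prod_mult:
  assumes "a \<in> p" "rideal p" "b \<in> gen (L \<union> F)"
  shows "a * b \<in> gen (L \<union> prods p F)"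
proof -
  let ?G = "gen (L \<union> prods p F)"
  have "L \<union> F \<subseteq> {b. a * b \<in> ?G}"
  proof
    fix w assume "w \<in> L \<union> F"
    then show "w \<in> {b. a * b \<in> ?G}"
    proof
      assume "w \<in> L"
      then have "a * w \<in> ?G" by (intro rideal_mult[OF rideal_gen] gen_base UnI1)
      then show ?thesis by simp
    next
      assume "w \<in> F"
      then have "a * w \<in> ?G" using assms(1) by (intro gen_base) blast
      then show ?thesis by simp
    qed
  qed
  then have "gen (L \<union> F) \<subseteq> {b. a * b \<in> ?G}" by (rule gen_least[OF rideal_colon'[OF rideal_gen]])
  then show ?thesis using assms(3) by blast
qed

text \<open>Generators are eliminated one at a time instead of by a determinant: the relation for
  \<open>x\<close> expresses \<open>(s - c) * x\<close> through the remaining generators, and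
  \<open>s - c\<close> is invertible locally at \<open>p\<close>.\<close>

lemma nakayama_sat:
  assumes "finite F" "rprime p" "rideal L"
    and "\<And>x. x \<in> F \<Longrightarrow> x \<in> sat (- p) (gen (L \<union> prods p F))"
  shows "F \<subseteq> sat (- p) L"
  using assms(1,4)
proof (induction F)
  case (insert x F)
  let ?G = "gen (L \<union> prods p F)"
  note p = rprime_rideal[OF assms(2)]
  obtain s where s: "s \<notin> p" "s * x \<in> gen (L \<union> prods p (insert x F))"
    using insert.prems[of x] unfolding sat_def by blast
  obtain c where c: "c \<in> p" "s * x - c * x \<in> ?G" using gen_insert_prod[OF s(2) p] by blast
  have sc: "s - c \<notin> p" using s(1) c(1) rideal_diffD[OF p] by blast
  have "y \<in> sat (- p) ?G" if y: "y \<in> F" for y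
  proof -
    obtain t where t: "t \<notin> p" "t * y \<in> gen (L \<union> prods p (insert x F))"
      using insert.prems[of y] y unfolding sat_def by blast
    obtain d where d: "d \<in> p" "t * y - d * x \<in> ?G" using gen_insert_prod[OF t(2) p] by blast
    \<comment> \<open>The relations for \<open>y\<close> and \<open>x\<close> are combined so that
      the terms in \<open>x\<close> cancel.\<close>
    have "(s - c) * (t * y - d * x) + d * (s * x - c * x) \<in> ?G"
      by (intro rideal_add[OF rideal_gen] rideal_mult[OF rideal_gen] c(2) d(2))
    also have "(s - c) * (t * y - d * x) + d * (s * x - c * x) = (s - c) * t * y"
      by (simp add: algebra_simps)
    finally show ?thesis using sc t(1) assms(2) unfolding sat_def rprime_def by blast
  qed
  then have IH: "F \<subseteq> sat (- p) L" by (rule insert.IH)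
  note S = rideal_sat[OF multset_prime[OF assms(2)] assms(3)]
  have "L \<union> prods p F \<subseteq> sat (- p) L"
    using sat_superset[OF multset_prime[OF assms(2)], of L] IH rideal_mult[OF S] by blast
  then have "?G \<subseteq> sat (- p) L" by (rule gen_least[OF S])
  then have "(s - c) * x \<in> sat (- p) L" using c(2) by (auto simp: left_diff_distrib)
  then have "x \<in> sat (- p) L" using sat_sat[OF multset_prime[OF assms(2)], of "s - c" x L] sc by simp
  then show ?case using IH by simp
qed simp

text \<open>The products of \<open>p\<close> with \<open>K\<close> are absorbed by \<open>L\<close>,
  so finitely many generators of \<open>M\<close> over \<open>K\<close> suffice.\<close>

lemma noeth_nakayama_sat:
  assumes "noeth K" "rprime p" "rideal L" "K \<subseteq> L" "rideal M" "K \<subseteq> M"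
    and "M \<subseteq> sat (- p) (gen (L \<union> prods p M))"
  shows "M \<subseteq> sat (- p) L"
proof -
  obtain F where F: "finite F" "M = gen (K \<union> F)" "F \<subseteq> M" using noeth_fg[OF assms(1,5,6)] by blast
  note p = rprime_rideal[OF assms(2)]
  let ?G = "gen (L \<union> prods p F)"
  have "L \<union> prods p M \<subseteq> ?G"
  proof
    fix w assume "w \<in> L \<union> prods p M"
    then consider "w \<in> L" | a y where "w = a * y" "a \<in> p" "y \<in> M" by blast
    then show "w \<in> ?G"
    proof cases
      case 2
      have "M \<subseteq> gen (L \<union> F)" unfolding F(2) by (rule gen_mono) (use assms(4) in blast)
      then show ?thesis using gen_prod_mult[OF 2(2) p, of y L F] 2 by blast
    qed (simp add: gen_base)
  qed
  then have "gen (L \<union> prods p M) \<subseteq> ?G" by (rule gen_least[OF rideal_gen])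
  then have MG: "M \<subseteq> sat (- p) ?G" using assms(7) sat_mono by blast
  have "F \<subseteq> sat (- p) L"
    by (rule nakayama_sat[OF F(1) assms(2,3)]) (use F(3) MG in blast)
  moreover have "K \<subseteq> sat (- p) L" using sat_superset[OF multset_prime[OF assms(2)], of L] assms(4) by blast
  ultimately show ?thesis unfolding F(2)
    by (intro gen_least[OF rideal_sat[OF multset_prime[OF assms(2)] assms(3)]]) simp
qed

text \<open>Locally at \<open>p\<close> the quotient \<open>L 0 / B\<close> is a finite-dimensional vector space over the residue
  field, \<open>B\<close> being the intersection of the chain.  If \<open>y n \<in> L n - L (n + 1)\<close> at each strict step, then
  the \<open>y n\<close> are linearly independent.\<close>

lemma prime_killed_chain:
  fixes L :: "nat \<Rightarrow> 'p::comm_ring_1 set"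
  assumes K: "noeth K" and p: "rprime p"
    and L: "\<And>n. rideal (L n)" "\<And>n. L (Suc n) \<subseteq> L n" "\<And>n. K \<subseteq> L n"
    and cl: "\<And>n s a. s \<notin> p \<Longrightarrow> s * a \<in> L n \<Longrightarrow> a \<in> L n"
    and kill: "\<And>a y n. a \<in> p \<Longrightarrow> y \<in> L 0 \<Longrightarrow> a * y \<in> L n"
  obtains N where "\<And>n. n \<ge> N \<Longrightarrow> L n = L N"
proof -
  have mono: "i \<le> j \<Longrightarrow> L j \<subseteq> L i" for i j using lift_Suc_antimono_le[of L] L(2) by blast
  \<comment> \<open>The value 0 marks a step where the chain does not drop.\<close>
  define y where "y n = (if L n = L (Suc n) then 0 else (SOME z. z \<in> L n \<and> z \<notin> L (Suc n)))" for n
  have y0: "y n = 0 \<longleftrightarrow> L n = L (Suc n)" and yL: "y n \<in> L n"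
    and y1: "y n \<in> L (Suc n) \<Longrightarrow> y n = 0" for n
  proof -
    have "y n \<in> L n \<and> y n \<notin> L (Suc n)" if ne: "L n \<noteq> L (Suc n)"
    proof -
      have "\<exists>z. z \<in> L n \<and> z \<notin> L (Suc n)" using L(2)[of n] ne by blast
      then show ?thesis unfolding y_def if_not_P[OF ne] by (rule someI_ex)
    qed
    moreover have "y n = 0" if "L n = L (Suc n)" using that by (simp add: y_def)
    ultimately show "y n = 0 \<longleftrightarrow> L n = L (Suc n)" "y n \<in> L n" "y n \<in> L (Suc n) \<Longrightarrow> y n = 0"
      using rideal_0[OF L(1)] by metis+
  qed
  define B where "B = {z. \<forall>n. z \<in> L n}"
  have B: "rideal B" using L(1) unfolding B_def rideal_def by blast
  \<comment> \<open>Independence of the nonzero \<open>y n\<close> becomes finiteness here: the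
    ideals that they generate must be stationary from some index on.\<close>
  define G where "G n = gen (K \<union> y ` {..<n})" for n
  have "G n \<subseteq> G (Suc n)" for n unfolding G_def by (rule gen_mono) auto
  moreover have "K \<subseteq> G n" for n unfolding G_def using gen_superset by blast
  moreover have "rideal (G n)" for n unfolding G_def by (rule rideal_gen)
  ultimately obtain N where N: "\<And>n. n \<ge> N \<Longrightarrow> G n = G N" using noeth_chain[OF K, of G] by metis
  \<comment> \<open>Linear independence modulo \<open>B\<close>, with the coefficient of least index
    treated first.\<close>
  have key: "z \<in> L M \<Longrightarrow> z \<in> gen (B \<union> y ` {M - k..<M}) \<Longrightarrow> k \<le> M \<Longrightarrow> z \<in> B" for z M k
  proof (induction k arbitrary: z)
    case 0
    then show ?case by (simp add: gen_rideal[OF B])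
  next
    case (Suc k)
    define j where "j = M - Suc k"
    have j: "M - k = Suc j" "j < M" using Suc.prems by (auto simp: j_def)
    have "{j..<M} = insert j {Suc j..<M}" using j by auto
    then have "z \<in> gen (insert (y j) (B \<union> y ` {Suc j..<M}))" using Suc.prems(2) by (simp add: j_def)
    then obtain a where a: "z - a * y j \<in> gen (B \<union> y ` {Suc j..<M})" using gen_insert_iff by blast
    \<comment> \<open>The later \<open>y\<close> and also \<open>z\<close> lie in
      \<open>L (Suc j)\<close>, so \<open>a * y j\<close> does too. Either \<open>a\<close> is in
      \<open>p\<close> and multiplies \<open>L 0\<close> into \<open>B\<close>, or \<open>a\<close>
      is invertible locally at \<open>p\<close> and \<open>y j = 0\<close>.\<close>
    have "gen (B \<union> y ` {Suc j..<M}) \<subseteq> L (Suc j)"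
    proof (rule gen_least[OF L(1)])
      show "B \<union> y ` {Suc j..<M} \<subseteq> L (Suc j)" using yL mono unfolding B_def by fastforce
    qed
    moreover have "z \<in> L (Suc j)" using Suc.prems(1) mono[of "Suc j" M] j by auto
    ultimately have ay: "a * y j \<in> L (Suc j)" using a rideal_diffD'[OF L(1)] by blast
    have "a * y j \<in> B"
    proof (cases "a \<in> p")
      case True
      have "y j \<in> L 0" using yL mono[of 0 j] by auto
      then show ?thesis unfolding B_def using kill[OF True] by blast
    next
      case False
      then have "y j = 0" using cl[OF _ ay] y1 by blast
      then show ?thesis by (simp add: rideal_0[OF B])
    qed
    then have "a * y j \<in> gen (B \<union> y ` {Suc j..<M})" by (intro gen_base) simp
    then have "z \<in> gen (B \<union> y ` {Suc j..<M})" using a rideal_diffD[OF rideal_gen] by blast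
    then show ?case using Suc.IH[OF Suc.prems(1)] Suc.prems(3) j by simp
  qed
  have step: "L (Suc n) = L n" if n: "n \<ge> N" for n
  proof -
    have "y n \<in> G (Suc n)" unfolding G_def by (intro gen_base) simp
    then have "y n \<in> G n" using N[of n] N[of "Suc n"] n by simp
    \<comment> \<open>\<open>{n - n..<n}\<close> is \<open>{..<n}\<close> in the shape of
      \<open>key\<close> with \<open>k = n\<close>.\<close>
    moreover have "G n \<subseteq> gen (B \<union> y ` {n - n..<n})" unfolding G_def
      by (rule gen_mono) (use L(3) in \<open>auto simp: B_def\<close>)
    ultimately have "y n \<in> B" using key[OF yL, of n n] by blast
    then show ?thesis using y1 y0 unfolding B_def by blast
  qed
  have "L n = L N" if "n \<ge> N" for n using that by (induction n rule: dec_induct) (auto simp: step)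
  then show ?thesis using that by blast
qed

text \<open>Modulo \<open>p ^ k\<close> the ring is Artinian locally at \<open>p\<close>. The chain
  is filtered by \<open>H i n\<close>, the saturation of \<open>L n + p ^ i\<close>: once
  \<open>H i\<close> is stationary, \<open>p\<close> multiplies \<open>H (Suc i)\<close> into all
  its later members, so the vector space argument applies; and \<open>H k n = L n\<close> because
  \<open>p ^ k\<close> lies in \<open>L n\<close>.\<close>

lemma saturated_chain_stable:
  fixes L :: "nat \<Rightarrow> 'p::comm_ring_1 set"
  assumes K: "noeth K" and p: "rprime p"
    and L: "\<And>n. rideal (L n)" "\<And>n. L (Suc n) \<subseteq> L n" "\<And>n. K \<subseteq> L n"
    and cl: "\<And>n s a. s \<notin> p \<Longrightarrow> s * a \<in> L n \<Longrightarrow> a \<in> L n"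
    and pk: "\<And>n. ipow p k \<subseteq> L n"
  obtains N where "\<And>n. n \<ge> N \<Longrightarrow> L n = L N"
proof -
  note S = multset_prime[OF p]
  define H where "H i n = sat (- p) (gen (L n \<union> ipow p i))" for i n
  have H: "rideal (H i n)" for i n unfolding H_def by (rule rideal_sat[OF S rideal_gen])
  have LH: "L n \<subseteq> H i n" for i n
    unfolding H_def using sat_superset[OF S] gen_superset by blast
  have Hdec: "H i (Suc n) \<subseteq> H i n" for i n
    unfolding H_def by (intro sat_mono gen_mono) (use L(2) in blast)
  have Hcl: "a \<in> H i n" if "s \<notin> p" "s * a \<in> H i n" for i n s a
    using that sat_sat[OF S] unfolding H_def by blast
  have "\<exists>N. \<forall>n\<ge>N. H i n = H i N" for i
  proof (induction i)
    case 0
    have "H 0 n = UNIV" for n unfolding H_def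
      using sat_superset[OF S, of "gen (L n \<union> ipow p 0)"] gen_superset[of "L n \<union> ipow p 0"] by auto
    then show ?case by simp
  next
    case (Suc i)
    then obtain N where N: "\<And>n. n \<ge> N \<Longrightarrow> H i n = H i N" by blast
    have sub: "H (Suc i) n \<subseteq> H i n" for n
      unfolding H_def by (intro sat_mono gen_mono) (use ipow_Suc_subset in blast)
    have kill: "a * y \<in> H (Suc i) (N + n)" if a: "a \<in> p" and y: "y \<in> H (Suc i) (N + 0)" for a y n
    proof -
      have "y \<in> H i (N + n)" using y sub[of N] N[of "N + n"] by auto
      then obtain s where s: "s \<notin> p" "s * y \<in> gen (L (N + n) \<union> ipow p i)" unfolding H_def sat_def by blast
      then obtain u v where uv: "u \<in> L (N + n)" "v \<in> ipow p i" "s * y = u + v"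
        using gen_Un_iff[OF L(1) rideal_ipow] by blast
      have "s * (a * y) = a * u + a * v" using uv(3) by (metis distrib_left mult.left_commute)
      also have "\<dots> \<in> gen (L (N + n) \<union> ipow p (Suc i))"
        by (rule rideal_add[OF rideal_gen gen_base gen_base])
           (use rideal_mult[OF L(1) uv(1)] ipow_mult[OF a uv(2)] in blast)+
      finally show ?thesis using s(1) unfolding H_def sat_def by blast
    qed
    obtain N' where N': "\<And>n. n \<ge> N' \<Longrightarrow> H (Suc i) (N + n) = H (Suc i) (N + N')"
    proof (rule prime_killed_chain[OF K p, of "\<lambda>n. H (Suc i) (N + n)"])
      show "H (Suc i) (N + Suc n) \<subseteq> H (Suc i) (N + n)" for n using Hdec by simp
      show "K \<subseteq> H (Suc i) (N + n)" for n using L(3) LH by blast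
    qed (use H Hcl kill in auto)
    have "H (Suc i) n = H (Suc i) (N + N')" if "n \<ge> N + N'" for n
      using N'[of "n - N"] that by simp
    then show ?case by blast
  qed
  then obtain N where N: "\<And>n. n \<ge> N \<Longrightarrow> H k n = H k N" by blast
  have "H k n = L n" for n
  proof -
    have "gen (L n \<union> ipow p k) \<subseteq> L n" by (rule gen_least[OF L(1)]) (use pk in blast)
    then have "H k n \<subseteq> L n" unfolding H_def sat_def using cl by blast
    then show ?thesis using LH by blast
  qed
  then show ?thesis using that N by metis
qed

section \<open>Krull's height theorem\<close>

text \<open>\<open>Q n\<close> is the \<open>n\<close>-th symbolic power of \<open>q\<close> modulo \<open>r\<close>; saturation at \<open>p\<close> and \<open>q\<close> stands for
  localization.\<close>

theorem krull_principal_ideal: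
  assumes K: "noeth r" and r: "rprime r" and p: "rprime p" and q: "rprime q"
    and rq: "r \<subseteq> q" and qp: "q \<subset> p" and x: "x \<in> p"
    and minimal: "\<And>t. rprime t \<Longrightarrow> r \<subseteq> t \<Longrightarrow> x \<in> t \<Longrightarrow> t \<subseteq> p \<Longrightarrow> t = p"
  shows "q = r"
proof -
  note Sp = multset_prime[OF p] and Sq = multset_prime[OF q]
  note ri = rprime_rideal[OF r] and pi = rprime_rideal[OF p] and qi = rprime_rideal[OF q]
  have xq: "x \<notin> q" using minimal[OF q rq] qp by blast
  have nX: "noeth (gen (insert x r))"
    by (rule noeth_mono[OF K rideal_gen]) (use gen_superset in blast)
  \<comment> \<open>\<open>p\<close> is minimal over \<open>r + (x)\<close>, so a power of
    \<open>p\<close> lies in that ideal locally, and descending saturated chains above it become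
    stationary.\<close>
  obtain k where k: "ipow p k \<subseteq> sat (- p) (gen (insert x r))"
  proof (rule ipow_subset_sat[OF nX Sp])
    fix t assume t: "rprime t" "gen (insert x r) \<subseteq> t" "t \<inter> - p = {}"
    then have "insert x r \<subseteq> t" using gen_superset[of "insert x r"] by blast
    then have "t = p" using t by (intro minimal) auto
    then show "p \<subseteq> t" by simp
  qed blast
  define Q where "Q n = sat (- q) (gen (r \<union> ipow q n))" for n
  have Q: "rideal (Q n)" for n unfolding Q_def by (rule rideal_sat[OF Sq rideal_gen])
  have rQ: "r \<subseteq> Q n" for n unfolding Q_def using sat_superset[OF Sq] gen_superset by blast
  have iQ: "ipow q n \<subseteq> Q n" for n unfolding Q_def using sat_superset[OF Sq] gen_superset by blast
  have Qcl: "a \<in> Q n" if "s \<notin> q" "s * a \<in> Q n" for s a n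
    using that sat_sat[OF Sq] unfolding Q_def by blast
  have Qdec: "Q (Suc n) \<subseteq> Q n" for n
    unfolding Q_def by (intro sat_mono gen_mono) (use ipow_Suc_subset in blast)
  obtain N where N: "\<And>n. n \<ge> N \<Longrightarrow>
      sat (- p) (gen (insert x (Q n))) = sat (- p) (gen (insert x (Q N)))"
  proof (rule saturated_chain_stable[OF K p, of "\<lambda>n. sat (- p) (gen (insert x (Q n)))" k])
    fix n
    show "rideal (sat (- p) (gen (insert x (Q n))))" by (rule rideal_sat[OF Sp rideal_gen])
    show "sat (- p) (gen (insert x (Q (Suc n)))) \<subseteq> sat (- p) (gen (insert x (Q n)))"
      by (intro sat_mono gen_mono) (use Qdec in blast)
    have sub: "gen (insert x r) \<subseteq> gen (insert x (Q n))" by (rule gen_mono) (use rQ in blast)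
    then show "r \<subseteq> sat (- p) (gen (insert x (Q n)))"
      using sat_superset[OF Sp] gen_superset[of "insert x r"] by blast
    show "ipow p k \<subseteq> sat (- p) (gen (insert x (Q n)))" using k sat_mono[OF sub] by blast
    show "a \<in> sat (- p) (gen (insert x (Q n)))"
      if "s \<notin> p" "s * a \<in> sat (- p) (gen (insert x (Q n)))" for s a
      using that sat_sat[OF Sp] by blast
  qed blast
  \<comment> \<open>Locally at \<open>p\<close>, stability modulo \<open>x\<close> gives
    \<open>Q N = Q (Suc N) + x * Q N\<close>: the cofactor \<open>b\<close> of \<open>x\<close> is
    again in \<open>Q N\<close>, since \<open>x\<close> is outside \<open>q\<close>. Nakayama's
    lemma drops the second summand.\<close>
  have "Q N \<subseteq> sat (- p) (Q (Suc N))"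
  proof (rule noeth_nakayama_sat[OF K p Q rQ Q rQ], rule subsetI)
    fix a assume a: "a \<in> Q N"
    have "a \<in> sat (- p) (gen (insert x (Q N)))"
      by (rule subsetD[OF sat_superset[OF Sp]], rule gen_base) (use a in blast)
    then have "a \<in> sat (- p) (gen (insert x (Q (Suc N))))" using N[of "Suc N"] by simp
    then obtain s where s: "s \<notin> p" "s * a \<in> gen (insert x (Q (Suc N)))" unfolding sat_def by blast
    then obtain b where b: "s * a - b * x \<in> Q (Suc N)" using gen_insert_ideal_iff[OF Q] by blast
    then have "s * a - b * x \<in> Q N" using Qdec by blast
    then have "b * x \<in> Q N" by (rule rideal_diffD'[OF Q _ rideal_mult[OF Q a]])
    then have "b \<in> Q N" using Qcl[OF xq, of b] by (simp add: mult.commute)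
    then have "b * x \<in> gen (Q (Suc N) \<union> prods p (Q N))"
      using x by (intro gen_base UnI2 CollectI exI[of _ x] exI[of _ b]) (simp add: mult.commute)
    then have "s * a \<in> gen (Q (Suc N) \<union> prods p (Q N))"
      by (rule rideal_diffD[OF rideal_gen gen_base[OF UnI1[OF b]]])
    then show "a \<in> sat (- p) (gen (Q (Suc N) \<union> prods p (Q N)))"
      using s(1) unfolding sat_def by blast
  qed
  also have "sat (- p) (Q (Suc N)) \<subseteq> Q (Suc N)" using Qcl qp unfolding sat_def by blast
  finally have QQ: "Q N \<subseteq> Q (Suc N)" .
  \<comment> \<open>Nakayama's lemma once more, now at \<open>q\<close>: equality of consecutive
    symbolic powers puts \<open>?M\<close> into \<open>r + q * ?M\<close> locally, so
    \<open>q ^ N\<close> vanishes modulo \<open>r\<close>.\<close>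
  let ?M = "gen (r \<union> ipow q N)"
  have rM: "r \<subseteq> ?M" using gen_superset by blast
  have "?M \<subseteq> sat (- q) r"
  proof (rule noeth_nakayama_sat[OF K q ri order_refl rideal_gen rM])
    have "ipow q (Suc N) \<subseteq> gen (r \<union> prods q ?M)"
      unfolding ipow.simps(2)
    proof (rule gen_mono, rule subsetI)
      fix z assume "z \<in> prods q (ipow q N)"
      moreover have "ipow q N \<subseteq> ?M" using gen_superset by blast
      ultimately show "z \<in> r \<union> prods q ?M" by blast
    qed
    moreover have "r \<subseteq> gen (r \<union> prods q ?M)" using gen_superset by blast
    ultimately have "gen (r \<union> ipow q (Suc N)) \<subseteq> gen (r \<union> prods q ?M)"
      by (intro gen_least[OF rideal_gen]) simp
    then have "Q (Suc N) \<subseteq> sat (- q) (gen (r \<union> prods q ?M))"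
      unfolding Q_def by (rule sat_mono)
    moreover have "?M \<subseteq> Q N" unfolding Q_def by (rule sat_superset[OF Sq])
    ultimately show "?M \<subseteq> sat (- q) (gen (r \<union> prods q ?M))" using QQ by blast
  qed
  also have "sat (- q) r \<subseteq> r" using rprime_multD[OF r] rq unfolding sat_def by blast
  finally have "ipow q N \<subseteq> r" using gen_superset by blast
  then have "q \<subseteq> r" by (rule ipow_subset_prime[OF r])
  then show ?thesis using rq by blast
qed

section \<open>Heights of primes\<close>

fun height_ge :: "'p::comm_ring_1 set \<Rightarrow> 'p set \<Rightarrow> nat \<Rightarrow> bool" where
  "height_ge K p 0 \<longleftrightarrow> rprime p \<and> K \<subseteq> p"
| "height_ge K p (Suc n) \<longleftrightarrow> rprime p \<and> (\<exists>q. q \<subset> p \<and> height_ge K q n)"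

definition minimal_over :: "'p::comm_ring_1 set \<Rightarrow> 'p set \<Rightarrow> bool" where
  "minimal_over Y p \<longleftrightarrow> rprime p \<and> Y \<subseteq> p \<and> (\<forall>t. rprime t \<and> Y \<subseteq> t \<and> t \<subseteq> p \<longrightarrow> t = p)"

lemma height_ge_prime: "height_ge K p n \<Longrightarrow> rprime p \<and> K \<subseteq> p"
proof (induction n arbitrary: p)
  case (Suc n)
  obtain q where "rprime p" "q \<subset> p" "height_ge K q n" using Suc.prems by auto
  then show ?case using Suc.IH[of q] by blast
qed simp

lemma height_ge_up:
  assumes "height_ge K q n" "q \<subseteq> p" "rprime p" shows "height_ge K p n"
proof (cases n)
  case 0
  then show ?thesis using assms height_ge_prime[OF assms(1)] by auto
next
  case (Suc m)
  then obtain t where "t \<subset> q" "height_ge K t m" using assms(1) by auto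
  then have "t \<subset> p \<and> height_ge K t m" using assms(2) by blast
  then show ?thesis using Suc assms(3) by auto
qed

text \<open>\<open>p\<close> is the only prime over \<open>M\<close> inside \<open>p\<close>, so its
  elements are nilpotent modulo \<open>M\<close> locally at \<open>p\<close>.\<close>

lemma minimal_over_power:
  assumes "noeth M" "minimal_over M p" "y \<in> p"
  obtains k s where "s \<notin> p" "s * y ^ k \<in> M"
proof -
  have p: "rprime p" using assms(2) by (simp add: minimal_over_def)
  obtain k where k: "ipow p k \<subseteq> sat (- p) M"
  proof (rule ipow_subset_sat[OF assms(1) multset_prime[OF p]])
    fix r assume "rprime r" "M \<subseteq> r" "r \<inter> - p = {}"
    then have "r = p" using assms(2) unfolding minimal_over_def by blast
    then show "p \<subseteq> r" by simp
  qed blast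
  have "y ^ k \<in> sat (- p) M" using k ipow_power[OF assms(3)] by blast
  then show ?thesis using that unfolding sat_def by blast
qed

text \<open>Induction on the number of elements. Take a prime \<open>q\<close> directly below
  \<open>p\<close> and some \<open>x\<close> in \<open>xs\<close> outside \<open>q\<close>. Locally
  at \<open>p\<close>, powers of the other elements are congruent modulo \<open>x\<close> to
  elements of \<open>q\<close>, and \<open>q\<close> is minimal over these by the principal ideal
  theorem.\<close>

theorem krull_height:
  assumes "noeth K" "minimal_over (K \<union> set xs) p" "height_ge K p n"
  shows "n \<le> length xs"
  using assms(2,3)
proof (induction "length xs" arbitrary: xs p n)
  case 0
  then have m: "minimal_over K p" by simp
  show ?case
  proof (cases n)
    case (Suc m)
    then obtain q where q: "q \<subset> p" "height_ge K q m" using 0 by auto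
    then have "q = p" using m height_ge_prime[OF q(2)] unfolding minimal_over_def by blast
    then show ?thesis using q by blast
  qed simp
next
  case (Suc d)
  have p: "rprime p" "K \<subseteq> p" "set xs \<subseteq> p"
    and pmin: "\<And>t. rprime t \<Longrightarrow> K \<subseteq> t \<Longrightarrow> set xs \<subseteq> t \<Longrightarrow> t \<subseteq> p \<Longrightarrow> t = p"
    using Suc.prems(1) unfolding minimal_over_def by auto
  show ?case
  proof (cases n)
    case (Suc m)
    then obtain q0 where q0: "q0 \<subset> p" "height_ge K q0 m" using Suc.prems(2) by auto
    have q0': "rprime q0" "K \<subseteq> q0" using height_ge_prime[OF q0(2)] by auto
    \<comment> \<open>No prime lies strictly between this \<open>q\<close> and \<open>p\<close>,
      which makes \<open>p\<close> minimal over \<open>q + (x)\<close>.\<close>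
    obtain q where q: "rprime q \<and> q0 \<subseteq> q \<and> q \<subset> p"
      and qmax: "\<And>t. rprime t \<and> q0 \<subseteq> t \<and> t \<subset> p \<Longrightarrow> q \<subseteq> t \<Longrightarrow> t = q"
    proof (rule noeth_max[OF assms(1), of "\<lambda>q. rprime q \<and> q0 \<subseteq> q \<and> q \<subset> p" q0])
      show "rprime q0 \<and> q0 \<subseteq> q0 \<and> q0 \<subset> p" using q0 q0' by blast
    qed (use q0' rprime_rideal in \<open>blast+\<close>)
    have hq: "height_ge K q m" using height_ge_up[OF q0(2)] q by blast
    have "\<not> set xs \<subseteq> q" using pmin[of q] q q0' by blast
    then obtain x where x: "x \<in> set xs" "x \<notin> q" by blast
    define ys where "ys = remove1 x xs"
    have ys: "length ys = d" "set xs = insert x (set ys)"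
      using x Suc.hyps(2) by (auto simp: ys_def length_remove1 dest: set_remove1_subset[THEN subsetD])
         (metis in_set_remove1)
    have nq: "noeth q" using noeth_mono[OF assms(1) rprime_rideal] q q0' by blast
    let ?M = "gen (insert x q)"
    have nM: "noeth ?M" by (rule noeth_mono[OF nq rideal_gen]) (use gen_superset in blast)
    have Mp: "minimal_over ?M p"
      unfolding minimal_over_def
    proof (intro conjI allI impI)
      show "?M \<subseteq> p" by (rule gen_least[OF rprime_rideal[OF p(1)]]) (use x p q in blast)
      fix t assume t: "rprime t \<and> ?M \<subseteq> t \<and> t \<subseteq> p"
      then have "x \<in> t" "q \<subseteq> t" using gen_superset[of "insert x q"] by auto
      then show "t = p" using qmax[of t] t x q by blast
    qed (rule p(1))
    have "\<exists>z\<in>q. \<exists>s k b. s \<notin> p \<and> s * y ^ k = z + b * x" if y: "y \<in> set ys" for y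
    proof -
      have "y \<in> p" using y ys p by auto
      then obtain k s where ks: "s \<notin> p" "s * y ^ k \<in> ?M" using minimal_over_power[OF nM Mp] by blast
      then obtain b where b: "s * y ^ k - b * x \<in> q"
        using gen_insert_ideal_iff[OF rprime_rideal] q by blast
      have "s * y ^ k = (s * y ^ k - b * x) + b * x" by simp
      then show ?thesis using b ks(1) by blast
    qed
    then obtain f where f: "\<And>y. y \<in> set ys \<Longrightarrow> f y \<in> q \<and> (\<exists>s k b. s \<notin> p \<and> s * y ^ k = f y + b * x)"
      by metis
    have "minimal_over (K \<union> set (map f ys)) q"
      unfolding minimal_over_def
    proof (intro conjI allI impI)
      show "K \<union> set (map f ys) \<subseteq> q" using f q q0' by auto
      fix r assume r: "rprime r \<and> K \<union> set (map f ys) \<subseteq> r \<and> r \<subseteq> q"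
      have nr: "noeth r" using noeth_mono[OF assms(1) rprime_rideal] r by blast
      show "r = q"
      proof (rule sym, rule krull_principal_ideal[OF nr _ p(1)])
        \<comment> \<open>Such a \<open>t\<close> contains \<open>f y\<close> and \<open>x\<close>,
          hence \<open>s * y ^ k\<close> and so \<open>y\<close>; it then contains all of
          \<open>xs\<close> and equals \<open>p\<close>.\<close>
        fix t assume t: "rprime t" "r \<subseteq> t" "x \<in> t" "t \<subseteq> p"
        have "y \<in> t" if y: "y \<in> set ys" for y
        proof -
          obtain s k b where skb: "s \<notin> p" "s * y ^ k = f y + b * x" using f[OF y] by blast
          have "f y \<in> t" using y r t(2) by auto
          then have "s * y ^ k \<in> t" unfolding skb(2)
            by (rule rideal_add[OF rprime_rideal[OF t(1)] _ rideal_mult[OF rprime_rideal[OF t(1)] t(3)]])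
          then have "y ^ k \<in> t" by (rule rprime_multD[OF t(1)]) (use skb(1) t(4) in blast)
          then show ?thesis by (rule rprime_powD[OF t(1)])
        qed
        then have "set xs \<subseteq> t" by (simp add: ys(2) t(3) subset_iff)
        moreover have "K \<subseteq> t" using r t(2) by blast
        ultimately show "t = p" using pmin[OF t(1)] t(4) by blast
      qed (use r q x p in auto)
    qed (use q in blast)
    then have "m \<le> length (map f ys)" using Suc.hyps(1)[of "map f ys" q m] ys(1) hq by simp
    then show ?thesis using Suc Suc.hyps(2) ys(1) by simp
  qed simp
qed

section \<open>Minimal primes, prime avoidance and parameters\<close>

text \<open>Noetherian induction: a maximal counterexample \<open>M\<close> is proper and not prime,
  and for \<open>a * b\<close> in \<open>M\<close> every prime over \<open>M\<close> contains
  \<open>a\<close> or \<open>b\<close>. The set found contains the minimal primes, possibly with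
  others.\<close>

lemma finite_primes_below:
  fixes K :: "'a::comm_ring_1 set"
  assumes "noeth K"
  obtains S where "finite S" "\<And>r. r \<in> S \<Longrightarrow> rprime r \<and> K \<subseteq> r"
    "\<And>t. rprime t \<Longrightarrow> K \<subseteq> t \<Longrightarrow> \<exists>r\<in>S. r \<subseteq> t"
proof -
  define Q where "Q J \<longleftrightarrow> (\<exists>S. finite S \<and> (\<forall>r\<in>S. rprime r \<and> J \<subseteq> r) \<and>
    (\<forall>t. rprime t \<and> J \<subseteq> t \<longrightarrow> (\<exists>r\<in>S. r \<subseteq> t)))" for J :: "'a set"
  have QI: "Q J" if "finite S" "\<And>r. r \<in> S \<Longrightarrow> rprime r" "\<And>r. r \<in> S \<Longrightarrow> J \<subseteq> r"
    "\<And>t. rprime t \<Longrightarrow> J \<subseteq> t \<Longrightarrow> \<exists>r\<in>S. r \<subseteq> t" for J :: "'a set" and S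
    unfolding Q_def using that by (intro exI[of _ S]) simp
  have QE: "\<exists>S. finite S \<and> (\<forall>r\<in>S. rprime r) \<and> (\<forall>r\<in>S. J \<subseteq> r) \<and>
    (\<forall>t. rprime t \<and> J \<subseteq> t \<longrightarrow> (\<exists>r\<in>S. r \<subseteq> t))" if "Q J" for J
    using that unfolding Q_def by (simp add: ball_conj_distrib conj_assoc)
  have "Q K"
  proof (rule ccontr)
    assume no: "\<not> Q K"
    obtain M where M: "rideal M \<and> K \<subseteq> M \<and> \<not> Q M"
      and Mmax: "\<And>L. rideal L \<and> K \<subseteq> L \<and> \<not> Q L \<Longrightarrow> M \<subseteq> L \<Longrightarrow> L = M"
    proof (rule noeth_max[OF assms, of "\<lambda>M. rideal M \<and> K \<subseteq> M \<and> \<not> Q M" K])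
      show "rideal K \<and> K \<subseteq> K \<and> \<not> Q K" using no noeth_rideal[OF assms] by simp
    qed (simp, simp, metis)
    have Mi: "rideal M" and KM: "K \<subseteq> M" and nQ: "\<not> Q M" using M by simp_all
    have big: "Q (gen (insert a M))" if "a \<notin> M" for a
    proof (rule ccontr)
      assume c: "\<not> Q (gen (insert a M))"
      have sub: "insert a M \<subseteq> gen (insert a M)" by (rule gen_superset)
      have "gen (insert a M) = M"
        by (rule Mmax) (use sub KM c rideal_gen in auto)
      then show False using that sub by simp
    qed
    have sub: "gen (insert a M) \<subseteq> t \<longleftrightarrow> a \<in> t \<and> M \<subseteq> t" if t: "rprime t" for a t
      using gen_superset[of "insert a M"] gen_least[OF rprime_rideal[OF t], of "insert a M"] by blast
    have "1 \<notin> M"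
    proof
      assume "1 \<in> M"
      then have "Q M" by (intro QI[of "{}"]) (auto dest: rprime_one)
      then show False using nQ by simp
    qed
    moreover have "\<not> rprime M"
    proof
      assume "rprime M"
      then have "Q M" by (intro QI[of "{M}"]) auto
      then show False using nQ by simp
    qed
    ultimately obtain a b where ab: "a * b \<in> M" "a \<notin> M" "b \<notin> M" using Mi unfolding rprime_def by blast
    obtain S where S: "finite S" "\<forall>r\<in>S. rprime r" "\<forall>r\<in>S. gen (insert a M) \<subseteq> r"
      "\<forall>t. rprime t \<and> gen (insert a M) \<subseteq> t \<longrightarrow> (\<exists>r\<in>S. r \<subseteq> t)" using QE[OF big[OF ab(2)]] by metis
    obtain T where T: "finite T" "\<forall>r\<in>T. rprime r" "\<forall>r\<in>T. gen (insert b M) \<subseteq> r"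
      "\<forall>t. rprime t \<and> gen (insert b M) \<subseteq> t \<longrightarrow> (\<exists>r\<in>T. r \<subseteq> t)" using QE[OF big[OF ab(3)]] by metis
    have "Q M"
    proof (rule QI[of "S \<union> T"])
      show "finite (S \<union> T)" using S(1) T(1) by simp
      show pr: "rprime r" if "r \<in> S \<union> T" for r using S(2) T(2) that by (elim UnE) simp_all
      show "M \<subseteq> r" if "r \<in> S \<union> T" for r
        using S(3) T(3) that sub[OF pr[OF that]] by (metis UnE)
      fix t assume t: "rprime t" "M \<subseteq> t"
      then have "a \<in> t \<or> b \<in> t" using ab(1) unfolding rprime_def by auto
      then show "\<exists>r\<in>S \<union> T. r \<subseteq> t" using S(4) T(4) t sub[OF t(1)] by (meson UnI1 UnI2)
    qed
    then show False using nQ by simp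
  qed
  then show ?thesis using QE[of K] that by metis
qed

lemma prime_product_avoid:
  assumes "finite S" "rprime r" "rideal J" "\<not> J \<subseteq> r" "\<And>s. s \<in> S \<Longrightarrow> rideal s \<and> \<not> s \<subseteq> r"
  shows "\<exists>y\<in>J. (\<forall>s\<in>S. y \<in> s) \<and> y \<notin> r"
  using assms(1,5)
proof (induction S)
  case empty
  then show ?case using assms(4) by blast
next
  case (insert s S)
  then obtain y where y: "y \<in> J" "\<forall>s\<in>S. y \<in> s" "y \<notin> r" by blast
  obtain z where z: "z \<in> s" "z \<notin> r" "rideal s" using insert.prems[of s] by blast
  have "z * y \<notin> r" using rprime_multD[OF assms(2)] y z by blast
  moreover have "z * y \<in> J" by (rule rideal_mult[OF assms(3) y(1)])
  moreover have "z * y \<in> s" by (rule rideal_mult2[OF z(3,1)])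
  moreover have "z * y \<in> t" if "t \<in> S" for t using insert.prems[of t] y(2) that rideal_mult by blast
  ultimately show ?case by blast
qed

lemma prime_avoidance:
  assumes "finite S" "rideal J" "\<And>r. r \<in> S \<Longrightarrow> rprime r \<and> \<not> J \<subseteq> r"
  shows "\<exists>x\<in>J. \<forall>r\<in>S. x \<notin> r"
  using assms(1,3)
proof (induction S rule: finite_psubset_induct)
  case (psubset S)
  show ?case
  proof (cases "S = {}")
    case True
    then show ?thesis using rideal_0[OF assms(2)] by blast
  next
    case False
    \<comment> \<open>Minimality of \<open>r\<close> means that no other member of \<open>S\<close>
      lies inside \<open>r\<close>, so some element of \<open>J\<close> lies in all the others but
      not in \<open>r\<close>.\<close>
    then obtain r where r: "r \<in> S" "\<And>s. s \<in> S \<Longrightarrow> s \<subseteq> r \<Longrightarrow> s = r"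
      using finite_has_minimal[OF psubset.hyps] by metis
    have rp: "rprime r" "\<not> J \<subseteq> r" using psubset.prems r(1) by auto
    obtain x where x: "x \<in> J" "\<And>s. s \<in> S - {r} \<Longrightarrow> x \<notin> s"
      using psubset.IH[of "S - {r}"] r(1) psubset.prems by blast
    show ?thesis
    proof (cases "x \<in> r")
      case True
      obtain y where y: "y \<in> J" "\<And>s. s \<in> S - {r} \<Longrightarrow> y \<in> s" "y \<notin> r"
        using prime_product_avoid[OF _ rp(1) assms(2) rp(2), of "S - {r}"]
          psubset.hyps psubset.prems r(2) rprime_rideal by blast
      have "x + y \<notin> s" if s: "s \<in> S" for s
      proof (cases "s = r")
        case True
        then show ?thesis using \<open>x \<in> r\<close> y(3) rideal_addD'[OF rprime_rideal[OF rp(1)]] by blast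
      next
        case False
        then have "s \<in> S - {r}" "rideal s" using s psubset.prems rprime_rideal by auto
        then show ?thesis using x(2) y(2) rideal_addD[of s x y] by blast
      qed
      then show ?thesis using rideal_add[OF assms(2) x(1) y(1)] by blast
    qed (use x in blast)
  qed
qed

text \<open>Each new parameter avoids the finitely many minimal primes strictly below \<open>p\<close>.\<close>

lemma ex_parameters:
  assumes "noeth K" "rprime p" "K \<subseteq> p"
  shows "\<exists>xs. length xs = i \<and> set xs \<subseteq> p \<and>
    (\<forall>r. rprime r \<and> K \<union> set xs \<subseteq> r \<and> r \<subset> p \<longrightarrow> height_ge K r i)"
proof (induction i)
  case 0
  then show ?case by (intro exI[of _ "[]"]) simp
next
  case (Suc i)
  then obtain xs where xs: "length xs = i" "set xs \<subseteq> p"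
    "\<And>r. rprime r \<Longrightarrow> K \<union> set xs \<subseteq> r \<Longrightarrow> r \<subset> p \<Longrightarrow> height_ge K r i" by blast
  let ?L = "gen (K \<union> set xs)"
  have nL: "noeth ?L" by (rule noeth_mono[OF assms(1) rideal_gen]) (use gen_superset in blast)
  obtain S where S: "finite S" "\<And>r. r \<in> S \<Longrightarrow> rprime r \<and> ?L \<subseteq> r"
    "\<And>t. rprime t \<Longrightarrow> ?L \<subseteq> t \<Longrightarrow> \<exists>r\<in>S. r \<subseteq> t"
    by (rule finite_primes_below[OF nL]) blast
  obtain x where x: "x \<in> p" "\<And>r. r \<in> S \<Longrightarrow> r \<subset> p \<Longrightarrow> x \<notin> r"
  proof -
    have "\<exists>x\<in>p. \<forall>r\<in>{r\<in>S. r \<subset> p}. x \<notin> r"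
    proof (rule prime_avoidance[OF _ rprime_rideal[OF assms(2)]])
      fix r assume "r \<in> {r\<in>S. r \<subset> p}"
      then show "rprime r \<and> \<not> p \<subseteq> r" using S(2)[of r] by blast
    qed (use S(1) in simp)
    then show ?thesis using that by blast
  qed
  show ?case
  proof (intro exI[of _ "x # xs"] conjI allI impI)
    fix r assume r: "rprime r \<and> K \<union> set (x # xs) \<subseteq> r \<and> r \<subset> p"
    then have "?L \<subseteq> r" by (intro gen_least rprime_rideal) auto
    then obtain t where t: "t \<in> S" "t \<subseteq> r" using S(3) r by blast
    have "x \<notin> t" using x(2)[OF t(1)] t(2) r by blast
    then have "t \<subset> r" using t(2) r by auto
    moreover have "height_ge K t i"
    proof (rule xs(3))
      show "K \<union> set xs \<subseteq> t" using S(2)[OF t(1)] gen_superset by blast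
    qed (use S(2)[OF t(1)] t r in auto)
    ultimately show "height_ge K r (Suc i)" using r by auto
  qed (use xs x in auto)
qed

text \<open>The summand \<open>ipow m (Suc N)\<close> turns a local condition into one modulo a
  power of \<open>m\<close>, where elements outside \<open>m\<close> are units anyway. Nakayama's
  lemma removes it again.\<close>

lemma height_le_iff_maximal:
  assumes K: "noeth K" and m: "rmaximal m" and Km: "K \<subseteq> m"
  shows "(\<forall>n. height_ge K m n \<longrightarrow> n \<le> d) \<longleftrightarrow>
    (\<exists>xs N. length xs = d \<and> set xs \<subseteq> m \<and> ipow m N \<subseteq> gen (K \<union> set xs \<union> ipow m (Suc N)))"
    (is "?l \<longleftrightarrow> ?r")
proof
  note p = rmaximal_rprime[OF m]
  note mi = rprime_rideal[OF p]
  assume l: ?l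
  obtain xs where xs: "length xs = d" "set xs \<subseteq> m"
    "\<And>r. rprime r \<Longrightarrow> K \<union> set xs \<subseteq> r \<Longrightarrow> r \<subset> m \<Longrightarrow> height_ge K r d"
    using ex_parameters[OF K p Km, of d] by blast
  let ?L = "gen (K \<union> set xs)"
  have nL: "noeth ?L" by (rule noeth_mono[OF K rideal_gen]) (use gen_superset in blast)
  obtain N where N: "ipow m N \<subseteq> sat (- m) ?L"
  proof (rule ipow_subset_sat[OF nL multset_prime[OF p]])
    fix r assume r: "rprime r" "?L \<subseteq> r" "r \<inter> - m = {}"
    have "K \<union> set xs \<subseteq> r" using r(2) gen_superset by blast
    \<comment> \<open>By the choice of \<open>xs\<close> such an \<open>r\<close> has height at
      least \<open>d\<close>, and \<open>m\<close> would exceed the bound.\<close>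
    have "\<not> r \<subset> m"
    proof
      assume rm: "r \<subset> m"
      have "height_ge K r d" by (rule xs(3)[OF r(1) \<open>K \<union> set xs \<subseteq> r\<close> rm])
      then have "height_ge K m (Suc d)" using rm p by auto
      then show False using l by (meson not_less_eq_eq order_refl)
    qed
    then show "m \<subseteq> r" using r(3) by blast
  qed blast
  have "ipow m N \<subseteq> gen (K \<union> set xs \<union> ipow m (Suc N))"
  proof
    fix a assume a: "a \<in> ipow m N"
    then obtain s where s: "s \<notin> m" "s * a \<in> ?L" using N unfolding sat_def by blast
    \<comment> \<open>Multiplication by \<open>u\<close> undoes \<open>s\<close> up to the error
      \<open>(u * s - 1) * a\<close>, which lies in \<open>m ^ (N + 1)\<close>.\<close>
    obtain u where u: "u * s - 1 \<in> m" using m s(1) unfolding rmaximal_def by blast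
    have "?L \<subseteq> gen (K \<union> set xs \<union> ipow m (Suc N))" by (rule gen_mono) blast
    then have "u * (s * a) \<in> gen (K \<union> set xs \<union> ipow m (Suc N))" using rideal_mult[OF rideal_gen s(2)] by blast
    moreover have "(u * s - 1) * a \<in> gen (K \<union> set xs \<union> ipow m (Suc N))"
      using ipow_mult[OF u a] by (intro gen_base) blast
    ultimately have "u * (s * a) - (u * s - 1) * a \<in> gen (K \<union> set xs \<union> ipow m (Suc N))"
      by (rule rideal_diff[OF rideal_gen])
    also have "u * (s * a) - (u * s - 1) * a = a" by (simp add: algebra_simps)
    finally show "a \<in> gen (K \<union> set xs \<union> ipow m (Suc N))" .
  qed
  then show ?r using xs by blast
next
  note p = rmaximal_rprime[OF m]
  note mi = rprime_rideal[OF p]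
  assume ?r
  then obtain xs N where xs: "length xs = d" "set xs \<subseteq> m"
    "ipow m N \<subseteq> gen (K \<union> set xs \<union> ipow m (Suc N))" by blast
  let ?L = "gen (K \<union> set xs)" and ?M = "gen (K \<union> ipow m N)"
  have KL: "K \<subseteq> ?L" "K \<subseteq> ?M" "ipow m N \<subseteq> ?M" using gen_superset by blast+
  let ?G = "gen (?L \<union> prods m ?M)"
  have LG: "?L \<subseteq> ?G" using gen_superset[of "?L \<union> prods m ?M"] by blast
  have "ipow m (Suc N) \<subseteq> ?G"
    unfolding ipow.simps(2)
  proof (rule gen_mono, rule subsetI)
    fix z assume "z \<in> prods m (ipow m N)"
    then show "z \<in> ?L \<union> prods m ?M" using KL(3) by blast
  qed
  then have "K \<union> set xs \<union> ipow m (Suc N) \<subseteq> ?G" using LG gen_superset[of "K \<union> set xs"] by blast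
  then have "gen (K \<union> set xs \<union> ipow m (Suc N)) \<subseteq> ?G" by (rule gen_least[OF rideal_gen])
  then have "K \<union> ipow m N \<subseteq> ?G" using xs(3) KL(1) LG by blast
  then have "?M \<subseteq> ?G" by (rule gen_least[OF rideal_gen])
  also have "?G \<subseteq> sat (- m) ?G" by (rule sat_superset[OF multset_prime[OF p]])
  finally have "?M \<subseteq> sat (- m) ?L"
    by (rule noeth_nakayama_sat[OF K p rideal_gen KL(1) rideal_gen KL(2)])
  then have sat: "ipow m N \<subseteq> sat (- m) ?L" using KL(3) by blast
  have "minimal_over (K \<union> set xs) m"
    unfolding minimal_over_def
  proof (intro conjI allI impI)
    fix t assume t: "rprime t \<and> K \<union> set xs \<subseteq> t \<and> t \<subseteq> m"
    then have Lt: "?L \<subseteq> t" by (intro gen_least rprime_rideal) auto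
    have "a \<in> t" if a: "a \<in> m" for a
    proof -
      obtain s where s: "s \<notin> m" "s * a ^ N \<in> ?L" using sat ipow_power[OF a] unfolding sat_def by blast
      then have "a ^ N \<in> t" using rprime_multD[of t s "a ^ N"] t Lt by blast
      then show ?thesis using rprime_powD t by blast
    qed
    then show "t = m" using t by blast
  qed (use p Km xs(2) in auto)
  then show ?l using krull_height[OF K] xs(1) by blast
qed

section \<open>Regular sequences and grade\<close>

definition nzd :: "'p::comm_ring_1 set \<Rightarrow> 'p \<Rightarrow> bool" where
  "nzd K x \<longleftrightarrow> (\<forall>a. x * a \<in> K \<longrightarrow> a \<in> K)"

text \<open>Dividing by the head replaces the base ideal. Properness of the generated ideal is kept
  apart, as the second conjunct in \<open>regular_sequence_iff\<close>.\<close>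

fun regs :: "'p::comm_ring_1 set \<Rightarrow> 'p list \<Rightarrow> bool" where
  "regs K [] \<longleftrightarrow> True"
| "regs K (x # xs) \<longleftrightarrow> nzd K x \<and> regs (gen (insert x K)) xs"

text \<open>For ideals of the ambient ring \<open>A\<close>, this says that
  \<open>Hom (A / I, A / K)\<close> is nonzero. Over a Noetherian base it is the absence of
  non-zero-divisors in \<open>I\<close>, in the form of a witness.\<close>

definition socle :: "'p::comm_ring_1 set \<Rightarrow> 'p set \<Rightarrow> bool" where
  "socle I K \<longleftrightarrow> (\<exists>z. z \<notin> K \<and> (\<forall>i\<in>I. i * z \<in> K))"

definition maxreg :: "'p::comm_ring_1 set \<Rightarrow> 'p set \<Rightarrow> 'p list \<Rightarrow> bool" where
  "maxreg I K xs \<longleftrightarrow> regs K xs \<and> set xs \<subseteq> I \<and> (\<forall>y\<in>I. \<not> nzd (gen (K \<union> set xs)) y)"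

lemma gen_Cons: "gen (gen (insert x K) \<union> set xs) = gen (K \<union> set (x # xs))"
proof -
  have "insert x K \<union> set xs = K \<union> set (x # xs)" by auto
  then show ?thesis by (simp only: gen_gen_Un)
qed

lemma gen_snoc: "gen (insert x (gen (K \<union> set xs))) = gen (K \<union> set (xs @ [x]))"
  by (simp add: gen_gen_insert)

lemma regs_append:
  "rideal K \<Longrightarrow> regs K (xs @ ys) \<longleftrightarrow> regs K xs \<and> regs (gen (K \<union> set xs)) ys"
proof (induction xs arbitrary: K)
  case Nil
  then show ?case by (simp add: gen_rideal)
next
  case (Cons x xs)
  show ?case using Cons.IH[OF rideal_gen, of "insert x K"] unfolding gen_Cons by simp
qed

lemma regs_iff_nth:
  assumes "rideal K"
  shows "regs K xs \<longleftrightarrow> (\<forall>i<length xs. nzd (gen (K \<union> set (take i xs))) (xs ! i))"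
proof (induction xs rule: rev_induct)
  case (snoc x xs)
  have "regs K (xs @ [x]) \<longleftrightarrow> regs K xs \<and> nzd (gen (K \<union> set xs)) x"
    by (simp add: regs_append[OF assms])
  moreover have "gen (K \<union> set (take i (xs @ [x]))) = gen (K \<union> set (take i xs))"
    "(xs @ [x]) ! i = xs ! i" if "i < length xs" for i using that by (simp_all add: nth_append)
  ultimately show ?case using snoc by (simp add: All_less_Suc nth_append conj_commute)
qed simp

text \<open>The maximal annihilators of elements outside \<open>K\<close> are prime and cover the
  zero divisors. They are finitely many: the witnesses \<open>f r\<close> are generated over
  \<open>K\<close> by finitely many of them, and these already account for every maximal
  annihilator.\<close>

lemma associated_primes:
  assumes "noeth K"
  shows "\<exists>S. finite S \<and> (\<forall>r\<in>S. rprime r \<and> (\<exists>z. z \<notin> K \<and> r = {a. a * z \<in> K})) \<and>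
    (\<forall>x. \<not> nzd K x \<longrightarrow> (\<exists>r\<in>S. x \<in> r))"
proof -
  note K = noeth_rideal[OF assms]
  define P where "P J \<longleftrightarrow> (\<exists>z. z \<notin> K \<and> J = {a. a * z \<in> K})" for J
  have P: "rideal J \<and> K \<subseteq> J" if J: "P J" for J
  proof -
    obtain z where "J = {a. a * z \<in> K}" using J unfolding P_def by blast
    then show ?thesis using rideal_colon[OF K, of z] rideal_mult2[OF K] by blast
  qed
  define S where "S = {J. P J \<and> (\<forall>L. P L \<and> J \<subseteq> L \<longrightarrow> L = J)}"
  have SP: "P r" if "r \<in> S" for r using that by (simp add: S_def)
  have prime: "rprime r" if r: "r \<in> S" for r
    unfolding rprime_def
  proof (intro conjI allI impI)
    obtain z where z: "z \<notin> K" "r = {a. a * z \<in> K}" using SP[OF r] unfolding P_def by blast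
    show "1 \<notin> r" using z by simp
    fix a b assume ab: "a * b \<in> r"
    show "a \<in> r \<or> b \<in> r"
    proof (subst disj_commute, rule disjCI)
      assume "a \<notin> r"
      then have "a * z \<notin> K" using z by simp
      then have "P {c. c * (a * z) \<in> K}" unfolding P_def by blast
      moreover have "r \<subseteq> {c. c * (a * z) \<in> K}"
      proof
        fix c assume "c \<in> r"
        then have "a * (c * z) \<in> K" using z rideal_mult[OF K] by blast
        then show "c \<in> {c. c * (a * z) \<in> K}" by (simp add: mult.left_commute)
      qed
      ultimately have "{c. c * (a * z) \<in> K} = r" using r unfolding S_def by blast
      moreover have "b * (a * z) \<in> K" using ab z by (simp add: mult_ac)
      ultimately show "b \<in> r" by blast
    qed
  qed (use P SP r in blast)
  have cover: "\<exists>r\<in>S. x \<in> r" if x: "\<not> nzd K x" for x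
  proof -
    obtain z where z: "z \<notin> K" "x * z \<in> K" using x unfolding nzd_def by blast
    then have "P {a. a * z \<in> K}" unfolding P_def by blast
    then obtain M where M: "P M" "{a. a * z \<in> K} \<subseteq> M" "\<And>L. P L \<Longrightarrow> M \<subseteq> L \<Longrightarrow> L = M"
      by (rule noeth_max[OF assms, of P]) (use P in blast)+
    then have "M \<in> S" unfolding S_def by blast
    then show ?thesis using M(2) z(2) by blast
  qed
  obtain f where f: "\<And>r. r \<in> S \<Longrightarrow> f r \<notin> K \<and> r = {a. a * f r \<in> K}"
    using SP unfolding P_def by metis
  obtain F where F: "finite F" "F \<subseteq> f ` S" "f ` S \<subseteq> gen (K \<union> F)"
    using noeth_finite_subset[OF assms] by metis
  obtain T where T: "finite T" "T \<subseteq> S" "F = f ` T" using finite_subset_image[OF F(1,2)] by blast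
  have "S \<subseteq> T"
  proof
    fix r assume r: "r \<in> S"
    have "\<exists>t\<in>T. t \<subseteq> r"
    proof (rule ccontr)
      assume c: "\<not> ?thesis"
      \<comment> \<open>Such a \<open>y\<close> multiplies \<open>F\<close> into \<open>K\<close>,
        hence also \<open>f r\<close>, whose annihilator is \<open>r\<close>.\<close>
      obtain y where y: "\<forall>t\<in>T. y \<in> t" "y \<notin> r"
        using prime_product_avoid[OF T(1) prime[OF r] rideal_UNIV] c prime r T(2) rprime_rideal
          rprime_one by blast
      have "K \<union> F \<subseteq> {w. y * w \<in> K}"
      proof
        fix w assume "w \<in> K \<union> F"
        then show "w \<in> {w. y * w \<in> K}"
          using rideal_mult[OF K] y(1) T f by blast
      qed
      then have "gen (K \<union> F) \<subseteq> {w. y * w \<in> K}" by (rule gen_least[OF rideal_colon'[OF K]])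
      then have "y * f r \<in> K" using F(3) r by blast
      then show False using f[OF r] y(2) by blast
    qed
    then obtain t where "t \<in> T" "t \<subseteq> r" by blast
    then have "r = t" using SP[OF r] T(2) unfolding S_def by blast
    then show "r \<in> T" using \<open>t \<in> T\<close> by simp
  qed
  then have "finite S" using T(1) by (rule finite_subset)
  then show ?thesis
    by (intro exI[of _ S] conjI ballI allI impI prime cover SP[unfolded P_def])
qed

text \<open>Prime avoidance over the union of the finite sets of associated primes yields one
  element for several base ideals at once, as the exchange argument requires.\<close>

lemma common_nzd:
  assumes "finite \<K>" "rideal I" "\<And>K. K \<in> \<K> \<Longrightarrow> noeth K \<and> (\<exists>i\<in>I. nzd K i)"
  shows "\<exists>z\<in>I. \<forall>K\<in>\<K>. nzd K z"
proof -
  have "\<forall>K\<in>\<K>. \<exists>S. finite S \<and> (\<forall>r\<in>S. rprime r \<and> (\<exists>z. z \<notin> K \<and> r = {a. a * z \<in> K})) \<and>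
      (\<forall>x. \<not> nzd K x \<longrightarrow> (\<exists>r\<in>S. x \<in> r))"
  proof
    fix K assume "K \<in> \<K>"
    then have "noeth K" using assms(3) by blast
    then show "\<exists>S. finite S \<and>
      (\<forall>r\<in>S. rprime r \<and> (\<exists>z. z \<notin> K \<and> r = {a. a * z \<in> K})) \<and>
      (\<forall>x. \<not> nzd K x \<longrightarrow> (\<exists>r\<in>S. x \<in> r))" by (rule associated_primes)
  qed
  from bchoice[OF this] obtain S where *: "\<forall>K\<in>\<K>. finite (S K) \<and>
      (\<forall>r\<in>S K. rprime r \<and> (\<exists>z. z \<notin> K \<and> r = {a. a * z \<in> K})) \<and>
      (\<forall>x. \<not> nzd K x \<longrightarrow> (\<exists>r\<in>S K. x \<in> r))" ..
  have S: "finite (S K)" "r \<in> S K \<Longrightarrow> rprime r \<and> (\<exists>z. z \<notin> K \<and> r = {a. a * z \<in> K})"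
    "\<not> nzd K x \<Longrightarrow> \<exists>r\<in>S K. x \<in> r" if "K \<in> \<K>" for K r x
    using bspec[OF * that] by (elim conjE; simp)+
  have "\<exists>x\<in>I. \<forall>r\<in>(\<Union>K\<in>\<K>. S K). x \<notin> r"
  proof (rule prime_avoidance)
    show "finite (\<Union>K\<in>\<K>. S K)" using S(1) assms(1) by blast
    fix r assume "r \<in> (\<Union>K\<in>\<K>. S K)"
    then obtain K where K: "K \<in> \<K>" "r \<in> S K" by blast
    obtain z where z: "z \<notin> K" "r = {a. a * z \<in> K}" using S(2)[OF K] by blast
    obtain i where "i \<in> I" "nzd K i" using assms(3)[OF K(1)] by blast
    then have "i \<notin> r" using z unfolding nzd_def by blast
    then show "rprime r \<and> \<not> I \<subseteq> r" using S(2)[OF K] \<open>i \<in> I\<close> by blast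
  qed (rule assms)
  then obtain x where x: "x \<in> I" "\<forall>r\<in>(\<Union>K\<in>\<K>. S K). x \<notin> r" by (elim bexE)
  have "nzd K x" if K: "K \<in> \<K>" for K
  proof (rule ccontr)
    assume "\<not> nzd K x"
    from S(3)[OF K this] obtain r where "r \<in> S K" "x \<in> r" by metis
    then show False using x(2) K by (meson UN_I)
  qed
  then show ?thesis using x(1) by (intro bexI ballI)
qed

text \<open>Otherwise prime avoidance would find an element of \<open>I\<close> outside all primes
  covering the zero divisors; so \<open>I\<close> lies in a single annihilator.\<close>

lemma socle_of_no_nzd:
  assumes "noeth K" "rideal I" "\<And>i. i \<in> I \<Longrightarrow> \<not> nzd K i"
  shows "socle I K"
proof -
  obtain S where S: "finite S" "\<forall>r\<in>S. rprime r \<and> (\<exists>z. z \<notin> K \<and> r = {a. a * z \<in> K})"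
    "\<forall>x. \<not> nzd K x \<longrightarrow> (\<exists>r\<in>S. x \<in> r)" using associated_primes[OF assms(1)] by (elim exE conjE)
  have "\<not> (\<forall>r\<in>S. \<not> I \<subseteq> r)"
  proof
    assume "\<forall>r\<in>S. \<not> I \<subseteq> r"
    then obtain x where "x \<in> I" "\<forall>r\<in>S. x \<notin> r"
      using prime_avoidance[OF S(1) assms(2)] S(2) by metis
    then show False using S(3) assms(3) by metis
  qed
  then obtain r where r: "r \<in> S" "I \<subseteq> r" by metis
  obtain z where "z \<notin> K" "r = {a. a * z \<in> K}" using S(2) r(1) by metis
  then show ?thesis using r(2) unfolding socle_def by blast
qed

lemma nzd_not_socle: "nzd K y \<Longrightarrow> y \<in> I \<Longrightarrow> \<not> socle I K"
  unfolding nzd_def socle_def by blast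

text \<open>The new witness \<open>w\<close> comes from \<open>y * z = w * x\<close> modulo
  \<open>K\<close>. When \<open>x\<close> is in \<open>I\<close> too, this is the elementary form of
  the fact that both sides compute \<open>Ext^1 (A / I, A / K)\<close>.\<close>

lemma socle_exchange:
  assumes K: "rideal K" and x: "nzd K x" and y: "nzd K y" "y \<in> I"
    and s: "socle I (gen (insert x K))"
  shows "socle I (gen (insert y K))"
proof -
  obtain z where z: "z \<notin> gen (insert x K)" "\<And>i. i \<in> I \<Longrightarrow> i * z \<in> gen (insert x K)"
    using s unfolding socle_def by blast
  obtain w where w: "y * z - w * x \<in> K" using z(2)[OF y(2)] gen_insert_ideal_iff[OF K] by blast
  have "w \<notin> gen (insert y K)"
  proof
    assume "w \<in> gen (insert y K)"
    then obtain v where v: "w - v * y \<in> K" using gen_insert_ideal_iff[OF K] by blast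
    have "(y * z - w * x) + (w - v * y) * x \<in> K"
      by (rule rideal_add[OF K w rideal_mult2[OF K v]])
    also have "(y * z - w * x) + (w - v * y) * x = y * (z - v * x)" by (simp add: algebra_simps)
    finally have "z - v * x \<in> K" using y(1) unfolding nzd_def by blast
    then show False using z(1) gen_insert_ideal_iff[OF K] by blast
  qed
  moreover have "i * w \<in> gen (insert y K)" if i: "i \<in> I" for i
  proof -
    obtain c where c: "i * z - c * x \<in> K" using z(2)[OF i] gen_insert_ideal_iff[OF K] by blast
    have "y * (i * z - c * x) - i * (y * z - w * x) \<in> K"
      by (rule rideal_diff[OF K rideal_mult[OF K c] rideal_mult[OF K w]])
    also have "y * (i * z - c * x) - i * (y * z - w * x) = x * (i * w - c * y)"
      by (simp add: algebra_simps)
    finally have "i * w - c * y \<in> K" using x unfolding nzd_def by blast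
    then show ?thesis using gen_insert_ideal_iff[OF K] by blast
  qed
  ultimately show ?thesis unfolding socle_def by blast
qed

text \<open>Modulo \<open>K\<close>, if \<open>x * a = b * z\<close>, regularity of \<open>z\<close>
  modulo \<open>x\<close> gives \<open>b = c * x\<close>, and cancelling \<open>x\<close> leaves
  \<open>a = c * z\<close>.\<close>

lemma regs_shift:
  assumes "rideal K" "regs K xs" "\<And>i. i \<le> length xs \<Longrightarrow> nzd (gen (K \<union> set (take i xs))) z"
  shows "regs (gen (insert z K)) xs"
  using assms
proof (induction xs arbitrary: K)
  case (Cons x xs)
  note K = Cons.prems(1)
  have x: "nzd K x" using Cons.prems(2) by simp
  have z: "nzd (gen (insert x K)) z" using Cons.prems(3)[of 1] by simp
  have "nzd (gen (insert z K)) x"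
    unfolding nzd_def
  proof (intro allI impI)
    fix a assume "x * a \<in> gen (insert z K)"
    then obtain b where b: "x * a - b * z \<in> K" using gen_insert_ideal_iff[OF K] by blast
    have "z * b - a * x \<in> K" using rideal_uminus[OF K b] by (simp add: mult.commute)
    then have "z * b \<in> gen (insert x K)" using gen_insert_ideal_iff[OF K] by blast
    then have "b \<in> gen (insert x K)" using z unfolding nzd_def by blast
    then obtain c where c: "b - c * x \<in> K" using gen_insert_ideal_iff[OF K] by blast
    have "(x * a - b * z) + (b - c * x) * z \<in> K"
      by (rule rideal_add[OF K b rideal_mult2[OF K c]])
    also have "(x * a - b * z) + (b - c * x) * z = x * (a - c * z)" by (simp add: algebra_simps)
    finally have "a - c * z \<in> K" using x unfolding nzd_def by blast
    then show "a \<in> gen (insert z K)" using gen_insert_ideal_iff[OF K] by blast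
  qed
  moreover have "regs (gen (insert z (gen (insert x K)))) xs"
  proof (rule Cons.IH[OF rideal_gen])
    show "nzd (gen (gen (insert x K) \<union> set (take i xs))) z" if "i \<le> length xs" for i
      using Cons.prems(3)[of "Suc i"] that by (simp add: gen_Cons)
  qed (use Cons.prems(2) in simp)
  then have "regs (gen (insert x (gen (insert z K)))) xs"
    by (simp add: gen_gen_insert insert_commute)
  ultimately show ?case by simp
qed simp

text \<open>Kaplansky's exchange argument: the last elements of both sequences are replaced by a common
  \<open>z\<close>, which is a non-zero-divisor on all intermediate quotients and so can be moved to the front.\<close>

lemma rees_socle:
  assumes "noeth K" "rideal I" "length xs = n" "length ys = n" "regs K xs" "regs K ys"
    "set xs \<subseteq> I" "set ys \<subseteq> I" "socle I (gen (K \<union> set xs))"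
  shows "socle I (gen (K \<union> set ys))"
  using assms(1,3-)
proof (induction n arbitrary: K xs ys)
  case (Suc n)
  note K = noeth_rideal[OF Suc.prems(1)]
  obtain xs' x where xs: "xs = xs' @ [x]" "length xs' = n"
    using Suc.prems(2) by (metis length_Suc_conv_rev)
  obtain ys' y where ys: "ys = ys' @ [y]" "length ys' = n"
    using Suc.prems(3) by (metis length_Suc_conv_rev)
  let ?Kx = "gen (K \<union> set xs')" and ?Ky = "gen (K \<union> set ys')"
  \<comment> \<open>Only the ideals before the last elements occur; each has the next element of its
    sequence as a non-zero-divisor in \<open>I\<close>.\<close>
  define \<K> where "\<K> = (\<lambda>i. gen (K \<union> set (take i xs))) ` {..n} \<union> (\<lambda>i. gen (K \<union> set (take i ys))) ` {..n}"
  have nth: "noeth (gen (K \<union> set (take i zs))) \<and> (\<exists>j\<in>I. nzd (gen (K \<union> set (take i zs))) j)"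
    if "regs K zs" "i \<le> n" "length zs = Suc n" "set zs \<subseteq> I" for i zs
  proof
    show "noeth (gen (K \<union> set (take i zs)))"
      by (rule noeth_mono[OF Suc.prems(1) rideal_gen]) (use gen_superset in blast)
    show "\<exists>j\<in>I. nzd (gen (K \<union> set (take i zs))) j"
      using that regs_iff_nth[OF K] nth_mem[of i zs] by (metis le_imp_less_Suc subsetD)
  qed
  have "\<exists>z\<in>I. \<forall>L\<in>\<K>. nzd L z"
    by (rule common_nzd[OF _ assms(2)]) (use nth Suc.prems in \<open>auto simp: \<K>_def\<close>)
  then obtain z where z: "z \<in> I" "\<And>L. L \<in> \<K> \<Longrightarrow> nzd L z" by blast
  have zx: "nzd (gen (K \<union> set (take i xs'))) z" and zy: "nzd (gen (K \<union> set (take i ys'))) z"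
    if "i \<le> n" for i
  proof -
    have "take i xs' = take i xs" "take i ys' = take i ys" using that xs ys by simp_all
    then show "nzd (gen (K \<union> set (take i xs'))) z" "nzd (gen (K \<union> set (take i ys'))) z"
      using z(2) that unfolding \<K>_def by auto
  qed
  have rx: "regs K xs'" "nzd ?Kx x" using Suc.prems(4) xs by (simp_all add: regs_append[OF K])
  have ry: "regs K ys'" "nzd ?Ky y" using Suc.prems(5) ys by (simp_all add: regs_append[OF K])
  have zKx: "nzd ?Kx z" using zx[of n] xs by simp
  have zKy: "nzd ?Ky z" using zy[of n] ys by simp
  have "socle I (gen (insert x ?Kx))" using Suc.prems(8) unfolding gen_snoc xs .
  then have "socle I (gen (insert z ?Kx))" by (rule socle_exchange[OF rideal_gen rx(2) zKx z(1)])
  then have sx: "socle I (gen (gen (insert z K) \<union> set xs'))" unfolding gen_Cons gen_gen_insert by simp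
  have "socle I (gen (gen (insert z K) \<union> set ys'))"
  proof (rule Suc.IH[OF _ xs(2) ys(2) _ _ _ _ sx])
    show "noeth (gen (insert z K))"
      by (rule noeth_mono[OF Suc.prems(1) rideal_gen]) (use gen_superset in blast)
    show "regs (gen (insert z K)) xs'" by (rule regs_shift[OF K rx(1)]) (use zx xs in simp)
    show "regs (gen (insert z K)) ys'" by (rule regs_shift[OF K ry(1)]) (use zy ys in simp)
  qed (use Suc.prems xs ys in auto)
  then have "socle I (gen (insert z ?Ky))" unfolding gen_Cons gen_gen_insert by simp
  moreover have "y \<in> I" using Suc.prems(7) ys by simp
  ultimately have "socle I (gen (insert y ?Ky))" by (intro socle_exchange[OF rideal_gen zKy ry(2)])
  then show ?case unfolding gen_snoc ys .
qed simp

lemma maxreg_of_socle: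
  "regs K xs \<Longrightarrow> set xs \<subseteq> I \<Longrightarrow> socle I (gen (K \<union> set xs)) \<Longrightarrow> maxreg I K xs"
  unfolding maxreg_def using nzd_not_socle by blast

lemma socle_of_maxreg:
  assumes "noeth K" "rideal I" "maxreg I K xs" shows "socle I (gen (K \<union> set xs))"
proof (rule socle_of_no_nzd[OF _ assms(2)])
  show "noeth (gen (K \<union> set xs))"
    by (rule noeth_mono[OF assms(1) rideal_gen]) (use gen_superset in blast)
qed (use assms(3) in \<open>simp add: maxreg_def\<close>)

text \<open>Were \<open>ys\<close> longer than \<open>xs\<close>, the exchange argument would give a
  witness modulo the initial segment of \<open>ys\<close> of length \<open>length xs\<close>,
  although the next element of \<open>ys\<close> is regular there.\<close>

theorem rees_length_unique:
  assumes "noeth K" "rideal I" "maxreg I K xs" "maxreg I K ys"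
  shows "length xs = length ys"
proof -
  have "\<not> length xs < length ys" if xs: "maxreg I K xs" and ys: "maxreg I K ys" for xs ys
  proof
    assume l: "length xs < length ys"
    let ?n = "length xs"
    note K = noeth_rideal[OF assms(1)]
    have y: "regs K ys" "set ys \<subseteq> I" using ys by (simp_all add: maxreg_def)
    have "regs K (take ?n ys)" using y(1) regs_append[OF K, of "take ?n ys" "drop ?n ys"] by simp
    moreover have "set (take ?n ys) \<subseteq> I" using y(2) set_take_subset by fastforce
    ultimately have "socle I (gen (K \<union> set (take ?n ys)))"
      using rees_socle[OF assms(1,2) refl, of "take ?n ys" xs] socle_of_maxreg[OF assms(1,2) xs] xs l
      by (simp add: maxreg_def)
    moreover have "nzd (gen (K \<union> set (take ?n ys))) (ys ! ?n)" using y(1) l regs_iff_nth[OF K] by blast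
    ultimately show False using nzd_not_socle y(2) l nth_mem by blast
  qed
  then show ?thesis using assms(3,4) by (metis linorder_neqE_nat)
qed

text \<open>Noetherian induction on the base ideal: over a maximal counterexample inside
  \<open>I\<close> the empty sequence is not maximal, so the base can be enlarged by a
  non-zero-divisor from \<open>I\<close>.\<close>

lemma ex_maxreg:
  assumes "noeth K" "rideal I" "1 \<notin> I" "K \<subseteq> I"
  shows "\<exists>xs. maxreg I K xs"
proof (rule ccontr)
  assume no: "\<not> ?thesis"
  define P where "P L \<longleftrightarrow> rideal L \<and> K \<subseteq> L \<and> L \<subseteq> I \<and> \<not> (\<exists>xs. maxreg I L xs)" for L
  have "P K" using no assms noeth_rideal unfolding P_def by blast
  then obtain M where M: "P M" "\<And>L. P L \<Longrightarrow> M \<subseteq> L \<Longrightarrow> L = M"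
  proof (rule noeth_max[OF assms(1), of P])
  qed (unfold P_def, blast+)
  then have Mi: "rideal M" "K \<subseteq> M" "M \<subseteq> I" "\<And>xs. \<not> maxreg I M xs" unfolding P_def by auto
  have "\<not> maxreg I M []" by (rule Mi)
  then obtain y where y: "y \<in> I" "nzd M y" unfolding maxreg_def by (auto simp: gen_rideal[OF Mi(1)])
  let ?L = "gen (insert y M)"
  have sub: "M \<subseteq> ?L" "y \<in> ?L" using gen_superset[of "insert y M"] by auto
  \<comment> \<open>A non-zero-divisor inside \<open>M\<close> would force \<open>1\<close> into
    \<open>M\<close>.\<close>
  have "y \<notin> M" using y(2) assms(3) Mi(3) unfolding nzd_def by (metis mult.right_neutral subsetD)
  then have "\<not> P ?L" using M(2)[OF _ sub(1)] sub(2) by blast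
  moreover have "?L \<subseteq> I" by (rule gen_least[OF assms(2)]) (use y Mi in blast)
  ultimately obtain xs where "maxreg I ?L xs" using Mi sub rideal_gen unfolding P_def by blast
  then have "maxreg I M (y # xs)" using y unfolding maxreg_def gen_Cons by simp
  then show False using Mi(4) by blast
qed

section \<open>Krull's intersection theorem\<close>

text \<open>Weak in that nothing is said about how \<open>m\<close> depends on \<open>n\<close>,
  which avoids the Rees algebra. An ideal \<open>H\<close> maximal with \<open>H \<inter> M\<close>
  inside the right-hand side contains a power of each element of \<open>I\<close>, hence a power of
  \<open>I\<close>.\<close>

lemma weak_artin_rees:
  assumes L: "noeth L" and M: "rideal M" "L \<subseteq> M"
  shows "\<exists>m. gen (L \<union> ipow I m) \<inter> M \<subseteq> gen (L \<union> prods (ipow I n) M)"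
proof -
  let ?B = "gen (L \<union> prods (ipow I n) M)"
  define P where "P H \<longleftrightarrow> rideal H \<and> ?B \<subseteq> H \<and> H \<inter> M \<subseteq> ?B" for H
  have LB: "L \<subseteq> ?B" using gen_superset by blast
  have "P ?B" unfolding P_def using rideal_gen by blast
  then obtain H where H: "P H" "\<And>J. P J \<Longrightarrow> H \<subseteq> J \<Longrightarrow> J = H"
  proof (rule noeth_max[OF L, of P])
    show "rideal J" if "P J" for J using that unfolding P_def by simp
    show "L \<subseteq> J" if "P J" for J using that LB unfolding P_def by (meson order_trans)
  qed metis
  have Hi: "rideal H" "?B \<subseteq> H" "H \<inter> M \<subseteq> ?B" using H(1) unfolding P_def by auto
  have LH: "L \<subseteq> H" using LB Hi(2) by blast
  have nH: "noeth H" by (rule noeth_mono[OF L Hi(1) LH])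
  have pw: "\<exists>k. i ^ k \<in> H" if i: "i \<in> I" for i
  proof -
    define j where "j = i ^ n"
    have j: "j \<in> ipow I n" unfolding j_def by (rule ipow_power[OF i])
    define C where "C k = {a. j ^ k * a \<in> H}" for k
    have C: "rideal (C k)" "L \<subseteq> C k" for k
      unfolding C_def using rideal_colon'[OF Hi(1)] rideal_mult[OF Hi(1)] LH by blast+
    have "C k \<subseteq> C (Suc k)" for k
      unfolding C_def using rideal_mult[OF Hi(1)] by (auto simp: mult.assoc)
    \<comment> \<open>The factor \<open>j\<close> multiplies \<open>M\<close> into
      \<open>?B\<close>; stationary colon ideals then allow one \<open>j\<close> to be cancelled
      modulo \<open>H\<close>, so adding \<open>j ^ k\<close> to \<open>H\<close> does not enlarge
      the intersection with \<open>M\<close>.\<close>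
    then obtain k where k: "\<And>l. l \<ge> k \<Longrightarrow> C l = C k" using noeth_chain[OF L, of C] C by metis
    let ?J = "gen (insert (j ^ k) H)"
    have sub: "H \<subseteq> ?J" "j ^ k \<in> ?J" using gen_superset[of "insert (j ^ k) H"] by auto
    have "?J \<inter> M \<subseteq> ?B"
    proof
      fix y assume y: "y \<in> ?J \<inter> M"
      then obtain a where a: "y - a * j ^ k \<in> H" using gen_insert_ideal_iff[OF Hi(1)] by blast
      have "j * y \<in> ?B" using j y by (intro gen_base) blast
      then have "j * y - j * (y - a * j ^ k) \<in> H"
        using Hi(2) by (intro rideal_diff[OF Hi(1)] rideal_mult[OF Hi(1) a]) blast
      also have "j * y - j * (y - a * j ^ k) = j ^ Suc k * a" by (simp add: algebra_simps)
      finally have "a \<in> C (Suc k)" unfolding C_def by simp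
      then have "a \<in> C k" using k[of "Suc k"] by simp
      then have "a * j ^ k \<in> H" unfolding C_def by (simp add: mult.commute)
      then have "y \<in> H" by (rule rideal_diffD[OF Hi(1) a])
      then show "y \<in> ?B" using Hi(3) y by blast
    qed
    then have "P ?J" unfolding P_def using rideal_gen sub Hi(2) by blast
    then have "?J = H" by (rule H(2)[OF _ sub(1)])
    then have "i ^ (n * k) \<in> H" using sub(2) by (simp add: j_def power_mult)
    then show ?thesis by blast
  qed
  obtain m where m: "ipow I m \<subseteq> H"
  proof (rule ipow_subset_of_primes[OF nH])
    fix r assume "rprime r" "H \<subseteq> r"
    then show "I \<subseteq> r" using pw rprime_powD by blast
  qed blast
  have "gen (L \<union> ipow I m) \<subseteq> H" by (rule gen_least[OF Hi(1)]) (use LH m in blast)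
  then show ?thesis using Hi(3) by blast
qed

text \<open>The intersection \<open>D\<close> satisfies \<open>D = L + I * D\<close> by the weak
  Artin-Rees lemma, so Nakayama's lemma makes it vanish modulo \<open>L\<close> locally at every
  maximal ideal over \<open>L\<close>.\<close>

theorem krull_intersection:
  assumes L: "noeth L" and I: "rideal I"
    and jac: "\<And>m. rmaximal m \<Longrightarrow> L \<subseteq> m \<Longrightarrow> I \<subseteq> m"
    and x: "\<And>n. x \<in> gen (L \<union> ipow I n)"
  shows "x \<in> L"
proof (rule ccontr)
  assume xL: "x \<notin> L"
  note Li = noeth_rideal[OF L]
  define D where "D = {x. \<forall>n. x \<in> gen (L \<union> ipow I n)}"
  have D: "rideal D" using rideal_gen[of "L \<union> ipow I _"] unfolding D_def rideal_def by blast
  have LD: "L \<subseteq> D" unfolding D_def using gen_superset by blast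
  obtain k where "gen (L \<union> ipow I k) \<inter> D \<subseteq> gen (L \<union> prods (ipow I (Suc 0)) D)"
    using weak_artin_rees[OF L D LD] by blast
  then have DD: "D \<subseteq> gen (L \<union> prods (ipow I (Suc 0)) D)" unfolding D_def by blast
  \<comment> \<open>The annihilator of \<open>x\<close> modulo \<open>L\<close> is proper; a maximal
    ideal above it is where the contradiction arises.\<close>
  obtain m where m: "rmaximal m" "{a. a * x \<in> L} \<subseteq> m"
  proof (rule ex_rmaximal[OF L rideal_colon[OF Li, of x]])
    show "L \<subseteq> {a. a * x \<in> L}" using rideal_mult2[OF Li] by blast
  qed (use xL in auto)
  have Lm: "L \<subseteq> m" using m(2) rideal_mult2[OF Li] by blast
  have Im: "ipow I (Suc 0) \<subseteq> m" unfolding ipow_1[OF I] by (rule jac[OF m(1) Lm])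
  note p = rmaximal_rprime[OF m(1)]
  have "D \<subseteq> sat (- m) L"
  proof (rule noeth_nakayama_sat[OF L p Li order_refl D LD])
    have "gen (L \<union> prods (ipow I (Suc 0)) D) \<subseteq> gen (L \<union> prods m D)"
      by (rule gen_mono) (use Im in blast)
    then show "D \<subseteq> sat (- m) (gen (L \<union> prods m D))"
      using DD sat_superset[OF multset_prime[OF p]] by blast
  qed
  moreover have "x \<in> D" using x unfolding D_def by simp
  ultimately obtain s where "s \<notin> m" "s * x \<in> L" unfolding sat_def by blast
  then show False using m(2) by blast
qed

section \<open>Noetherian completions\<close>

text \<open>An ideal maximal among those not finitely generated over \<open>B\<close> is prime.
  Zorn's lemma provides one, because finitely many generators of the union of a chain would already
  lie in one member.\<close>

theorem cohen_noeth:
  assumes B: "rideal B" and pr: "\<And>r. rprime r \<Longrightarrow> B \<subseteq> r \<Longrightarrow> \<exists>F. finite F \<and> r = gen (B \<union> F)"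
  shows "noeth B"
proof (rule ccontr)
  assume no: "\<not> noeth B"
  define A where "A = {J. rideal J \<and> B \<subseteq> J \<and> \<not> (\<exists>F. finite F \<and> J = gen (B \<union> F))}"
  have "A \<noteq> {}" using no B unfolding noeth_def A_def by blast
  moreover have "\<Union>\<C> \<in> A" if ne: "\<C> \<noteq> {}" and ch: "subset.chain A \<C>" for \<C>
  proof -
    have CA: "\<And>C. C \<in> \<C> \<Longrightarrow> rideal C \<and> B \<subseteq> C \<and> \<not> (\<exists>F. finite F \<and> C = gen (B \<union> F))"
      using ch unfolding subset.chain_def A_def by blast
    have U: "rideal (\<Union>\<C>)"
    proof (rule ridealI)
      show "0 \<in> \<Union>\<C>" using ne CA rideal_0 by blast
      fix a b assume "a \<in> \<Union>\<C>" "b \<in> \<Union>\<C>"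
      then obtain C D where CD: "C \<in> \<C>" "D \<in> \<C>" "a \<in> C" "b \<in> D" by blast
      then have "C \<subseteq> D \<or> D \<subseteq> C" using ch unfolding subset.chain_def by blast
      then show "a + b \<in> \<Union>\<C>"
      proof
        assume "C \<subseteq> D"
        then have "a + b \<in> D" using CD CA[of D] rideal_add by blast
        then show ?thesis using CD by blast
      next
        assume "D \<subseteq> C"
        then have "a + b \<in> C" using CD CA[of C] rideal_add by blast
        then show ?thesis using CD by blast
      qed
    next
      fix r a assume "a \<in> \<Union>\<C>"
      then show "r * a \<in> \<Union>\<C>" using CA rideal_mult by blast
    qed
    have "\<not> (\<exists>F. finite F \<and> \<Union>\<C> = gen (B \<union> F))"
    proof
      assume "\<exists>F. finite F \<and> \<Union>\<C> = gen (B \<union> F)"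
      then obtain F where F: "finite F" "\<Union>\<C> = gen (B \<union> F)" by blast
      have "F \<subseteq> \<Union>\<C>" unfolding F(2) using gen_superset by blast
      then obtain C where C: "C \<in> \<C>" "F \<subseteq> C" by (rule finite_subset_Union_chain[OF F(1) _ ne ch])
      have "gen (B \<union> F) \<subseteq> C" using C CA[OF C(1)] by (intro gen_least) auto
      then have "C = gen (B \<union> F)" using F(2) C(1) by blast
      then show False using CA[OF C(1)] F(1) by blast
    qed
    moreover have "B \<subseteq> \<Union>\<C>" using ne CA by blast
    ultimately show ?thesis using U unfolding A_def by blast
  qed
  ultimately obtain r where rA: "r \<in> A" and rmax: "\<And>J. J \<in> A \<Longrightarrow> r \<subseteq> J \<Longrightarrow> J = r"
    using subset_Zorn_nonempty[of A] by metis
  have r: "rideal r" "B \<subseteq> r" and nfg: "\<And>F. finite F \<Longrightarrow> r \<noteq> gen (B \<union> F)"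
    using rA unfolding A_def by auto
  have fg: "\<exists>F. finite F \<and> J = gen (B \<union> F)" if "rideal J" "r \<subset> J" for J
    using rmax[of J] that r unfolding A_def by blast
  have "rprime r" unfolding rprime_def
  proof (intro conjI allI impI)
    show "1 \<notin> r"
    proof
      assume "1 \<in> r"
      then have "r = gen (B \<union> {1})" using rideal_one[OF r(1)] rideal_one[OF rideal_gen gen_base, of "B \<union> {1}"] by blast
      then show False using nfg by blast
    qed
    fix a b assume ab: "a * b \<in> r"
    show "a \<in> r \<or> b \<in> r"
    proof (rule ccontr)
      assume c: "\<not> (a \<in> r \<or> b \<in> r)"
      have ins: "insert a r \<subseteq> gen (insert a r)" by (rule gen_superset)
      then have "r \<subset> gen (insert a r)" using c by blast
      from fg[OF rideal_gen this] obtain F where F: "finite F" "gen (insert a r) = gen (B \<union> F)" by metis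
      have "\<exists>c. f - c * a \<in> r" if "f \<in> F" for f
        using that F(2) gen_superset[of "B \<union> F"] gen_insert_ideal_iff[OF r(1)] by blast
      then obtain h where h: "\<And>f. f \<in> F \<Longrightarrow> f - h f * a \<in> r" by metis
      \<comment> \<open>The generators of \<open>r + (a)\<close> are corrected into
        \<open>r\<close>; together with \<open>a\<close> times generators of the colon ideal
        \<open>r : a\<close> they will generate \<open>r\<close>.\<close>
      define F' where "F' = (\<lambda>f. f - h f * a) ` F"
      have "r \<subset> {c. c * a \<in> r}" using c ab rideal_mult2[OF r(1)] by (auto simp: mult.commute)
      from fg[OF rideal_colon[OF r(1)] this]
      obtain G where G: "finite G" "{c. c * a \<in> r} = gen (B \<union> G)" by metis
      have "r = gen (B \<union> (F' \<union> (\<lambda>g. g * a) ` G))"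
      proof
        have "(\<lambda>g. g * a) ` G \<subseteq> r" using G(2) gen_superset[of "B \<union> G"] by blast
        then show "gen (B \<union> (F' \<union> (\<lambda>g. g * a) ` G)) \<subseteq> r"
          using r(2) h by (intro gen_least[OF r(1)]) (auto simp: F'_def)
        show "r \<subseteq> gen (B \<union> (F' \<union> (\<lambda>g. g * a) ` G))" (is "_ \<subseteq> ?T")
        proof
          fix y assume y: "y \<in> r"
          have "F \<subseteq> gen (insert a (B \<union> F'))"
          proof
            fix f assume "f \<in> F"
            then have "f - h f * a \<in> gen (B \<union> F')" unfolding F'_def by (intro gen_base) blast
            then show "f \<in> gen (insert a (B \<union> F'))" using gen_insert_iff by blast
          qed
          moreover have "B \<subseteq> gen (insert a (B \<union> F'))"
            using gen_superset[of "insert a (B \<union> F')"] by simp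
          ultimately have "gen (B \<union> F) \<subseteq> gen (insert a (B \<union> F'))" by (intro gen_least[OF rideal_gen]) blast
          moreover have "y \<in> gen (B \<union> F)" using y ins F(2) by blast
          ultimately obtain d where d: "y - d * a \<in> gen (B \<union> F')" using gen_insert_iff by blast
          have "gen (B \<union> F') \<subseteq> r" using r(2) h by (intro gen_least[OF r(1)]) (auto simp: F'_def)
          then have "d * a \<in> r" using rideal_diffD'[OF r(1) _ y] d by blast
          then have "d \<in> gen (B \<union> G)" using G(2) by blast
          moreover have "gen (B \<union> G) \<subseteq> {d. d * a \<in> ?T}"
          proof (rule gen_least[OF rideal_colon[OF rideal_gen]], rule subsetI)
            fix g assume "g \<in> B \<union> G"
            then show "g \<in> {d. d * a \<in> ?T}"
              using rideal_mult2[OF rideal_gen gen_base, of g "B \<union> (F' \<union> (\<lambda>g. g * a) ` G)" a]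
                gen_base[of "g * a" "B \<union> (F' \<union> (\<lambda>g. g * a) ` G)"] by blast
          qed
          ultimately have "d * a \<in> ?T" by blast
          moreover have "gen (B \<union> F') \<subseteq> ?T" by (rule gen_mono) blast
          ultimately show "y \<in> ?T" using d rideal_diffD[OF rideal_gen] by blast
        qed
      qed
      moreover have "finite (F' \<union> (\<lambda>g. g * a) ` G)" using F(1) G(1) by (simp add: F'_def)
      ultimately show False using nfg by blast
    qed
  qed (rule r)
  then show False using pr[of r] r(2) nfg by blast
qed

text \<open>Kaplansky's argument for power series rings.  The hypothesis \<open>comp\<close> solves
  \<open>b n = (\<Sum>i. a (n + i) * x ^ i)\<close> modulo \<open>K\<close>, and \<open>sep\<close> says that
  \<open>K\<close> contains every element infinitely divisible by \<open>x\<close> modulo \<open>K\<close>.\<close>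

lemma noeth_of_complete:
  assumes comp: "\<And>a. \<exists>b. \<forall>n::nat. b n - a n - x * b (Suc n) \<in> K"
    and sep: "\<And>d. (\<And>n::nat. d n - x * d (Suc n) \<in> K) \<Longrightarrow> d 0 \<in> K"
    and K: "rideal K" and Z: "finite Z" and N: "noeth (gen (K \<union> insert x Z))"
  shows "noeth (gen (K \<union> Z))"
proof (rule cohen_noeth[OF rideal_gen])
  let ?B = "gen (K \<union> Z)"
  fix r assume r: "rprime r" "?B \<subseteq> r"
  note ri = rprime_rideal[OF r(1)]
  have KZ: "K \<subseteq> ?B" "Z \<subseteq> ?B" using gen_superset by blast+
  have BX: "gen (insert x ?B) = gen (K \<union> insert x Z)" by (simp add: gen_gen_insert)
  show "\<exists>F. finite F \<and> r = gen (?B \<union> F)"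
  proof (cases "x \<in> r")
    case True
    have "gen (K \<union> insert x Z) \<subseteq> r" by (rule gen_least[OF ri]) (use True r KZ in blast)
    then obtain F where F: "finite F" "r = gen (gen (K \<union> insert x Z) \<union> F)" using noeth_fg[OF N ri] by blast
    have "gen (gen (K \<union> insert x Z) \<union> F) = gen (?B \<union> insert x F)"
      unfolding gen_gen_Un by simp
    then show ?thesis using F by blast
  next
    case False
    let ?J = "gen (insert x r)"
    have "gen (K \<union> insert x Z) \<subseteq> ?J" by (rule gen_mono) (use r KZ in blast)
    then obtain F where F: "finite F" "?J = gen (gen (K \<union> insert x Z) \<union> F)"
      using noeth_fg[OF N rideal_gen] by metis
    have "\<exists>c. f - c * x \<in> r" if "f \<in> F" for f
      using that F(2) gen_superset[of "gen (K \<union> insert x Z) \<union> F"] gen_insert_ideal_iff[OF ri] by blast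
    then obtain h where h: "\<And>f. f \<in> F \<Longrightarrow> f - h f * x \<in> r" by metis
    define G where "G = Z \<union> (\<lambda>f. f - h f * x) ` F"
    have G: "finite G" "G \<subseteq> r" using Z F(1) h r(2) KZ by (auto simp: G_def)
    let ?T = "gen (K \<union> G)"
    have Tr: "?T \<subseteq> r" by (rule gen_least[OF ri]) (use G r(2) KZ in blast)
    \<comment> \<open>Division by \<open>x\<close>: the quotient \<open>c\<close> stays in
      \<open>r\<close> because \<open>x\<close> is outside the prime \<open>r\<close>.\<close>
    have step: "\<exists>b c. b \<in> ?T \<and> c \<in> r \<and> g = b + x * c" if g: "g \<in> r" for g
    proof -
      have "gen (K \<union> insert x Z) \<union> F \<subseteq> gen (insert x (K \<union> G))"
      proof
        fix f assume "f \<in> gen (K \<union> insert x Z) \<union> F"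
        then show "f \<in> gen (insert x (K \<union> G))"
        proof
          assume "f \<in> gen (K \<union> insert x Z)"
          moreover have "gen (K \<union> insert x Z) \<subseteq> gen (insert x (K \<union> G))"
            by (rule gen_mono) (auto simp: G_def)
          ultimately show ?thesis by blast
        next
          assume "f \<in> F"
          then have "f - h f * x \<in> ?T" by (intro gen_base) (simp add: G_def)
          then show ?thesis using gen_insert_iff by blast
        qed
      qed
      then have "?J \<subseteq> gen (insert x (K \<union> G))" unfolding F(2) by (rule gen_least[OF rideal_gen])
      moreover have "g \<in> ?J" by (rule gen_base) (use g in blast)
      ultimately obtain c where c: "g - c * x \<in> ?T" using gen_insert_iff by blast
      then have "c * x \<in> r" using rideal_diffD'[OF ri _ g] Tr by blast
      then have "c \<in> r" using r(1) False unfolding rprime_def by blast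
      moreover have "g = (g - c * x) + x * c" by (simp add: mult.commute)
      ultimately show ?thesis using c by blast
    qed
    then obtain bf cf where bc: "\<And>g. g \<in> r \<Longrightarrow> bf g \<in> ?T \<and> cf g \<in> r \<and> g = bf g + x * cf g" by metis
    \<comment> \<open>A power series in \<open>x\<close> with coefficients in
      \<open>gen (K \<union> H)\<close> has its sum there, since the coefficients at each generator
      can be summed separately by \<open>comp\<close>. All tails \<open>c n\<close> are kept, as the
      equations relate consecutive ones.\<close>
    have sums: "\<exists>c. (\<forall>n. c n \<in> gen (K \<union> H)) \<and> (\<forall>n. c n - b n - x * c (Suc n) \<in> K)"
      if "finite H" "\<And>n::nat. b n \<in> gen (K \<union> H)" for H b
      using that
    proof (induction H arbitrary: b)
      case empty
      then have "- b n \<in> K" for n using rideal_uminus[OF K] by (simp add: gen_rideal[OF K])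
      then show ?case using rideal_0[OF rideal_gen] by (intro exI[of _ "\<lambda>_. 0"]) simp
    next
      case (insert z H)
      have "\<exists>a. b n - a * z \<in> gen (K \<union> H)" for n using insert.prems(1)[of n] by (simp add: gen_insert_iff)
      then obtain a where a: "\<And>n. b n - a n * z \<in> gen (K \<union> H)" by metis
      obtain c where c: "\<And>n. c n \<in> gen (K \<union> H)" "\<And>n. c n - (b n - a n * z) - x * c (Suc n) \<in> K"
        using insert.IH[of "\<lambda>n. b n - a n * z"] a by blast
      obtain e where e: "\<And>n. e n - a n - x * e (Suc n) \<in> K" using comp by blast
      show ?case
      proof (intro exI[of _ "\<lambda>n. c n + e n * z"] conjI allI)
        fix n
        have "c n + e n * z - e n * z \<in> gen (K \<union> H)" using c(1) by simp
        then have "\<exists>a. c n + e n * z - a * z \<in> gen (K \<union> H)" by (rule exI)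
        then show "c n + e n * z \<in> gen (K \<union> insert z H)" by (simp only: gen_insert_iff Un_insert_right)
        have "(c n - (b n - a n * z) - x * c (Suc n)) + (e n - a n - x * e (Suc n)) * z \<in> K"
          by (rule rideal_add[OF K c(2) rideal_mult2[OF K e]])
        also have "(c n - (b n - a n * z) - x * c (Suc n)) + (e n - a n - x * e (Suc n)) * z =
          c n + e n * z - b n - x * (c (Suc n) + e (Suc n) * z)" by (simp add: algebra_simps)
        finally show "c n + e n * z - b n - x * (c (Suc n) + e (Suc n) * z) \<in> K" .
      qed
    qed
    have "r \<subseteq> ?T"
    proof
      fix g assume g: "g \<in> r"
      \<comment> \<open>\<open>gs n\<close> is the remainder after \<open>n\<close> divisions, so
        \<open>g\<close> should be the series with coefficients \<open>bf (gs n)\<close>;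
        \<open>sep\<close> identifies it with the sum \<open>c 0\<close>.\<close>
      define gs where "gs n = (cf ^^ n) g" for n
      have gs: "gs n \<in> r" for n using g bc unfolding gs_def by (induction n) auto
      obtain c where c: "\<And>n. c n \<in> ?T" "\<And>n. c n - bf (gs n) - x * c (Suc n) \<in> K"
        using sums[OF G(1), of "\<lambda>n. bf (gs n)"] bc[OF gs] by blast
      have "gs 0 - c 0 \<in> K"
      proof (rule sep)
        fix n
        have "gs n = bf (gs n) + x * gs (Suc n)" using bc[OF gs[of n]] by (simp add: gs_def)
        then have "(gs n - c n) - x * (gs (Suc n) - c (Suc n)) = - (c n - bf (gs n) - x * c (Suc n))"
          by (simp add: algebra_simps)
        then show "(gs n - c n) - x * (gs (Suc n) - c (Suc n)) \<in> K"
          using rideal_uminus[OF K c(2)[of n]] by (simp only:)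
      qed
      then have "gs 0 - c 0 \<in> ?T" by (intro gen_base) simp
      then have "gs 0 \<in> ?T" by (rule rideal_diffD[OF rideal_gen _ c(1)])
      then show "g \<in> ?T" by (simp add: gs_def)
    qed
    then have "r = ?T" using Tr by blast
    moreover have "?T = gen (?B \<union> G)" unfolding gen_gen_Un by (simp add: G_def Un_ac)
    ultimately show ?thesis using G(1) by blast
  qed
qed

section \<open>Comparison of a ring with its completion\<close>

text \<open>The dimension can be infinite, so only its finite upper bounds are expressed.\<close>

definition dim_le :: "'p::comm_ring_1 set \<Rightarrow> nat \<Rightarrow> bool" where
  "dim_le K d \<longleftrightarrow> (\<forall>p n. height_ge K p n \<longrightarrow> n \<le> d)"

lemma dim_le_iff_maximal:
  assumes "noeth K"
  shows "dim_le K d \<longleftrightarrow> (\<forall>m. rmaximal m \<and> K \<subseteq> m \<longrightarrow> (\<forall>n. height_ge K m n \<longrightarrow> n \<le> d))"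
proof (rule iffI)
  assume r: "\<forall>m. rmaximal m \<and> K \<subseteq> m \<longrightarrow> (\<forall>n. height_ge K m n \<longrightarrow> n \<le> d)"
  show "dim_le K d" unfolding dim_le_def
  proof (intro allI impI)
    fix p n assume h: "height_ge K p n"
    have p: "rprime p" "K \<subseteq> p" using height_ge_prime[OF h] by auto
    obtain m where m: "rmaximal m" "p \<subseteq> m"
      by (rule ex_rmaximal[OF assms rprime_rideal[OF p(1)] p(2) rprime_one[OF p(1)]])
    have "height_ge K m n" by (rule height_ge_up[OF h m(2) rmaximal_rprime[OF m(1)]])
    moreover have "K \<subseteq> m" using p(2) m(2) by (rule order_trans)
    ultimately show "n \<le> d" using r m(1) by simp
  qed
qed (simp add: dim_le_def)

text \<open>The rings are \<open>UNIV / K\<close> and \<open>UNIV / K'\<close>, and \<open>\<phi>\<close> induces the map of a ring to its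
  \<open>I\<close>-adic completion.\<close>

locale completion_pair =
  fixes K I :: "'p::comm_ring_1 set" and K' :: "'q::comm_ring_1 set" and \<phi> :: "'p \<Rightarrow> 'q"
    and ext :: "'p set \<Rightarrow> 'q set"
  defines "ext J \<equiv> gen (K' \<union> \<phi> ` J)"
  assumes nK: "noeth K" and I: "rideal I" and KI: "K \<subseteq> I"
    and jac: "\<And>m. rmaximal m \<Longrightarrow> K \<subseteq> m \<Longrightarrow> I \<subseteq> m"
    and K': "rideal K'"
    and hom_add: "\<And>a b. \<phi> (a + b) = \<phi> a + \<phi> b"
    and hom_mult: "\<And>a b. \<phi> (a * b) = \<phi> a * \<phi> b"
    and hom_one: "\<phi> 1 = 1"
    and hom_K: "\<phi> ` K \<subseteq> K'"
    and dense: "\<And>y n. \<exists>x. y - \<phi> x \<in> ext (ipow I n)"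
    and contract_ipow: "\<And>x n. \<phi> x \<in> ext (ipow I n) \<Longrightarrow> x \<in> gen (K \<union> ipow I n)"
    and separated: "\<And>y. (\<And>n. y \<in> ext (ipow I n)) \<Longrightarrow> y \<in> K'"
    and complete: "\<And>x a. x \<in> ext I \<Longrightarrow> \<exists>b. \<forall>n::nat. b n - a n - x * b (Suc n) \<in> K'"
begin

section \<open>Extension and contraction of ideals\<close>

lemma hom_0: "\<phi> 0 = 0" using hom_add[of 0 0] by simp
lemma hom_uminus: "\<phi> (- a) = - \<phi> a" using hom_add[of a "-a"] hom_0 by (simp add: eq_neg_iff_add_eq_0 add.commute)
lemma hom_diff: "\<phi> (a - b) = \<phi> a - \<phi> b" using hom_add[of a "-b"] hom_uminus by simp

lemma rideal_vimage: "rideal J \<Longrightarrow> rideal {a. \<phi> a \<in> J}"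
  unfolding rideal_def by (simp add: hom_0 hom_add hom_mult)

lemma rideal_ext: "rideal (ext J)" by (simp add: ext_def rideal_gen)
lemma K'_ext: "K' \<subseteq> ext J" using gen_superset unfolding ext_def by blast
lemma image_ext: "a \<in> J \<Longrightarrow> \<phi> a \<in> ext J" unfolding ext_def by (intro gen_base) simp

lemma ext_least: "rideal A \<Longrightarrow> K' \<subseteq> A \<Longrightarrow> (\<And>a. a \<in> J \<Longrightarrow> \<phi> a \<in> A) \<Longrightarrow> ext J \<subseteq> A"
  unfolding ext_def by (rule gen_least) auto

lemma ext_mono: "J \<subseteq> L \<Longrightarrow> ext J \<subseteq> ext L"
  unfolding ext_def by (rule gen_mono) auto

lemma ext_gen: "ext (gen (K \<union> Z)) = ext Z"
proof
  show "ext (gen (K \<union> Z)) \<subseteq> ext Z"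
  proof (rule ext_least[OF rideal_ext K'_ext])
    fix a assume a: "a \<in> gen (K \<union> Z)"
    have "gen (K \<union> Z) \<subseteq> {a. \<phi> a \<in> ext Z}"
      by (rule gen_least[OF rideal_vimage[OF rideal_ext]])
         (use hom_K K'_ext image_ext in blast)
    then show "\<phi> a \<in> ext Z" using a by blast
  qed
  show "ext Z \<subseteq> ext (gen (K \<union> Z))" by (rule ext_mono) (use gen_superset in blast)
qed

lemma ext_K: "ext K = K'"
  using ext_gen[of "{}"] gen_rideal[OF noeth_rideal[OF nK]] gen_rideal[OF K'] by (simp add: ext_def)

lemma ext_mult:
  assumes "a \<in> ext J" "b \<in> ext L" "\<And>j l. j \<in> J \<Longrightarrow> l \<in> L \<Longrightarrow> j * l \<in> M"
  shows "a * b \<in> ext M"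
proof -
  have "\<phi> j * b \<in> ext M" if j: "j \<in> J" for j
  proof -
    have "ext L \<subseteq> {b. \<phi> j * b \<in> ext M}"
    proof (rule ext_least[OF rideal_colon'[OF rideal_ext]])
      show "K' \<subseteq> {b. \<phi> j * b \<in> ext M}" using rideal_mult[OF rideal_ext] K'_ext by blast
      fix l assume "l \<in> L"
      then show "\<phi> l \<in> {b. \<phi> j * b \<in> ext M}" using image_ext[OF assms(3)[OF j]] by (simp add: hom_mult)
    qed
    then show ?thesis using assms(2) by blast
  qed
  then have "ext J \<subseteq> {a. a * b \<in> ext M}"
    by (intro ext_least[OF rideal_colon[OF rideal_ext]]) (use rideal_mult2[OF rideal_ext] K'_ext in blast)+
  then show ?thesis using assms(1) by blast
qed

text \<open>\<open>ext\<close> always contains \<open>K'\<close> while \<open>ipow\<close> need not,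
  so the converse \<open>ext_ipow\<close> has to add \<open>K'\<close>.\<close>

lemma ipow_ext: "ipow (ext J) n \<subseteq> ext (ipow J n)"
proof (induction n)
  case 0
  have "1 \<in> ext (UNIV :: 'p set)" using image_ext[of 1 UNIV] by (simp add: hom_one)
  then have "ext (UNIV :: 'p set) = UNIV" by (rule rideal_one[OF rideal_ext])
    then show ?case by simp
next
  case (Suc n)
  show ?case unfolding ipow.simps(2)[of "ext J"]
  proof (rule gen_least[OF rideal_ext], rule subsetI)
    fix z assume "z \<in> prods (ext J) (ipow (ext J) n)"
    then obtain a b where "z = a * b" "a \<in> ext J" "b \<in> ext (ipow J n)" using Suc.IH by blast
    then show "z \<in> ext (ipow J (Suc n))" using ext_mult ipow_mult by metis
  qed
qed

lemma image_ipow: "a \<in> ipow J n \<Longrightarrow> \<phi> a \<in> ipow (ext J) n"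
proof (induction n arbitrary: a)
  case (Suc n)
  have "ipow J (Suc n) \<subseteq> {a. \<phi> a \<in> ipow (ext J) (Suc n)}"
    unfolding ipow.simps(2)[of J]
  proof (rule gen_least[OF rideal_vimage[OF rideal_ipow]], rule subsetI)
    fix z assume "z \<in> prods J (ipow J n)"
    then obtain a b where z: "z = a * b" "a \<in> J" "b \<in> ipow J n" by blast
    then show "z \<in> {a. \<phi> a \<in> ipow (ext J) (Suc n)}"
      using ipow_mult[OF image_ext[OF z(2)] Suc.IH[OF z(3)]] by (simp only: hom_mult mem_Collect_eq)
  qed
  then show ?case using Suc.prems by blast
qed simp

lemma ext_ipow: "ext (ipow J n) \<subseteq> gen (K' \<union> ipow (ext J) n)"
proof (rule ext_least[OF rideal_gen])
  show "K' \<subseteq> gen (K' \<union> ipow (ext J) n)" using gen_superset[of "K' \<union> ipow (ext J) n"] by simp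
  show "\<phi> a \<in> gen (K' \<union> ipow (ext J) n)" if "a \<in> ipow J n" for a
    by (intro gen_base UnI2 image_ipow that)
qed

lemma dense_Suc0: "\<exists>x. y - \<phi> x \<in> ext I"
  using dense[of y "Suc 0"] unfolding ipow_1[OF I] .

text \<open>By density, the elements congruent modulo \<open>I ^ n C\<close> to some
  \<open>\<phi> l\<close> with \<open>l\<close> in \<open>A\<close> form an ideal. It contains
  \<open>ext A\<close>, and \<open>contract_ipow\<close> pulls the congruence back to
  \<open>R\<close>.\<close>

lemma contract:
  assumes A: "rideal A" "gen (K \<union> ipow I n) \<subseteq> A" and y: "\<phi> y \<in> ext A"
  shows "y \<in> A"
proof -
  let ?E = "ext (ipow I n)"
  let ?C = "{w. \<exists>l\<in>A. w - \<phi> l \<in> ?E}"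
  have C0: "w \<in> ?C" if "l \<in> A" "w - \<phi> l \<in> ?E" for w l using that by blast
  have "ext A \<subseteq> ?C"
  proof (rule ext_least)
    show "rideal ?C"
    proof (rule ridealI)
      show "0 \<in> ?C" by (rule C0[OF rideal_0[OF A(1)]]) (simp add: hom_0 rideal_0[OF rideal_ext])
    next
      fix u v assume "u \<in> ?C" "v \<in> ?C"
      then obtain k l where kl: "k \<in> A" "l \<in> A" "u - \<phi> k \<in> ?E" "v - \<phi> l \<in> ?E" by blast
      have "(u - \<phi> k) + (v - \<phi> l) \<in> ?E" by (rule rideal_add[OF rideal_ext kl(3,4)])
      also have "(u - \<phi> k) + (v - \<phi> l) = u + v - \<phi> (k + l)" by (simp add: hom_add)
      finally show "u + v \<in> ?C" by (rule C0[OF rideal_add[OF A(1) kl(1,2)]])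
    next
      fix r u assume "u \<in> ?C"
      then obtain l where l: "l \<in> A" "u - \<phi> l \<in> ?E" by blast
      obtain s where s: "r - \<phi> s \<in> ?E" using dense by blast
      have "r * (u - \<phi> l) + (r - \<phi> s) * \<phi> l \<in> ?E"
        by (rule rideal_add[OF rideal_ext rideal_mult[OF rideal_ext l(2)] rideal_mult2[OF rideal_ext s]])
      also have "r * (u - \<phi> l) + (r - \<phi> s) * \<phi> l = r * u - \<phi> (s * l)"
        by (simp add: hom_mult algebra_simps)
      finally show "r * u \<in> ?C" by (rule C0[OF rideal_mult[OF A(1) l(1)]])
    qed
    show "K' \<subseteq> ?C"
    proof
      fix w assume "w \<in> K'"
      then have "w - \<phi> 0 \<in> ?E" using K'_ext by (simp add: hom_0 subset_iff)
      then show "w \<in> ?C" by (rule C0[OF rideal_0[OF A(1)]])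
    qed
    show "\<phi> a \<in> ?C" if "a \<in> A" for a by (rule C0[OF that]) (simp add: rideal_0[OF rideal_ext])
  qed
  then obtain l where l: "l \<in> A" "\<phi> y - \<phi> l \<in> ?E" using y by blast
  then have "y - l \<in> gen (K \<union> ipow I n)" by (intro contract_ipow) (simp add: hom_diff)
  then show ?thesis using A rideal_diffD[OF A(1) _ l(1)] by blast
qed

text \<open>By \<open>contract\<close>, \<open>y\<close> lies in \<open>L + I ^ n\<close> for every
  \<open>n\<close>; as \<open>I\<close> is in the Jacobson radical, Krull's intersection theorem
  removes the powers.\<close>

lemma contract_closed:
  assumes L: "rideal L" "K \<subseteq> L" and y: "\<phi> y \<in> ext L"
  shows "y \<in> L"
proof (rule krull_intersection[OF noeth_mono[OF nK L] I])
  show "I \<subseteq> m" if "rmaximal m" "L \<subseteq> m" for m using jac that L(2) by blast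
  fix n
  let ?A = "gen (L \<union> ipow I n)"
  show "y \<in> ?A"
  proof (rule contract[OF rideal_gen])
    show "gen (K \<union> ipow I n) \<subseteq> ?A" by (rule gen_mono) (use L(2) in blast)
    have "L \<subseteq> ?A" using gen_superset by blast
    then show "\<phi> y \<in> ext ?A" using ext_mono y by blast
  qed
qed

section \<open>The completion is Noetherian and has \<open>I C\<close> in its Jacobson
  radical\<close>

text \<open>Iterating the relation puts every \<open>d k\<close> into every \<open>I ^ n C\<close>.
  This supplies the hypothesis \<open>sep\<close> of \<open>noeth_of_complete\<close>.\<close>

lemma divisible_separated:
  assumes x: "x \<in> ext I" and d: "\<And>n::nat. d n - x * d (Suc n) \<in> K'"
  shows "d 0 \<in> K'"
proof (rule separated)
  have "d k \<in> ext (ipow I n)" for n k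
  proof (induction n arbitrary: k)
    case 0
    have "1 \<in> ext (UNIV :: 'p set)" using image_ext[of 1 UNIV] by (simp add: hom_one)
    then have "ext (UNIV :: 'p set) = UNIV" by (rule rideal_one[OF rideal_ext])
    then show ?case by simp
  next
    case (Suc n)
    have "x * d (Suc k) \<in> ext (ipow I (Suc n))" by (rule ext_mult[OF x Suc.IH ipow_mult])
    moreover have "d k - x * d (Suc k) \<in> ext (ipow I (Suc n))" using d K'_ext by blast
    ultimately show ?case using rideal_diffD[OF rideal_ext] by blast
  qed
  then show "d 0 \<in> ext (ipow I n)" for n .
qed

text \<open>By density every element of \<open>C\<close> is an image up to \<open>I C\<close>, so an
  ideal above \<open>I C\<close> is generated over it by images of generators of its
  contraction.\<close>

lemma noeth_ext_I: "noeth (ext I)"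
  unfolding noeth_def
proof (intro conjI allI impI rideal_ext)
  fix J assume J: "rideal J \<and> ext I \<subseteq> J"
  have J0: "rideal {a. \<phi> a \<in> J}" using rideal_vimage J by blast
  have "K \<subseteq> {a. \<phi> a \<in> J}" using KI image_ext J by blast
  then obtain F where F: "finite F" "{a. \<phi> a \<in> J} = gen (K \<union> F)" "F \<subseteq> {a. \<phi> a \<in> J}"
    by (rule noeth_fg[OF nK J0])
  have "J = gen (ext I \<union> \<phi> ` F)"
  proof
    show "gen (ext I \<union> \<phi> ` F) \<subseteq> J" by (rule gen_least) (use J F in auto)
    show "J \<subseteq> gen (ext I \<union> \<phi> ` F)" (is "_ \<subseteq> ?T")
    proof
      fix y assume y: "y \<in> J"
      obtain x where x: "y - \<phi> x \<in> ext I" using dense_Suc0 by blast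
      then have "\<phi> x \<in> J" using J y rideal_diffD' by blast
      then have "x \<in> gen (K \<union> F)" using F(2) by blast
      then have "\<phi> x \<in> ext F" using image_ext ext_gen by blast
      moreover have "ext F \<subseteq> ?T"
      proof (rule ext_least[OF rideal_gen])
        show "K' \<subseteq> ?T" using K'_ext[of I] gen_superset[of "ext I \<union> \<phi> ` F"] by (simp add: subset_iff)
        show "\<phi> a \<in> ?T" if "a \<in> F" for a using that by (intro gen_base) simp
      qed
      moreover have "y - \<phi> x \<in> ?T" using x by (intro gen_base) simp
      ultimately show "y \<in> ?T" using rideal_diffD[OF rideal_gen] by blast
    qed
  qed
  then show "\<exists>F. finite F \<and> J = gen (ext I \<union> F)" using F(1) by blast
qed

text \<open>Start from \<open>I C\<close>, generated by the images of finitely many generators of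
  \<open>I\<close>, and drop these one at a time by \<open>noeth_of_complete\<close>.\<close>

theorem noeth_K': "noeth K'"
proof -
  obtain G where G: "finite G" "I = gen (K \<union> G)" "G \<subseteq> I" by (rule noeth_fg[OF nK I KI])
  have "ext I = gen (K' \<union> \<phi> ` G)" using ext_gen[of G] G(2) by (simp add: ext_def)
  then have N: "noeth (gen (K' \<union> \<phi> ` G))" using noeth_ext_I by simp
  have "noeth K'" if "finite Z" "Z \<subseteq> ext I" "noeth (gen (K' \<union> Z))" for Z
    using that
  proof (induction Z)
    case empty
    then show ?case by (simp add: gen_rideal[OF K'])
  next
    case (insert x Z)
    have x: "x \<in> ext I" using insert.prems by simp
    have "noeth (gen (K' \<union> Z))"
    proof (rule noeth_of_complete[OF _ _ K' insert.hyps(1) insert.prems(2)])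
      show "\<exists>b. \<forall>n. b n - a n - x * b (Suc n) \<in> K'" for a :: "nat \<Rightarrow> 'q" by (rule complete[OF x])
      show "d 0 \<in> K'" if "\<And>n. d n - x * d (Suc n) \<in> K'" for d :: "nat \<Rightarrow> 'q"
        using that by (rule divisible_separated[OF x, of d])
    qed
    then show ?case using insert.IH insert.prems(1) by simp
  qed
  then show ?thesis using N G(1,3) image_ext by (metis finite_imageI image_subsetI subsetD)
qed

text \<open>For \<open>x\<close> in \<open>I C\<close>, every \<open>1 - u * x\<close> is invertible
  by the geometric series.\<close>

lemma ext_I_jacobson:
  assumes M: "rmaximal M" "K' \<subseteq> M"
  shows "ext I \<subseteq> M"
proof
  fix x assume x: "x \<in> ext I"
  note p = rmaximal_rprime[OF M(1)]
  note Mi = rprime_rideal[OF p]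
  show "x \<in> M"
  proof (rule ccontr)
    assume "x \<notin> M"
    then obtain u where u: "u * x - 1 \<in> M" using M(1) unfolding rmaximal_def by blast
    let ?x = "u * x"
    have x': "?x \<in> ext I" by (rule rideal_mult[OF rideal_ext x])
    obtain b where b: "\<And>n::nat. b n - 1 - ?x * b (Suc n) \<in> K'"
      using complete[OF x', of "\<lambda>_. 1"] by blast
    \<comment> \<open>All \<open>b n\<close> ought to be the same geometric series, but
      \<open>complete\<close> only relates consecutive ones. Their differences are infinitely
      divisible by \<open>u * x\<close>, hence zero.\<close>
    have "b 0 - b (Suc 0) \<in> K'"
    proof (rule divisible_separated[OF x', of "\<lambda>n. b n - b (Suc n)"])
      fix n
      have "(b n - 1 - ?x * b (Suc n)) - (b (Suc n) - 1 - ?x * b (Suc (Suc n))) \<in> K'"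
        by (rule rideal_diff[OF K' b b])
      also have "(b n - 1 - ?x * b (Suc n)) - (b (Suc n) - 1 - ?x * b (Suc (Suc n)))
          = b n - b (Suc n) - ?x * (b (Suc n) - b (Suc (Suc n)))" by (simp add: algebra_simps)
      finally show "b n - b (Suc n) - ?x * (b (Suc n) - b (Suc (Suc n))) \<in> K'" .
    qed
    then have "(b 0 - 1 - ?x * b (Suc 0)) - (b 0 - b (Suc 0)) \<in> K'" by (rule rideal_diff[OF K' b])
    then have "(b 0 - 1 - ?x * b (Suc 0)) - (b 0 - b (Suc 0)) \<in> M" using M(2) by blast
    then have "(b 0 - 1 - ?x * b (Suc 0)) - (b 0 - b (Suc 0)) + (?x - 1) * b (Suc 0) \<in> M"
      by (rule rideal_add[OF Mi _ rideal_mult2[OF Mi u]])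
    also have "(b 0 - 1 - ?x * b (Suc 0)) - (b 0 - b (Suc 0)) + (?x - 1) * b (Suc 0) = - 1"
      by (simp add: algebra_simps)
    finally have "1 \<in> M" using rideal_uminus[OF Mi, of "-1"] by simp
    then show False using rprime_one[OF p] by simp
  qed
qed

lemma ext_UNIV_iff: "1 \<in> ext I \<longleftrightarrow> 1 \<in> I"
proof
  assume "1 \<in> ext I"
  then have "\<phi> 1 \<in> ext I" by (simp add: hom_one)
  then show "1 \<in> I" by (rule contract_closed[OF I KI])
next
  assume "1 \<in> I"
  then show "1 \<in> ext I" using image_ext[of 1 I] by (simp add: hom_one)
qed

subsection \<open>Regular sequences\<close>

text \<open>Approximate \<open>a'\<close> by \<open>\<phi> a\<close> so closely that
  \<open>x * a\<close> lies in \<open>L + I ^ m\<close>. The weak Artin-Rees lemma writes it as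
  \<open>x * c\<close> modulo \<open>L\<close> with \<open>c\<close> in \<open>I ^ n\<close>, and
  cancelling \<open>x\<close> puts \<open>a\<close> into \<open>L + I ^ n\<close>. So
  \<open>a'\<close> is in \<open>ext L\<close> up to every power of \<open>I C\<close>, and Krull's
  intersection theorem in \<open>C\<close> finishes.\<close>

lemma nzd_ext:
  assumes L: "rideal L" "K \<subseteq> L" and x: "nzd L x"
  shows "nzd (ext L) (\<phi> x)"
  unfolding nzd_def
proof (intro allI impI)
  fix a' assume xa': "\<phi> x * a' \<in> ext L"
  have nL: "noeth L" by (rule noeth_mono[OF nK L])
  have nL': "noeth (ext L)" by (rule noeth_mono[OF noeth_K' rideal_ext K'_ext])
  show "a' \<in> ext L"
  proof (rule krull_intersection[OF nL' rideal_ext[of I]])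
    show "ext I \<subseteq> m" if "rmaximal m" "ext L \<subseteq> m" for m
      using ext_I_jacobson[of m] that K'_ext by blast
    fix n
    let ?M = "gen (insert x L)"
    have LM: "L \<subseteq> ?M" "x \<in> ?M" using gen_superset[of "insert x L"] by auto
    let ?B = "gen (L \<union> prods (ipow I n) ?M)"
    obtain m where m: "gen (L \<union> ipow I m) \<inter> ?M \<subseteq> ?B"
      using weak_artin_rees[OF nL rideal_gen LM(1)] by blast
    \<comment> \<open>\<open>m\<close> serves the Artin-Rees step, \<open>n\<close> the final error
      \<open>a' - \<phi> a\<close>.\<close>
    let ?k = "max m n"
    obtain a where a: "a' - \<phi> a \<in> ext (ipow I ?k)" using dense by blast
    let ?A = "gen (L \<union> ipow I ?k)"
    have LA: "L \<subseteq> ?A" "ipow I ?k \<subseteq> ?A" using gen_superset by blast+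
    have "\<phi> x * (a' - \<phi> a) \<in> ext ?A"
      by (rule rideal_mult[OF rideal_ext]) (use a ext_mono[OF LA(2)] in blast)
    moreover have "\<phi> x * a' \<in> ext ?A" using xa' ext_mono[OF LA(1)] by blast
    ultimately have "\<phi> x * a' - \<phi> x * (a' - \<phi> a) \<in> ext ?A" using rideal_diff[OF rideal_ext] by blast
    also have "\<phi> x * a' - \<phi> x * (a' - \<phi> a) = \<phi> (x * a)" by (simp add: hom_mult algebra_simps)
    finally have "\<phi> (x * a) \<in> ext ?A" .
    moreover have "gen (K \<union> ipow I ?k) \<subseteq> ?A" by (rule gen_mono) (use L(2) in blast)
    ultimately have "x * a \<in> ?A" by (intro contract[OF rideal_gen])
    then have "x * a \<in> gen (L \<union> ipow I m)"
      using gen_mono[of "L \<union> ipow I ?k" "L \<union> ipow I m"] ipow_antimono[of m ?k I] by auto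
    moreover have "x * a \<in> ?M" by (rule rideal_mult2[OF rideal_gen LM(2)])
    ultimately have xa: "x * a \<in> ?B" using m by blast
    \<comment> \<open>This is \<open>L + x * I ^ n\<close>; it contains \<open>?B\<close> because
      \<open>?M\<close> is \<open>L + (x)\<close>.\<close>
    let ?C = "{w. \<exists>c\<in>ipow I n. w - x * c \<in> L}"
    have C0: "w \<in> ?C" if "c \<in> ipow I n" "w - x * c \<in> L" for w c using that by blast
    have "?B \<subseteq> ?C"
    proof (rule gen_least)
      show "rideal ?C"
      proof (rule ridealI)
        show "0 \<in> ?C" by (rule C0[OF rideal_0[OF rideal_ipow]]) (simp add: rideal_0[OF L(1)])
      next
        fix u v assume "u \<in> ?C" "v \<in> ?C"
        then obtain c d where cd: "c \<in> ipow I n" "d \<in> ipow I n" "u - x * c \<in> L" "v - x * d \<in> L" by blast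
        have "(u - x * c) + (v - x * d) \<in> L" by (rule rideal_add[OF L(1) cd(3,4)])
        also have "(u - x * c) + (v - x * d) = u + v - x * (c + d)" by (simp add: algebra_simps)
        finally show "u + v \<in> ?C" by (rule C0[OF rideal_add[OF rideal_ipow cd(1,2)]])
      next
        fix r u assume "u \<in> ?C"
        then obtain c where c: "c \<in> ipow I n" "u - x * c \<in> L" by blast
        have "r * (u - x * c) \<in> L" by (rule rideal_mult[OF L(1) c(2)])
        also have "r * (u - x * c) = r * u - x * (r * c)" by (simp add: algebra_simps)
        finally show "r * u \<in> ?C" by (rule C0[OF rideal_mult[OF rideal_ipow c(1)]])
      qed
      show "L \<union> prods (ipow I n) ?M \<subseteq> ?C"
      proof
        fix w assume "w \<in> L \<union> prods (ipow I n) ?M"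
        then show "w \<in> ?C"
        proof
          assume "w \<in> L"
          then show ?thesis by (intro C0[OF rideal_0[OF rideal_ipow]]) simp
        next
          assume "w \<in> prods (ipow I n) ?M"
          then obtain c b where cb: "w = c * b" "c \<in> ipow I n" "b \<in> ?M" by blast
          obtain e where e: "b - e * x \<in> L" using cb(3) gen_insert_ideal_iff[OF L(1)] by blast
          have "c * (b - e * x) \<in> L" by (rule rideal_mult[OF L(1) e])
          also have "c * (b - e * x) = w - x * (c * e)" using cb(1) by (simp add: algebra_simps)
          finally show ?thesis by (rule C0[OF rideal_mult2[OF rideal_ipow cb(2)]])
        qed
      qed
    qed
    then obtain c where c: "c \<in> ipow I n" "x * a - x * c \<in> L" using xa by blast
    have "x * (a - c) \<in> L" using c(2) by (simp add: right_diff_distrib)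
    then have ac: "a - c \<in> L" using x unfolding nzd_def by blast
    let ?T = "gen (ext L \<union> ipow (ext I) n)"
    have T: "ext L \<subseteq> ?T" "ipow (ext I) n \<subseteq> ?T" using gen_superset by blast+
    have "\<phi> (a - c) \<in> ?T" using image_ext[OF ac] T(1) by blast
    moreover have "\<phi> c \<in> ?T" using image_ipow[OF c(1)] T(2) by blast
    ultimately have "\<phi> (a - c) + \<phi> c \<in> ?T" by (rule rideal_add[OF rideal_gen])
    then have "\<phi> a \<in> ?T" by (simp add: hom_diff)
    moreover have "a' - \<phi> a \<in> ?T"
    proof -
      have "a' - \<phi> a \<in> ext (ipow I n)" using a ext_mono[OF ipow_antimono[of n ?k I]] by auto
      moreover have "gen (K' \<union> ipow (ext I) n) \<subseteq> ?T" by (rule gen_mono) (use K'_ext in blast)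
      ultimately show ?thesis using ext_ipow by blast
    qed
    ultimately show "a' \<in> ?T" using rideal_diffD[OF rideal_gen] by blast
  qed
qed

lemma ext_insert: "ext (gen (insert x L)) = gen (insert (\<phi> x) (ext L))" if "K \<subseteq> L"
proof -
  have "K \<union> insert x L = insert x L" using that by blast
  then have "ext (gen (insert x L)) = ext (insert x L)" using ext_gen[of "insert x L"] by simp
  then show ?thesis by (simp add: ext_def gen_gen_insert)
qed

lemma regs_ext: "rideal L \<Longrightarrow> K \<subseteq> L \<Longrightarrow> regs L xs \<Longrightarrow> regs (ext L) (map \<phi> xs)"
proof (induction xs arbitrary: L)
  case (Cons x xs)
  have KL: "K \<subseteq> gen (insert x L)" using Cons.prems(2) gen_superset by blast
  show ?case using Cons.IH[OF rideal_gen KL] nzd_ext[OF Cons.prems(1,2), of x] Cons.prems(3)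
    by (simp add: ext_insert[OF Cons.prems(2)])
qed simp

text \<open>The witness \<open>z\<close> against a longer sequence is carried to
  \<open>\<phi> z\<close>, which stays outside the extended ideal because ideals of \<open>R\<close>
  are contracted.\<close>

theorem maxreg_ext:
  assumes "maxreg I K xs"
  shows "maxreg (ext I) K' (map \<phi> xs)"
proof (rule maxreg_of_socle)
  note Ki = noeth_rideal[OF nK]
  show "regs K' (map \<phi> xs)" using regs_ext[OF Ki order_refl, of xs] assms
    by (simp add: maxreg_def ext_K)
  show "set (map \<phi> xs) \<subseteq> ext I" using assms image_ext by (auto simp: maxreg_def)
  let ?L = "gen (K \<union> set xs)"
  have KL: "K \<subseteq> ?L" using gen_superset by blast
  obtain z where z: "z \<notin> ?L" "\<And>i. i \<in> I \<Longrightarrow> i * z \<in> ?L"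
    using socle_of_maxreg[OF nK I assms] unfolding socle_def by blast
  have "\<phi> z \<notin> ext ?L" using contract_closed[OF rideal_gen KL] z(1) by blast
  moreover have "ext I \<subseteq> {i. i * \<phi> z \<in> ext ?L}"
  proof (rule ext_least[OF rideal_colon[OF rideal_ext]])
    show "K' \<subseteq> {i. i * \<phi> z \<in> ext ?L}" using rideal_mult2[OF rideal_ext] K'_ext by blast
    fix i assume "i \<in> I"
    then show "\<phi> i \<in> {i. i * \<phi> z \<in> ext ?L}" using image_ext[OF z(2)] by (simp add: hom_mult)
  qed
  ultimately have "socle (ext I) (ext ?L)" unfolding socle_def by blast
  then show "socle (ext I) (gen (K' \<union> set (map \<phi> xs)))" unfolding ext_gen by (simp add: ext_def)
qed

subsection \<open>Dimension\<close>

lemma rmaximal_ext: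
  assumes m: "rmaximal m" "K \<subseteq> m"
  shows "rmaximal (ext m)"
  unfolding rmaximal_def
proof (intro conjI allI impI rideal_ext)
  note p = rmaximal_rprime[OF m(1)]
  have Im: "I \<subseteq> m" by (rule jac[OF m])
  show "1 \<notin> ext m"
  proof
    assume "1 \<in> ext m"
    then have "\<phi> 1 \<in> ext m" by (simp add: hom_one)
    then have "1 \<in> m" by (rule contract_closed[OF rprime_rideal[OF p] m(2)])
    then show False using rprime_one[OF p] by simp
  qed
  fix y assume y: "y \<notin> ext m"
  obtain z where z: "y - \<phi> z \<in> ext I" using dense_Suc0 by blast
  then have z': "y - \<phi> z \<in> ext m" using ext_mono[OF Im] by blast
  have "z \<notin> m" using y image_ext[of z m] rideal_diffD[OF rideal_ext z'] by blast
  then obtain u where u: "u * z - 1 \<in> m" using m(1) unfolding rmaximal_def by blast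
  have "\<phi> (u * z - 1) + \<phi> u * (y - \<phi> z) \<in> ext m"
    by (rule rideal_add[OF rideal_ext image_ext[OF u] rideal_mult[OF rideal_ext z']])
  also have "\<phi> (u * z - 1) + \<phi> u * (y - \<phi> z) = \<phi> u * y - 1"
    by (simp add: hom_diff hom_mult hom_one algebra_simps)
  finally show "\<exists>v. v * y - 1 \<in> ext m" by blast
qed

text \<open>\<open>M\<close> contains \<open>I C\<close>, and every element of \<open>C\<close> is
  an image up to \<open>I C\<close>, so \<open>M\<close> is recovered from its contraction.\<close>

lemma rmaximal_ext_surj:
  assumes M: "rmaximal M" "K' \<subseteq> M"
  obtains m where "rmaximal m" "K \<subseteq> m" "M = ext m"
proof -
  define m where "m = {a. \<phi> a \<in> M}"
  note p = rmaximal_rprime[OF M(1)]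
  note Mi = rprime_rideal[OF p]
  have IM: "ext I \<subseteq> M" by (rule ext_I_jacobson[OF M])
  have Km: "K \<subseteq> m" using hom_K M(2) unfolding m_def by blast
  have "rmaximal m" unfolding rmaximal_def
  proof (intro conjI allI impI)
    show "rideal m" unfolding m_def by (rule rideal_vimage[OF Mi])
    show "1 \<notin> m" using rprime_one[OF p] by (simp add: m_def hom_one)
    fix a assume "a \<notin> m"
    then obtain u where u: "u * \<phi> a - 1 \<in> M" using M(1) unfolding rmaximal_def m_def by blast
    obtain z where z: "u - \<phi> z \<in> ext I" using dense_Suc0 by blast
    have "(u * \<phi> a - 1) - (u - \<phi> z) * \<phi> a \<in> M"
      by (rule rideal_diff[OF Mi u rideal_mult2[OF Mi]]) (use z IM in blast)
    also have "(u * \<phi> a - 1) - (u - \<phi> z) * \<phi> a = \<phi> (z * a - 1)"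
      by (simp add: hom_diff hom_mult hom_one algebra_simps)
    finally show "\<exists>v. v * a - 1 \<in> m" unfolding m_def by blast
  qed
  moreover have "M = ext m"
  proof
    show "ext m \<subseteq> M" by (rule ext_least[OF Mi M(2)]) (simp add: m_def)
    show "M \<subseteq> ext m"
    proof
      fix y assume y: "y \<in> M"
      obtain z where z: "y - \<phi> z \<in> ext I" using dense_Suc0 by blast
      have "\<phi> z \<in> M" using rideal_diffD'[OF Mi _ y] z IM by blast
      then have "z \<in> m" by (simp add: m_def)
      moreover have "I \<subseteq> m" using IM image_ext unfolding m_def by blast
      ultimately show "y \<in> ext m" using z ext_mono image_ext rideal_diffD[OF rideal_ext] by blast
    qed
  qed
  ultimately show ?thesis using that Km by blast
qed

text \<open>Both sides become the parameter criterion. From \<open>R\<close> to \<open>C\<close> the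
  parameters are mapped by \<open>\<phi>\<close>; from \<open>C\<close> to \<open>R\<close> they are
  replaced by approximations.\<close>

lemma height_ext:
  assumes m: "rmaximal m" "K \<subseteq> m"
  shows "(\<forall>n. height_ge K' (ext m) n \<longrightarrow> n \<le> d) \<longleftrightarrow> (\<forall>n. height_ge K m n \<longrightarrow> n \<le> d)"
    (is "?l \<longleftrightarrow> ?r")
proof -
  let ?M = "ext m"
  note mi = rprime_rideal[OF rmaximal_rprime[OF m(1)]]
  have Im: "I \<subseteq> m" by (rule jac[OF m])
  have l: "?l \<longleftrightarrow> (\<exists>ys N. length ys = d \<and> set ys \<subseteq> ?M \<and> ipow ?M N \<subseteq> gen (K' \<union> set ys \<union> ipow ?M (Suc N)))"
    by (rule height_le_iff_maximal[OF noeth_K' rmaximal_ext[OF m] K'_ext])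
  have r: "?r \<longleftrightarrow> (\<exists>xs N. length xs = d \<and> set xs \<subseteq> m \<and> ipow m N \<subseteq> gen (K \<union> set xs \<union> ipow m (Suc N)))"
    by (rule height_le_iff_maximal[OF nK m])
  show ?thesis
  proof
    assume ?r
    then obtain xs N where xs: "length xs = d" "set xs \<subseteq> m"
      "ipow m N \<subseteq> gen (K \<union> set xs \<union> ipow m (Suc N))" unfolding r by blast
    have "ipow ?M N \<subseteq> ext (ipow m N)" by (rule ipow_ext)
    also have "\<dots> \<subseteq> ext (gen (K \<union> (set xs \<union> ipow m (Suc N))))"
      using xs(3) by (intro ext_mono) (simp only: Un_assoc)
    also have "\<dots> = ext (set xs \<union> ipow m (Suc N))" by (rule ext_gen)
    also have "\<dots> \<subseteq> gen (K' \<union> set (map \<phi> xs) \<union> ipow ?M (Suc N))" unfolding ext_def[of "set xs \<union> _"]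
    proof (rule gen_mono, rule subsetI)
      fix w assume "w \<in> K' \<union> \<phi> ` (set xs \<union> ipow m (Suc N))"
      then show "w \<in> K' \<union> set (map \<phi> xs) \<union> ipow ?M (Suc N)"
        using image_ipow[of _ m "Suc N"] by (auto simp del: ipow.simps)
    qed
    finally have "ipow ?M N \<subseteq> gen (K' \<union> set (map \<phi> xs) \<union> ipow ?M (Suc N))" .
    moreover have "set (map \<phi> xs) \<subseteq> ?M" using xs(2) image_ext by auto
    moreover have "length (map \<phi> xs) = d" using xs(1) by simp
    ultimately show ?l unfolding l by blast
  next
    assume ?l
    then obtain ys N where ys: "length ys = d" "set ys \<subseteq> ?M"
      "ipow ?M N \<subseteq> gen (K' \<union> set ys \<union> ipow ?M (Suc N))" unfolding l by blast
    \<comment> \<open>An error in \<open>I ^ (N + 1)\<close>, hence in \<open>m ^ (N + 1)\<close>,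
      is invisible to the criterion.\<close>
    have "\<forall>y. \<exists>x. y - \<phi> x \<in> ext (ipow I (Suc N))" by (rule allI, rule dense)
    from choice[OF this] obtain f where f: "\<And>y. y - \<phi> (f y) \<in> ext (ipow I (Suc N))" by blast
    define xs where "xs = map f ys"
    let ?A = "gen (K \<union> set xs \<union> ipow m (Suc N))"
    have A: "set xs \<subseteq> ?A" "ipow m (Suc N) \<subseteq> ?A"
      using gen_superset[of "K \<union> set xs \<union> ipow m (Suc N)"] by (simp_all del: ipow.simps)
    have KA: "gen (K \<union> ipow I (Suc N)) \<subseteq> ?A"
      by (rule gen_mono) (use ipow_mono[OF Im] in blast)
    have fA: "y - \<phi> (f y) \<in> ext ?A" for y
      using f ext_mono[OF order_trans[OF ipow_mono[OF Im] A(2)]] by blast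
    have fm: "f y \<in> m" if y: "y \<in> ?M" for y
    proof -
      have "ipow I (Suc N) \<subseteq> m" using ipow_subset[OF I, of "Suc N"] Im by (simp del: ipow.simps)
      then have "y - \<phi> (f y) \<in> ?M" using f ext_mono by blast
      then have "\<phi> (f y) \<in> ?M" by (rule rideal_diffD'[OF rideal_ext _ y])
      then show ?thesis by (rule contract_closed[OF mi m(2)])
    qed
    have sub: "gen (K' \<union> set ys \<union> ipow ?M (Suc N)) \<subseteq> ext ?A"
    proof (rule gen_least[OF rideal_ext], intro Un_least)
      show "K' \<subseteq> ext ?A" by (rule K'_ext)
      show "set ys \<subseteq> ext ?A"
      proof
        fix y assume "y \<in> set ys"
        then have "\<phi> (f y) \<in> ext ?A" by (intro image_ext subsetD[OF A(1)]) (simp add: xs_def)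
        then show "y \<in> ext ?A" by (rule rideal_diffD[OF rideal_ext fA])
      qed
      show "ipow ?M (Suc N) \<subseteq> ext ?A" by (rule order_trans[OF ipow_ext ext_mono[OF A(2)]])
    qed
    have "ipow m N \<subseteq> ?A"
    proof
      fix a assume "a \<in> ipow m N"
      then have "\<phi> a \<in> ext ?A" using image_ipow ys(3) sub by blast
      then show "a \<in> ?A" by (rule contract[OF rideal_gen KA])
    qed
    moreover have "set xs \<subseteq> m" "length xs = d" using ys fm by (auto simp: xs_def)
    ultimately show ?r unfolding r by blast
  qed
qed

theorem dim_le_ext: "dim_le K' d \<longleftrightarrow> dim_le K d"
  unfolding dim_le_iff_maximal[OF nK] dim_le_iff_maximal[OF noeth_K']
proof
  assume l: "\<forall>M. rmaximal M \<and> K' \<subseteq> M \<longrightarrow> (\<forall>n. height_ge K' M n \<longrightarrow> n \<le> d)"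
  show "\<forall>m. rmaximal m \<and> K \<subseteq> m \<longrightarrow> (\<forall>n. height_ge K m n \<longrightarrow> n \<le> d)"
  proof (rule allI, rule impI)
    fix m assume m: "rmaximal m \<and> K \<subseteq> m"
    then have "\<forall>n. height_ge K' (ext m) n \<longrightarrow> n \<le> d" using l rmaximal_ext K'_ext by blast
    then show "\<forall>n. height_ge K m n \<longrightarrow> n \<le> d" using height_ext m by blast
  qed
next
  assume r: "\<forall>m. rmaximal m \<and> K \<subseteq> m \<longrightarrow> (\<forall>n. height_ge K m n \<longrightarrow> n \<le> d)"
  show "\<forall>M. rmaximal M \<and> K' \<subseteq> M \<longrightarrow> (\<forall>n. height_ge K' M n \<longrightarrow> n \<le> d)"
  proof (rule allI, rule impI)
    fix M assume "rmaximal M \<and> K' \<subseteq> M"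
    then obtain m where m: "rmaximal m" "K \<subseteq> m" "M = ext m" using rmaximal_ext_surj by blast
    then show "\<forall>n. height_ge K' M n \<longrightarrow> n \<le> d" using height_ext[OF m(1,2)] r by blast
  qed
qed

end

section \<open>Presentations by free commutative rings\<close>

text \<open>Modulo \<open>req\<close>, the equational theory of commutative rings, these terms form
  the polynomial ring over the integers with variables \<open>'a\<close>. Terms make its maps into
  other rings plain recursions.\<close>

datatype 'a rexp = RVar 'a | RZero | ROne | RNeg "'a rexp" | RAdd "'a rexp" "'a rexp" | RMul "'a rexp" "'a rexp"

inductive req :: "'a rexp \<Rightarrow> 'a rexp \<Rightarrow> bool" where
  refl: "req a a"
| sym: "req a b \<Longrightarrow> req b a"
| trans: "req a b \<Longrightarrow> req b c \<Longrightarrow> req a c"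
| neg: "req a b \<Longrightarrow> req (RNeg a) (RNeg b)"
| add: "req a b \<Longrightarrow> req c d \<Longrightarrow> req (RAdd a c) (RAdd b d)"
| mul: "req a b \<Longrightarrow> req c d \<Longrightarrow> req (RMul a c) (RMul b d)"
| add_assoc: "req (RAdd (RAdd a b) c) (RAdd a (RAdd b c))"
| add_comm: "req (RAdd a b) (RAdd b a)"
| add_zero: "req (RAdd RZero a) a"
| add_neg: "req (RAdd (RNeg a) a) RZero"
| mul_assoc: "req (RMul (RMul a b) c) (RMul a (RMul b c))"
| mul_comm: "req (RMul a b) (RMul b a)"
| mul_one: "req (RMul ROne a) a"
| distrib: "req (RMul (RAdd a b) c) (RAdd (RMul a c) (RMul b c))"

primrec class_eval :: "('a \<Rightarrow> 'q::comm_ring_1) \<Rightarrow> 'a rexp \<Rightarrow> 'q" where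
  "class_eval v (RVar a) = v a"
| "class_eval v RZero = 0"
| "class_eval v ROne = 1"
| "class_eval v (RNeg a) = - class_eval v a"
| "class_eval v (RAdd a b) = class_eval v a + class_eval v b"
| "class_eval v (RMul a b) = class_eval v a * class_eval v b"

primrec carrier_eval :: "('c, 'd) ring_scheme \<Rightarrow> ('a \<Rightarrow> 'c) \<Rightarrow> 'a rexp \<Rightarrow> 'c" where
  "carrier_eval R v (RVar a) = v a"
| "carrier_eval R v RZero = \<zero>\<^bsub>R\<^esub>"
| "carrier_eval R v ROne = \<one>\<^bsub>R\<^esub>"
| "carrier_eval R v (RNeg a) = \<ominus>\<^bsub>R\<^esub> carrier_eval R v a"
| "carrier_eval R v (RAdd a b) = carrier_eval R v a \<oplus>\<^bsub>R\<^esub> carrier_eval R v b"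
| "carrier_eval R v (RMul a b) = carrier_eval R v a \<otimes>\<^bsub>R\<^esub> carrier_eval R v b"

lemma class_eval_req: "req a b \<Longrightarrow> class_eval v a = class_eval v b"
  by (induction rule: req.induct) (simp_all add: algebra_simps)

context
  fixes R :: "('c, 'd) ring_scheme" and v :: "'a \<Rightarrow> 'c"
  assumes R: "cring R" and v: "\<And>a. v a \<in> carrier R"
begin

interpretation cring R by (rule R)

lemma carrier_eval_closed: "carrier_eval R v e \<in> carrier R"
  by (induction e) (simp_all add: v)

lemma carrier_eval_req: "req a b \<Longrightarrow> carrier_eval R v a = carrier_eval R v b"
  by (induction rule: req.induct)
     (simp_all add: carrier_eval_closed a_ac m_ac l_distr r_distr l_neg r_neg)

end

quotient_type 'a free_cring = "'a rexp" / req
  by (intro equivpI reflpI sympI transpI) (auto intro: req.intros)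

instantiation free_cring :: (type) comm_ring_1
begin

lift_definition zero_free_cring :: "'a free_cring" is RZero .
lift_definition one_free_cring :: "'a free_cring" is ROne .
lift_definition uminus_free_cring :: "'a free_cring \<Rightarrow> 'a free_cring" is RNeg by (rule req.neg)
lift_definition plus_free_cring :: "'a free_cring \<Rightarrow> 'a free_cring \<Rightarrow> 'a free_cring" is RAdd
  by (rule req.add)
lift_definition times_free_cring :: "'a free_cring \<Rightarrow> 'a free_cring \<Rightarrow> 'a free_cring" is RMul
  by (rule req.mul)
definition minus_free_cring :: "'a free_cring \<Rightarrow> 'a free_cring \<Rightarrow> 'a free_cring" where
  "minus_free_cring a b = a + - b"

instance
proof
  fix a b c :: "'a free_cring"
  show "a + b + c = a + (b + c)" by transfer (rule req.add_assoc)
  show "a + b = b + a" by transfer (rule req.add_comm)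
  show "0 + a = a" by transfer (rule req.add_zero)
  show "- a + a = 0" by transfer (rule req.add_neg)
  show "a * b * c = a * (b * c)" by transfer (rule req.mul_assoc)
  show "a * b = b * a" by transfer (rule req.mul_comm)
  show "1 * a = a" by transfer (rule req.mul_one)
  show "(a + b) * c = a * c + b * c" by transfer (rule req.distrib)
  show "a - b = a + - b" by (rule minus_free_cring_def)
  show "(0 :: 'a free_cring) \<noteq> 1"
  proof (transfer, rule notI)
    assume "req RZero (ROne :: 'a rexp)"
    \<comment> \<open>Evaluation in the integers distinguishes 0 from 1.\<close>
    from class_eval_req[OF this, of "\<lambda>_. 0 :: int"] show False by simp
  qed
qed

end

lift_definition free_var :: "'a \<Rightarrow> 'a free_cring" is RVar .

lift_definition free_hom :: "('a \<Rightarrow> 'q::comm_ring_1) \<Rightarrow> 'a free_cring \<Rightarrow> 'q" is class_eval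
  by (rule class_eval_req)

lemma free_hom_hom:
  "free_hom v (x + y) = free_hom v x + free_hom v y"
  "free_hom v (x * y) = free_hom v x * free_hom v y"
  "free_hom v 1 = 1" "free_hom v (free_var a) = v a"
  by (transfer, simp)+

text \<open>Defined through representatives rather than lifted: that \<open>carrier_eval\<close>
  respects \<open>req\<close> depends on \<open>R\<close> being a commutative ring and on
  \<open>v\<close> having its values in the carrier.\<close>

definition free_eval :: "('c, 'd) ring_scheme \<Rightarrow> ('a \<Rightarrow> 'c) \<Rightarrow> 'a free_cring \<Rightarrow> 'c" where
  "free_eval R v x = carrier_eval R v (rep_free_cring x)"

lemma free_eval_abs:
  assumes "cring R" "\<And>a. v a \<in> carrier R"
  shows "free_eval R v (abs_free_cring e) = carrier_eval R v e"
proof -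
  have "abs_free_cring (rep_free_cring (abs_free_cring e)) = abs_free_cring e"
    using Quotient3_abs_rep[OF Quotient3_free_cring] by blast
  then have "req (rep_free_cring (abs_free_cring e)) e" by (simp add: free_cring.abs_eq_iff)
  then show ?thesis unfolding free_eval_def by (rule carrier_eval_req[where v = v, OF assms])
qed

lemma free_eval_hom:
  assumes "cring R" "\<And>a. v a \<in> carrier R"
  shows "free_eval R v x \<in> carrier R"
    "free_eval R v (x + y) = free_eval R v x \<oplus>\<^bsub>R\<^esub> free_eval R v y"
    "free_eval R v (x * y) = free_eval R v x \<otimes>\<^bsub>R\<^esub> free_eval R v y"
    "free_eval R v 1 = \<one>\<^bsub>R\<^esub>" "free_eval R v (free_var a) = v a"
proof -
  note ab = free_eval_abs[where v = v, OF assms]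
  show "free_eval R v x \<in> carrier R" unfolding free_eval_def by (rule carrier_eval_closed[where v = v, OF assms])
  show "free_eval R v (x + y) = free_eval R v x \<oplus>\<^bsub>R\<^esub> free_eval R v y"
    by (induction x rule: free_cring.abs_induct, induction y rule: free_cring.abs_induct)
       (simp add: plus_free_cring.abs_eq ab)
  show "free_eval R v (x * y) = free_eval R v x \<otimes>\<^bsub>R\<^esub> free_eval R v y"
    by (induction x rule: free_cring.abs_induct, induction y rule: free_cring.abs_induct)
       (simp add: times_free_cring.abs_eq ab)
  show "free_eval R v 1 = \<one>\<^bsub>R\<^esub>" by (simp add: one_free_cring_def ab)
  show "free_eval R v (free_var a) = v a" by (simp add: free_var.abs_eq ab)
qed

locale class_hom = cring R for R (structure) +
  fixes \<pi> :: "'p::comm_ring_1 \<Rightarrow> 'a"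
  assumes pi_closed [simp]: "\<pi> x \<in> carrier R"
    and pi_add: "\<pi> (x + y) = \<pi> x \<oplus> \<pi> y"
    and pi_mult: "\<pi> (x * y) = \<pi> x \<otimes> \<pi> y"
    and pi_one: "\<pi> 1 = \<one>"
begin

lemma pi_zero: "\<pi> 0 = \<zero>"
  using pi_add[of 0 0] add.l_cancel_one[of "\<pi> 0" "\<pi> 0"] by simp

lemma pi_uminus: "\<pi> (- x) = \<ominus> \<pi> x"
  using pi_add[of "- x" x] minus_equality[of "\<pi> (- x)" "\<pi> x"] by (simp add: pi_zero)

end

text \<open>This reduces the compatibility of \<open>\<phi>\<close> with the canonical map to the
  completion to a check on variables.\<close>

lemma free_cring_hom_unique:
  fixes f g :: "'a free_cring \<Rightarrow> 'c"
  assumes f: "class_hom R f" and g: "class_hom R g" and fg: "\<And>a. f (free_var a) = g (free_var a)"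
  shows "f x = g x"
proof (induction x rule: free_cring.abs_induct)
  case (1 e)
  note simps = zero_free_cring.abs_eq[symmetric] one_free_cring.abs_eq[symmetric]
    uminus_free_cring.abs_eq[symmetric] plus_free_cring.abs_eq[symmetric]
    times_free_cring.abs_eq[symmetric] free_var.abs_eq[symmetric]
  show ?case
    by (induction e)
       (simp_all add: simps fg class_hom.pi_zero[OF f] class_hom.pi_zero[OF g]
         class_hom.pi_one[OF f] class_hom.pi_one[OF g] class_hom.pi_uminus[OF f] class_hom.pi_uminus[OF g]
         class_hom.pi_add[OF f] class_hom.pi_add[OF g] class_hom.pi_mult[OF f] class_hom.pi_mult[OF g])
qed

locale presentation = class_hom R \<pi> for R (structure) and \<pi> :: "'p::comm_ring_1 \<Rightarrow> 'a" +
  fixes K :: "'p set"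
  assumes pi_surj: "a \<in> carrier R \<Longrightarrow> \<exists>x. \<pi> x = a"
    and mem_K: "x \<in> K \<longleftrightarrow> \<pi> x = \<zero>"

text \<open>Every element of the type is a variable, so those outside the carrier need a value too;
  they go to zero.\<close>

lemma free_presentation:
  assumes "cring R"
  defines "v \<equiv> \<lambda>a. if a \<in> carrier R then a else \<zero>\<^bsub>R\<^esub>"
  shows "presentation R (free_eval R v) {x. free_eval R v x = \<zero>\<^bsub>R\<^esub>}"
proof -
  interpret cring R by (rule assms)
  have v: "v a \<in> carrier R" for a by (simp add: v_def)
  note h = free_eval_hom[where v = v, OF assms(1) v]
  show ?thesis
  proof unfold_locales
    fix a assume "a \<in> carrier R"
    then have "free_eval R v (free_var a) = a" using h(5)[of a] by (simp add: v_def)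
    then show "\<exists>x. free_eval R v x = a" by blast
  qed (simp_all add: h)
qed

section \<open>Translation of ideals, dimension and grade along a presentation\<close>

context presentation
begin

abbreviation vim :: "'a set \<Rightarrow> 'p set" where "vim J \<equiv> {x. \<pi> x \<in> J}"

lemma pi_eq_iff: "\<pi> x = \<pi> y \<longleftrightarrow> x - y \<in> K"
  using pi_add[of x "- y"] r_right_minus_eq[of "\<pi> x" "\<pi> y"]
  by (simp add: mem_K pi_uminus a_minus_def)

lemma rideal_vim:
  assumes "ideal J R" shows "rideal (vim J)"
proof -
  interpret J: ideal J R by (rule assms)
  show ?thesis by (rule ridealI) (simp_all add: pi_zero pi_add pi_mult J.I_l_closed)
qed

lemma K_vim: "ideal J R \<Longrightarrow> K \<subseteq> vim J"
  using additive_subgroup.zero_closed[OF ideal.axioms(1)] by (auto simp: mem_K)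

lemma ideal_image:
  assumes L: "rideal L" shows "ideal (\<pi> ` L) R"
proof (rule idealI[OF ring_axioms])
  show "subgroup (\<pi> ` L) (add_monoid R)"
    unfolding subgroup_def
  proof (intro conjI allI impI)
    fix x y assume "x \<in> \<pi> ` L" "y \<in> \<pi> ` L"
    then obtain a b where ab: "a \<in> L" "b \<in> L" "x = \<pi> a" "y = \<pi> b" by blast
    then have "x \<otimes>\<^bsub>add_monoid R\<^esub> y = \<pi> (a + b)" by (simp add: pi_add)
    then show "x \<otimes>\<^bsub>add_monoid R\<^esub> y \<in> \<pi> ` L" using rideal_add[OF L ab(1,2)] by blast
  next
    show "\<one>\<^bsub>add_monoid R\<^esub> \<in> \<pi> ` L" using rideal_0[OF L] by (simp add: pi_zero[symmetric])
  next
    fix x assume "x \<in> \<pi> ` L"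
    then obtain a where a: "a \<in> L" "x = \<pi> a" by blast
    then have "inv\<^bsub>add_monoid R\<^esub> x = \<pi> (- a)" by (simp add: pi_uminus a_inv_def)
    then show "inv\<^bsub>add_monoid R\<^esub> x \<in> \<pi> ` L" using rideal_uminus[OF L a(1)] by blast
  qed auto
  fix x y assume x: "x \<in> \<pi> ` L" and y: "y \<in> carrier R"
  obtain a b where ab: "a \<in> L" "x = \<pi> a" "y = \<pi> b" using x pi_surj[OF y] by blast
  show "y \<otimes> x \<in> \<pi> ` L" "x \<otimes> y \<in> \<pi> ` L"
    using rideal_mult[OF L ab(1), of b] rideal_mult2[OF L ab(1), of b] unfolding ab(2,3) pi_mult[symmetric]
    by blast+
qed

lemma vim_image: "rideal L \<Longrightarrow> K \<subseteq> L \<Longrightarrow> vim (\<pi> ` L) = L"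
proof
  assume L: "rideal L" "K \<subseteq> L"
  show "vim (\<pi> ` L) \<subseteq> L"
  proof
    fix x assume "x \<in> vim (\<pi> ` L)"
    then obtain l where l: "l \<in> L" "\<pi> x = \<pi> l" by auto
    then have "x - l \<in> L" using pi_eq_iff L(2) by blast
    then show "x \<in> L" by (rule rideal_diffD[OF L(1) _ l(1)])
  qed
qed auto

lemma image_vim: "J \<subseteq> carrier R \<Longrightarrow> \<pi> ` vim J = J"
  using pi_surj by force

lemma ideal_subset: "ideal J R \<Longrightarrow> J \<subseteq> carrier R"
  using additive_subgroup.a_subset[OF ideal.axioms(1)] .

lemma vim_eq_iff: "J \<subseteq> carrier R \<Longrightarrow> J' \<subseteq> carrier R \<Longrightarrow> vim J = vim J' \<longleftrightarrow> J = J'"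
  by (metis image_vim)

lemma one_vim_iff: "ideal J R \<Longrightarrow> 1 \<in> vim J \<longleftrightarrow> J = carrier R"
  using ideal.one_imp_carrier by (auto simp: pi_one)

lemma vim_Idl: "vim (Idl (\<pi> ` Z)) = gen (K \<union> Z)"
proof
  have Zc: "\<pi> ` Z \<subseteq> carrier R" by auto
  have KG: "K \<subseteq> gen (K \<union> Z)" using gen_superset by blast
  have "Idl (\<pi> ` Z) \<subseteq> \<pi> ` gen (K \<union> Z)"
    by (rule genideal_minimal[OF ideal_image[OF rideal_gen]]) (use gen_superset in blast)
  then show "vim (Idl (\<pi> ` Z)) \<subseteq> gen (K \<union> Z)" using vim_image[OF rideal_gen KG] by blast
  show "gen (K \<union> Z) \<subseteq> vim (Idl (\<pi> ` Z))"
    by (rule gen_least[OF rideal_vim[OF genideal_ideal[OF Zc]]])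
       (use K_vim[OF genideal_ideal[OF Zc]] genideal_self[OF Zc] in blast)
qed

lemma rideal_K: "rideal K"
proof -
  have "K = vim {\<zero>}" using mem_K by auto
  then show ?thesis using rideal_vim[OF zeroideal] by simp
qed

lemma noeth_K: assumes "noetherian_ring R" shows "noeth K"
  unfolding noeth_def
proof (intro conjI allI impI rideal_K)
  fix J assume J: "rideal J \<and> K \<subseteq> J"
  then obtain A where A: "A \<subseteq> carrier R" "finite A" "\<pi> ` J = Idl A"
    using noetherian_ring.finetely_gen[OF assms ideal_image] by metis
  have "A \<subseteq> range \<pi>" using A(1) pi_surj by blast
  then obtain F where F: "finite F" "A = \<pi> ` F" using finite_subset_image[OF A(2)] by metis
  have "J = vim (\<pi> ` J)" using vim_image J by simp
  also have "\<dots> = gen (K \<union> F)" unfolding A(3) F(2) by (rule vim_Idl)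
  finally show "\<exists>F. finite F \<and> J = gen (K \<union> F)" using F(1) by blast
qed

lemma rprime_vim:
  assumes "primeideal P R" shows "rprime (vim P)"
proof -
  interpret P: primeideal P R by (rule assms)
  show ?thesis unfolding rprime_def
  proof (intro conjI allI impI)
    show "rideal (vim P)" by (rule rideal_vim[OF P.is_ideal])
    show "1 \<notin> vim P" using one_vim_iff[OF P.is_ideal] P.I_notcarr by simp
    fix a b assume "a * b \<in> vim P"
    then show "a \<in> vim P \<or> b \<in> vim P" using P.I_prime[of "\<pi> a" "\<pi> b"] by (simp add: pi_mult)
  qed
qed

lemma primeideal_image:
  assumes p: "rprime p" "K \<subseteq> p" shows "primeideal (\<pi> ` p) R"
proof (rule primeidealI[OF ideal_image[OF rprime_rideal[OF p(1)]] is_cring])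
  note v = vim_image[OF rprime_rideal[OF p(1)] p(2)]
  show "carrier R \<noteq> \<pi> ` p"
  proof
    assume "carrier R = \<pi> ` p"
    then have "1 \<in> vim (\<pi> ` p)" using pi_closed[of 1] by simp
    then show False using v rprime_one[OF p(1)] by simp
  qed
  fix a b assume ab: "a \<in> carrier R" "b \<in> carrier R" "a \<otimes> b \<in> \<pi> ` p"
  obtain x y where xy: "\<pi> x = a" "\<pi> y = b" using pi_surj[OF ab(1)] pi_surj[OF ab(2)] by blast
  have "x * y \<in> vim (\<pi> ` p)" using ab(3) xy by (simp add: pi_mult)
  then have "x \<in> p \<or> y \<in> p" unfolding v using p(1) by (simp add: rprime_def)
  then show "a \<in> \<pi> ` p \<or> b \<in> \<pi> ` p" using xy by blast
qed

lemma maximalideal_image: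
  assumes m: "rmaximal m" "K \<subseteq> m" shows "maximalideal (\<pi> ` m) R"
proof (rule maximalidealI)
  note p = rmaximal_rprime[OF m(1)]
  note v = vim_image[OF rprime_rideal[OF p] m(2)]
  show "ideal (\<pi> ` m) R" by (rule ideal_image[OF rprime_rideal[OF p]])
  show "carrier R \<noteq> \<pi> ` m" using primeideal.I_notcarr[OF primeideal_image[OF p m(2)]] .
  fix J assume J: "ideal J R" "\<pi> ` m \<subseteq> J" "J \<subseteq> carrier R"
  show "J = \<pi> ` m \<or> J = carrier R"
  proof (cases "1 \<in> vim J")
    case True
    then show ?thesis using one_vim_iff[OF J(1)] by simp
  next
    case False
    have "m \<subseteq> vim J" using J(2) by blast
    then have "vim J = m" by (rule rmaximal_maximal[OF m(1) rideal_vim[OF J(1)] False])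
    then show ?thesis using image_vim[OF J(3)] by simp
  qed
qed

lemma height_ge_of_chain:
  assumes "\<And>i. i \<le> n \<Longrightarrow> primeideal (p i) R" "\<And>i. i < n \<Longrightarrow> p i \<subset> p (Suc i)"
  shows "i \<le> n \<Longrightarrow> height_ge K (vim (p i)) i"
proof (induction i)
  case 0
  then show ?case using rprime_vim assms(1) K_vim primeideal.axioms(1) by (simp, blast)
next
  case (Suc i)
  have sub: "p i \<subseteq> carrier R" "p (Suc i) \<subseteq> carrier R"
    using assms(1) Suc.prems primeideal.axioms(1) ideal_subset by (metis Suc_leD)+
  have "p i \<subset> p (Suc i)" using assms(2) Suc.prems by simp
  then have "vim (p i) \<subset> vim (p (Suc i))" using vim_eq_iff[OF sub] by auto
  moreover have "height_ge K (vim (p i)) i" using Suc by simp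
  moreover have "rprime (vim (p (Suc i)))" using rprime_vim assms(1) Suc.prems by simp
  ultimately show ?case by auto
qed

lemma chain_of_height_ge:
  "height_ge K q n \<Longrightarrow> \<exists>p. (\<forall>i\<le>n. primeideal (p i) R) \<and> (\<forall>i<n. p i \<subset> p (Suc i)) \<and> p n = \<pi> ` q"
proof (induction n arbitrary: q)
  case 0
  then show ?case using primeideal_image[of q] by (intro exI[of _ "\<lambda>_. \<pi> ` q"]) simp
next
  case (Suc n)
  have q: "rprime q" "K \<subseteq> q" using height_ge_prime[OF Suc.prems] by auto
  obtain t where t: "t \<subset> q" "height_ge K t n" using Suc.prems by auto
  have t': "rprime t" "K \<subseteq> t" using height_ge_prime[OF t(2)] by auto
  obtain p where p: "\<forall>i\<le>n. primeideal (p i) R" "\<forall>i<n. p i \<subset> p (Suc i)" "p n = \<pi> ` t"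
    using Suc.IH[OF t(2)] by blast
  have ne: "\<pi> ` t \<noteq> \<pi> ` q"
    using vim_image[OF rprime_rideal[OF q(1)] q(2)] vim_image[OF rprime_rideal[OF t'(1)] t'(2)] t(1) by auto
  have sub: "\<pi> ` t \<subset> \<pi> ` q" using t(1) ne by auto
  define p' where "p' i = (if i \<le> n then p i else \<pi> ` q)" for i
  have "\<forall>i\<le>Suc n. primeideal (p' i) R" using p(1) primeideal_image[OF q] by (simp add: p'_def)
  moreover have "p' i \<subset> p' (Suc i)" if i: "i < Suc n" for i
  proof (cases "i = n")
    case True
    then show ?thesis using sub p(3) by (simp add: p'_def)
  next
    case False
    then have "i < n" using i by simp
    then show ?thesis using p(2) by (simp add: p'_def)
  qed
  ultimately show ?case by (intro exI[of _ p']) (simp add: p'_def)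
qed

text \<open>A finite bound on the supremum is a bound on the length of every chain; for the zero
  ring there are no chains, and both sides hold.\<close>

lemma krull_dim_le_iff: "krull_dim R \<le> enat d \<longleftrightarrow> (\<forall>p n. height_ge K p n \<longrightarrow> n \<le> d)"
proof -
  have "krull_dim R \<le> enat d \<longleftrightarrow> (\<forall>n p. (\<forall>i\<le>n. primeideal (p i) R) \<and> (\<forall>i<n. p i \<subset> p (Suc i)) \<longrightarrow> n \<le> d)"
  proof -
    have "{enat n |n. \<exists>p :: nat \<Rightarrow> 'a set. (\<forall>i\<le>n. primeideal (p i) R) \<and> (\<forall>i<n. p i \<subset> p (Suc i))} =
      enat ` {n. \<exists>p :: nat \<Rightarrow> 'a set. (\<forall>i\<le>n. primeideal (p i) R) \<and> (\<forall>i<n. p i \<subset> p (Suc i))}"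
      by (simp add: image_Collect)
    then show ?thesis
      unfolding krull_dim_def Sup_le_iff by (simp only: ball_simps mem_Collect_eq enat_ord_simps) metis
  qed
  also have "\<dots> \<longleftrightarrow> (\<forall>p n. height_ge K p n \<longrightarrow> n \<le> d)"
  proof
    assume l: "\<forall>n p. (\<forall>i\<le>n. primeideal (p i) R) \<and> (\<forall>i<n. p i \<subset> p (Suc i)) \<longrightarrow> n \<le> d"
    show "\<forall>p n. height_ge K p n \<longrightarrow> n \<le> d"
    proof (intro allI impI)
      fix q n assume "height_ge K q n"
      from chain_of_height_ge[OF this] obtain p where
        "(\<forall>i\<le>n. primeideal (p i) R) \<and> (\<forall>i<n. p i \<subset> p (Suc i))" by metis
      then show "n \<le> d" using l by metis
    qed
  next
    assume r: "\<forall>p n. height_ge K p n \<longrightarrow> n \<le> d"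
    show "\<forall>n p. (\<forall>i\<le>n. primeideal (p i) R) \<and> (\<forall>i<n. p i \<subset> p (Suc i)) \<longrightarrow> n \<le> d"
    proof (intro allI impI)
      fix n p assume p: "(\<forall>i\<le>n. primeideal (p i) R) \<and> (\<forall>i<n. p i \<subset> p (Suc i))"
      have "height_ge K (vim (p n)) n" by (rule height_ge_of_chain[of n p n]) (use p in simp_all)
      then show "n \<le> d" using r by metis
    qed
  qed
  finally show ?thesis .
qed

lemma nonzerodivisor_iff: "nonzerodivisor R (\<pi> x) \<longleftrightarrow> nzd K x"
proof
  assume l: "nonzerodivisor R (\<pi> x)"
  show "nzd K x" unfolding nzd_def
  proof (intro allI impI)
    fix a assume "x * a \<in> K"
    then have "\<pi> x \<otimes> \<pi> a = \<zero>" by (simp add: mem_K pi_mult)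
    then show "a \<in> K" using l pi_closed[of a] unfolding nonzerodivisor_def mem_K by blast
  qed
next
  assume r: "nzd K x"
  show "nonzerodivisor R (\<pi> x)" unfolding nonzerodivisor_def
  proof (intro conjI ballI impI)
    fix a assume a: "a \<in> carrier R" "\<pi> x \<otimes> a = \<zero>"
    obtain b where b: "\<pi> b = a" using pi_surj[OF a(1)] by blast
    then have "x * b \<in> K" using a(2) by (simp add: mem_K pi_mult)
    then have "b \<in> K" using r unfolding nzd_def by blast
    then show "a = \<zero>" using b by (simp add: mem_K)
  qed simp
qed

text \<open>The same ambient ring presents every quotient, with a larger base ideal, so
  \<open>nonzerodivisor_iff\<close> and \<open>krull_dim_le_iff\<close> apply to quotients of
  \<open>R\<close> as well.\<close>

lemma quotient_presentation:
  assumes J: "ideal J R"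
  shows "presentation (R Quot J) (\<lambda>x. J +> \<pi> x) (vim J)"
proof -
  interpret J: ideal J R by (rule J)
  interpret Q: cring "R Quot J" by (rule J.quotient_is_cring[OF is_cring])
  note h = J.rcos_ring_hom
  show ?thesis
  proof unfold_locales
    fix x y
    show "J +> \<pi> x \<in> carrier (R Quot J)" using ring_hom_closed[OF h] by simp
    show "J +> \<pi> (x + y) = (J +> \<pi> x) \<oplus>\<^bsub>R Quot J\<^esub> (J +> \<pi> y)"
      unfolding pi_add by (rule ring_hom_add[OF h]) simp_all
    show "J +> \<pi> (x * y) = (J +> \<pi> x) \<otimes>\<^bsub>R Quot J\<^esub> (J +> \<pi> y)"
      unfolding pi_mult by (rule ring_hom_mult[OF h]) simp_all
    show "J +> \<pi> 1 = \<one>\<^bsub>R Quot J\<^esub>" unfolding pi_one by (rule ring_hom_one[OF h])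
    have "J +> \<pi> x = J \<longleftrightarrow> \<pi> x \<in> J"
      using J.rcos_const_imp_mem[of "\<pi> x"] a_rcos_zero[OF J, of "\<pi> x"] by auto
    then show "x \<in> vim J \<longleftrightarrow> J +> \<pi> x = \<zero>\<^bsub>R Quot J\<^esub>" by (simp add: FactRing_def)
  next
    fix a assume "a \<in> carrier (R Quot J)"
    then obtain b where b: "b \<in> carrier R" "a = J +> b" by (auto simp: FactRing_def A_RCOSETS_def')
    then show "\<exists>x. J +> \<pi> x = a" using pi_surj by metis
  qed
qed

lemma regular_sequence_iff:
  "regular_sequence R (map \<pi> xs) \<longleftrightarrow> regs K xs \<and> 1 \<notin> gen (K \<union> set xs)"
proof -
  have nz: "nonzerodivisor (R Quot Idl (set (take i (map \<pi> xs)))) (Idl (set (take i (map \<pi> xs))) +> map \<pi> xs ! i)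
      \<longleftrightarrow> nzd (gen (K \<union> set (take i xs))) (xs ! i)" if i: "i < length xs" for i
  proof -
    let ?J = "Idl (\<pi> ` set (take i xs))"
    have J: "ideal ?J R" by (rule genideal_ideal) auto
    interpret Q: presentation "R Quot ?J" "\<lambda>x. ?J +> \<pi> x" "vim ?J" by (rule quotient_presentation[OF J])
    have "set (take i (map \<pi> xs)) = \<pi> ` set (take i xs)" by (simp add: take_map)
    then show ?thesis using Q.nonzerodivisor_iff[of "xs ! i"] i by (simp add: vim_Idl)
  qed
  have I: "ideal (Idl (\<pi> ` set xs)) R" by (rule genideal_ideal) auto
  have "Idl (set (map \<pi> xs)) \<noteq> carrier R \<longleftrightarrow> 1 \<notin> gen (K \<union> set xs)"
    using one_vim_iff[OF I] unfolding vim_Idl by simp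
  moreover have "set (map \<pi> xs) \<subseteq> carrier R" by auto
  ultimately show ?thesis
    unfolding regular_sequence_def regs_iff_nth[OF rideal_K] Let_def using nz by simp
qed

text \<open>Elements of a proper ideal generate a proper ideal, which leaves only the condition
  expressed by \<open>regs\<close>.\<close>

lemma maximal_regular_sequence_iff:
  assumes J: "ideal J R" "J \<noteq> carrier R"
  shows "maximal_regular_sequence_in R J (map \<pi> xs) \<longleftrightarrow> maxreg (vim J) K xs"
proof -
  have proper: "1 \<notin> gen (K \<union> Z)" if "Z \<subseteq> vim J" for Z
    using gen_least[OF rideal_vim[OF J(1)], of "K \<union> Z"] K_vim[OF J(1)] one_vim_iff[OF J(1)] J(2) that by blast
  have set: "set (map \<pi> xs) \<subseteq> J \<longleftrightarrow> set xs \<subseteq> vim J" by auto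
  have snoc: "regular_sequence R (map \<pi> xs @ [\<pi> y]) \<longleftrightarrow> nzd (gen (K \<union> set xs)) y"
    if "set xs \<subseteq> vim J" "y \<in> vim J" "regs K xs" for y
  proof -
    have "1 \<notin> gen (K \<union> set (xs @ [y]))" by (rule proper) (use that in auto)
    then show ?thesis using regular_sequence_iff[of "xs @ [y]"] that(3)
      by (simp add: regs_append[OF rideal_K])
  qed
  have all: "(\<forall>y\<in>J. \<not> regular_sequence R (map \<pi> xs @ [y])) \<longleftrightarrow>
      (\<forall>y\<in>vim J. \<not> nzd (gen (K \<union> set xs)) y)" if "set xs \<subseteq> vim J" "regs K xs"
  proof -
    have "(\<forall>y\<in>\<pi> ` vim J. \<not> regular_sequence R (map \<pi> xs @ [y])) \<longleftrightarrow>
      (\<forall>y\<in>vim J. \<not> nzd (gen (K \<union> set xs)) y)" unfolding ball_simps using snoc that by blast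
    then show ?thesis unfolding image_vim[OF ideal_subset[OF J(1)]] .
  qed
  show ?thesis
  proof (cases "set xs \<subseteq> vim J \<and> regs K xs")
    case True
    then show ?thesis unfolding maximal_regular_sequence_in_def maxreg_def set
      using all proper[of "set xs"] regular_sequence_iff[of xs] by simp
  next
    case False
    then show ?thesis unfolding maximal_regular_sequence_in_def maxreg_def set
      using regular_sequence_iff[of xs] by blast
  qed
qed

text \<open>\<open>rees_length_unique\<close> makes the description in \<open>grade\<close>
  unambiguous, and any sequence in \<open>J\<close> lifts along \<open>\<pi>\<close>.\<close>

lemma grade_eq:
  assumes K: "noeth K" and J: "ideal J R" "J \<noteq> carrier R" and xs: "maxreg (vim J) K xs"
  shows "grade J R = length xs"
  unfolding grade_def
proof (rule the_equality)
  show "\<exists>ys. maximal_regular_sequence_in R J ys \<and> length ys = length xs"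
    using maximal_regular_sequence_iff[OF J, of xs] xs by (intro exI[of _ "map \<pi> xs"]) simp
  fix n assume "\<exists>ys. maximal_regular_sequence_in R J ys \<and> length ys = n"
  then obtain ys where ys: "maximal_regular_sequence_in R J ys" "length ys = n" by blast
  have "\<forall>y\<in>set ys. \<exists>x. y = \<pi> x"
    using ys(1) ideal_subset[OF J(1)] pi_surj unfolding maximal_regular_sequence_in_def by (metis subsetD)
  then obtain zs where zs: "ys = map \<pi> zs" using ex_map_conv[of ys \<pi>] by blast
  then have "maxreg (vim J) K zs" using maximal_regular_sequence_iff[OF J] ys(1) by simp
  then show "n = length xs" using rees_length_unique[OF K rideal_vim[OF J(1)] xs] ys(2) zs by simp
qed

lemma vim_ideal_prod:
  assumes A: "ideal A R" and J: "ideal J R"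
  shows "vim (ideal_prod R A J) = gen (K \<union> prods (vim A) (vim J))"
proof
  let ?G = "gen (K \<union> prods (vim A) (vim J))"
  have KG: "K \<subseteq> ?G" using gen_superset by blast
  have "ideal_prod R A J \<subseteq> \<pi> ` ?G"
  proof
    fix s assume "s \<in> ideal_prod R A J"
    then show "s \<in> \<pi> ` ?G"
    proof (induction s rule: ideal_prod.induct)
      case (prod i j)
      obtain a b where ab: "\<pi> a = i" "\<pi> b = j"
        using prod pi_surj ideal_subset[OF A] ideal_subset[OF J] by (meson subsetD)
      then have "a * b \<in> ?G" using prod by (intro gen_base) blast
      then have "\<pi> (a * b) \<in> \<pi> ` ?G" by (rule imageI)
      then show ?case by (simp add: pi_mult ab)
    next
      case (sum s t)
      then obtain a b where ab: "a \<in> ?G" "b \<in> ?G" "s = \<pi> a" "t = \<pi> b" by blast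
      have "\<pi> (a + b) \<in> \<pi> ` ?G" by (rule imageI[OF rideal_add[OF rideal_gen ab(1,2)]])
      then show ?case by (simp add: pi_add ab)
    qed
  qed
  then have "vim (ideal_prod R A J) \<subseteq> vim (\<pi> ` ?G)" by blast
  then show "vim (ideal_prod R A J) \<subseteq> ?G" unfolding vim_image[OF rideal_gen KG] .
  note P = ideal_prod_is_ideal[OF A J]
  show "?G \<subseteq> vim (ideal_prod R A J)"
  proof (rule gen_least[OF rideal_vim[OF P]], rule Un_least[OF K_vim[OF P]], rule subsetI)
    fix z assume "z \<in> prods (vim A) (vim J)"
    then show "z \<in> vim (ideal_prod R A J)" by (auto simp: pi_mult intro: ideal_prod.prod)
  qed
qed

lemma ideal_power_vim:
  assumes J: "ideal J R"
  shows "ideal (ideal_power R J n) R \<and> vim (ideal_power R J n) = gen (K \<union> ipow (vim J) n)"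
proof (induction n)
  interpret S: comm_monoid "ideals_set R" by (rule ideals_set_is_comm_monoid)
  case 0
  have c: "ideal_power R J 0 = carrier R" by (simp add: ideals_set_def)
  have "gen (K \<union> ipow (vim J) 0) = UNIV" using gen_superset[of "K \<union> ipow (vim J) 0"] by auto
  then show ?case unfolding c using oneideal by auto
next
  interpret S: comm_monoid "ideals_set R" by (rule ideals_set_is_comm_monoid)
  case (Suc n)
  let ?A = "ideal_power R J n"
  have s: "ideal_power R J (Suc n) = ideal_prod R ?A J" by (simp add: ideals_set_def)
  have A: "ideal ?A R" and vA: "vim ?A = gen (K \<union> ipow (vim J) n)" using Suc by auto
  let ?S = "prods (gen (K \<union> ipow (vim J) n)) (vim J)"
  let ?T = "prods (vim J) (ipow (vim J) n)"
  \<comment> \<open>Products with the \<open>K\<close> part of the power are absorbed by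
    \<open>K\<close> again.\<close>
  have "gen (K \<union> ?S) = gen (K \<union> ?T)"
  proof
    have "?S \<subseteq> gen (K \<union> ?T)"
    proof
      fix z assume "z \<in> ?S"
      then obtain a b where z: "z = b * a" "a \<in> gen (K \<union> ipow (vim J) n)" "b \<in> vim J"
        by (auto simp: mult.commute)
      show "z \<in> gen (K \<union> ?T)" unfolding z(1) by (rule gen_prod_mult[OF z(3) rideal_vim[OF J] z(2)])
    qed
    moreover have "K \<subseteq> gen (K \<union> ?T)" using gen_superset by blast
    ultimately show "gen (K \<union> ?S) \<subseteq> gen (K \<union> ?T)" by (intro gen_least[OF rideal_gen] Un_least)
    have "?T \<subseteq> ?S"
    proof
      fix z assume "z \<in> ?T"
      then obtain a b where z: "z = b * a" "a \<in> vim J" "b \<in> ipow (vim J) n" by (auto simp: mult.commute)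
      then have "b \<in> gen (K \<union> ipow (vim J) n)" by (intro gen_base) simp
      then show "z \<in> ?S" using z by blast
    qed
    then show "gen (K \<union> ?T) \<subseteq> gen (K \<union> ?S)" by (intro gen_mono) blast
  qed
  also have "\<dots> = gen (K \<union> ipow (vim J) (Suc n))"
    using gen_gen_Un[of ?T K] by (simp add: Un_commute)
  finally show ?case unfolding s using ideal_prod_is_ideal[OF A J] vim_ideal_prod[OF A J] vA by simp
qed

end

section \<open>The adic completion\<close>

text \<open>Infinity is the only value without finite upper bounds, so comparing these bounds covers
  infinite dimensions.\<close>

lemma enat_eqI:
  assumes "\<And>d. a \<le> enat d \<longleftrightarrow> b \<le> enat d" shows "a = b"
proof (rule antisym)
  show "a \<le> b" by (cases b) (simp_all add: assms)
  show "b \<le> a" by (cases a) (simp_all add: assms[symmetric])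
qed

locale adic_presentation = presentation R \<pi> K
  for R (structure) and \<pi> :: "'p::comm_ring_1 \<Rightarrow> 'a" and K +
  fixes I
  assumes I_ideal: "ideal I R" and noeth_R: "noetherian_ring R"
begin

abbreviation "C \<equiv> adic_completion R I"
abbreviation "II \<equiv> vim I"

definition V :: "nat \<Rightarrow> 'p set" where "V n = gen (K \<union> ipow II n)"

text \<open>These are the lifts of points of the inverse limit: \<open>a n\<close> represents the
  component modulo \<open>I ^ n\<close>, hence the increment at \<open>n\<close> is controlled by
  \<open>V n\<close>, the preimage of \<open>I ^ n\<close>.\<close>

definition cauchy :: "(nat \<Rightarrow> 'p) \<Rightarrow> bool" where
  "cauchy a \<longleftrightarrow> (\<forall>n. a (Suc n) - a n \<in> V n)"

definition cs :: "(nat \<Rightarrow> 'p) \<Rightarrow> nat \<Rightarrow> 'a set" where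
  "cs a = (\<lambda>n. ideal_power R I n +> \<pi> (a n))"

lemma rideal_II: "rideal II" by (rule rideal_vim[OF I_ideal])
lemma rideal_V: "rideal (V n)" unfolding V_def by (rule rideal_gen)
lemma K_V: "K \<subseteq> V n" unfolding V_def using gen_superset[of "K \<union> ipow II n"] by simp
lemma ipow_V: "ipow II n \<subseteq> V n" unfolding V_def using gen_superset[of "K \<union> ipow II n"] by simp
lemma V_0: "V 0 = UNIV" using ipow_V[of 0] by auto
lemma V_1: "V (Suc 0) = II"
  unfolding V_def ipow_1[OF rideal_II] using gen_rideal[OF rideal_II] K_vim[OF I_ideal] by (simp add: Un_absorb1)
lemma V_Suc: "V (Suc n) \<subseteq> V n"
  unfolding V_def using ipow_Suc_subset[of II n] by (intro gen_mono Un_mono order_refl)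
lemma V_antimono: "m \<le> n \<Longrightarrow> V n \<subseteq> V m"
  using lift_Suc_antimono_le[of V] V_Suc by blast

lemma ideal_power_ideal: "ideal (ideal_power R I n) R"
  and vim_ideal_power: "vim (ideal_power R I n) = V n"
  using ideal_power_vim[OF I_ideal, of n] by (simp_all add: V_def)

lemma Q_presentation:
  "presentation (R Quot ideal_power R I n) (\<lambda>x. ideal_power R I n +> \<pi> x) (V n)"
  using quotient_presentation[OF ideal_power_ideal[of n]] unfolding vim_ideal_power .

lemma cs_eq_iff: "cs a = cs b \<longleftrightarrow> (\<forall>n. a n - b n \<in> V n)"
  unfolding cs_def fun_eq_iff using presentation.pi_eq_iff[OF Q_presentation] by simp

lemma cauchy_diff: "cauchy a \<Longrightarrow> m \<le> n \<Longrightarrow> a n - a m \<in> V m"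
proof (induction n rule: nat_induct)
  case 0
  then show ?case using rideal_0[OF rideal_V] by simp
next
  case (Suc n)
  show ?case
  proof (cases "m = Suc n")
    case True
    then show ?thesis using rideal_0[OF rideal_V] by simp
  next
    case False
    then have m: "m \<le> n" using Suc.prems by simp
    have "a (Suc n) - a n \<in> V m" using Suc.prems(1) V_antimono[OF m] unfolding cauchy_def by blast
    then have "(a (Suc n) - a n) + (a n - a m) \<in> V m" by (rule rideal_add[OF rideal_V _ Suc.IH[OF Suc.prems(1) m]])
    then show ?thesis by simp
  qed
qed

text \<open>The transition map of the inverse limit, evaluated on a coset; the smaller power is
  absorbed by the larger ideal \<open>I ^ n\<close>.\<close>

lemma coset_add_power:
  assumes "a \<in> carrier R"
  shows "ideal_power R I n <+>\<^bsub>R\<^esub> (ideal_power R I (Suc n) +> a) = ideal_power R I n +> a"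
proof -
  let ?J = "ideal_power R I n" and ?J' = "ideal_power R I (Suc n)"
  interpret J: ideal ?J R by (rule ideal_power_ideal)
  interpret J': ideal ?J' R by (rule ideal_power_ideal)
  have "vim ?J' \<subseteq> vim ?J" unfolding vim_ideal_power by (rule V_Suc)
  then have sub: "?J' \<subseteq> ?J" using image_vim[OF J'.a_subset] image_vim[OF J.a_subset] by (metis image_mono)
  show ?thesis
  proof
    show "?J <+>\<^bsub>R\<^esub> (?J' +> a) \<subseteq> ?J +> a"
    proof
      fix z assume "z \<in> ?J <+>\<^bsub>R\<^esub> (?J' +> a)"
      then obtain h h' where h: "h \<in> ?J" "h' \<in> ?J'" "z = h \<oplus> (h' \<oplus> a)"
        unfolding set_add_def' a_r_coset_def' by blast
      have "z = (h \<oplus> h') \<oplus> a" using h assms J.Icarr J'.Icarr by (simp add: a_assoc)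
      moreover have "h \<oplus> h' \<in> ?J" using h sub J.a_closed by blast
      ultimately show "z \<in> ?J +> a" unfolding a_r_coset_def' by blast
    qed
    show "?J +> a \<subseteq> ?J <+>\<^bsub>R\<^esub> (?J' +> a)"
    proof
      fix z assume "z \<in> ?J +> a"
      then obtain h where h: "h \<in> ?J" "z = h \<oplus> a" unfolding a_r_coset_def' by blast
      then have "z = h \<oplus> (\<zero> \<oplus> a)" using assms by simp
      then show "z \<in> ?J <+>\<^bsub>R\<^esub> (?J' +> a)"
        using h(1) J'.zero_closed unfolding set_add_def' a_r_coset_def' by blast
    qed
  qed
qed

lemma cs_carrier_iff: "cs a \<in> carrier C \<longleftrightarrow> cauchy a"
proof -
  have "ideal_power R I n <+>\<^bsub>R\<^esub> cs a (Suc n) = cs a n \<longleftrightarrow> a (Suc n) - a n \<in> V n" for n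
    unfolding cs_def coset_add_power[OF pi_closed] by (rule presentation.pi_eq_iff[OF Q_presentation])
  moreover have "cs a n \<in> carrier (R Quot ideal_power R I n)" for n
    unfolding cs_def by (rule class_hom.pi_closed[OF presentation.axioms(1)[OF Q_presentation]])
  ultimately show ?thesis unfolding cauchy_def adic_completion_def by simp
qed

lemma carrier_cs:
  assumes "s \<in> carrier C" obtains a where "cauchy a" "s = cs a"
proof -
  have "\<exists>x. ideal_power R I n +> \<pi> x = s n" for n
    using assms presentation.pi_surj[OF Q_presentation] unfolding adic_completion_def by simp
  then obtain a where "\<And>n. ideal_power R I n +> \<pi> (a n) = s n" by metis
  then have "s = cs a" unfolding cs_def by auto
  then show ?thesis using that assms cs_carrier_iff by blast
qed

lemma cs_add: "cs a \<oplus>\<^bsub>C\<^esub> cs b = cs (\<lambda>n. a n + b n)"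
  unfolding cs_def adic_completion_def
  using class_hom.pi_add[OF presentation.axioms(1)[OF Q_presentation]] by simp

lemma cs_mult: "cs a \<otimes>\<^bsub>C\<^esub> cs b = cs (\<lambda>n. a n * b n)"
  unfolding cs_def adic_completion_def
  using class_hom.pi_mult[OF presentation.axioms(1)[OF Q_presentation]] by simp

lemma cs_one: "\<one>\<^bsub>C\<^esub> = cs (\<lambda>_. 1)"
  unfolding cs_def adic_completion_def
  using class_hom.pi_one[OF presentation.axioms(1)[OF Q_presentation]] by simp

lemma cs_zero: "\<zero>\<^bsub>C\<^esub> = cs (\<lambda>_. 0)"
  unfolding cs_def adic_completion_def
  using class_hom.pi_zero[OF presentation.axioms(1)[OF Q_presentation]] by simp

lemma cauchy_const: "cauchy (\<lambda>_. x)"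
  unfolding cauchy_def by (simp add: rideal_0[OF rideal_V])

lemma cauchy_add: assumes "cauchy a" "cauchy b" shows "cauchy (\<lambda>n. a n + b n)"
  unfolding cauchy_def
proof
  fix n
  have "(a (Suc n) - a n) + (b (Suc n) - b n) \<in> V n"
    using assms unfolding cauchy_def by (intro rideal_add[OF rideal_V]) simp_all
  also have "(a (Suc n) - a n) + (b (Suc n) - b n) = a (Suc n) + b (Suc n) - (a n + b n)" by simp
  finally show "a (Suc n) + b (Suc n) - (a n + b n) \<in> V n" .
qed

lemma cauchy_mult: assumes "cauchy a" "cauchy b" shows "cauchy (\<lambda>n. a n * b n)"
  unfolding cauchy_def
proof
  fix n
  have "a (Suc n) - a n \<in> V n" "b (Suc n) - b n \<in> V n" using assms unfolding cauchy_def by simp_all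
  then have "(a (Suc n) - a n) * b (Suc n) + a n * (b (Suc n) - b n) \<in> V n"
    by (intro rideal_add[OF rideal_V] rideal_mult2[OF rideal_V, of "a (Suc n) - a n"]
        rideal_mult[OF rideal_V, of "b (Suc n) - b n"])
  also have "(a (Suc n) - a n) * b (Suc n) + a n * (b (Suc n) - b n) = a (Suc n) * b (Suc n) - a n * b n"
    by (simp add: algebra_simps)
  finally show "a (Suc n) * b (Suc n) - a n * b n \<in> V n" .
qed

lemma cauchy_uminus: "cauchy a \<Longrightarrow> cauchy (\<lambda>n. - a n)"
  using cauchy_mult[OF cauchy_const[of "-1"], of a] by simp

lemma completion_cring: "cring C"
proof (rule cringI)
  show "abelian_group C"
  proof (rule abelian_groupI)
    show "\<zero>\<^bsub>C\<^esub> \<in> carrier C" by (simp add: cs_zero cs_carrier_iff cauchy_const)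
    fix x assume "x \<in> carrier C"
    then obtain a where a: "cauchy a" "x = cs a" by (rule carrier_cs)
    show "\<zero>\<^bsub>C\<^esub> \<oplus>\<^bsub>C\<^esub> x = x" by (simp add: a cs_zero cs_add)
    show "\<exists>y\<in>carrier C. y \<oplus>\<^bsub>C\<^esub> x = \<zero>\<^bsub>C\<^esub>"
      by (rule bexI[of _ "cs (\<lambda>n. - a n)"]) (simp_all add: a cs_zero cs_add cs_carrier_iff cauchy_uminus)
    fix y assume "y \<in> carrier C"
    then obtain b where b: "cauchy b" "y = cs b" by (rule carrier_cs)
    show "x \<oplus>\<^bsub>C\<^esub> y \<in> carrier C" by (simp add: a b cs_add cs_carrier_iff cauchy_add)
    show "x \<oplus>\<^bsub>C\<^esub> y = y \<oplus>\<^bsub>C\<^esub> x" by (simp add: a b cs_add add.commute)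
    fix z assume "z \<in> carrier C"
    then obtain c where c: "cauchy c" "z = cs c" by (rule carrier_cs)
    show "x \<oplus>\<^bsub>C\<^esub> y \<oplus>\<^bsub>C\<^esub> z = x \<oplus>\<^bsub>C\<^esub> (y \<oplus>\<^bsub>C\<^esub> z)" by (simp add: a b c cs_add add.assoc)
  qed
  show "comm_monoid C"
  proof (rule comm_monoidI)
    show "\<one>\<^bsub>C\<^esub> \<in> carrier C" by (simp add: cs_one cs_carrier_iff cauchy_const)
    fix x assume "x \<in> carrier C"
    then obtain a where a: "cauchy a" "x = cs a" by (rule carrier_cs)
    show "\<one>\<^bsub>C\<^esub> \<otimes>\<^bsub>C\<^esub> x = x" by (simp add: a cs_one cs_mult)
    fix y assume "y \<in> carrier C"
    then obtain b where b: "cauchy b" "y = cs b" by (rule carrier_cs)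
    show "x \<otimes>\<^bsub>C\<^esub> y \<in> carrier C" by (simp add: a b cs_mult cs_carrier_iff cauchy_mult)
    show "x \<otimes>\<^bsub>C\<^esub> y = y \<otimes>\<^bsub>C\<^esub> x" by (simp add: a b cs_mult mult.commute)
    fix z assume "z \<in> carrier C"
    then obtain c where c: "cauchy c" "z = cs c" by (rule carrier_cs)
    show "x \<otimes>\<^bsub>C\<^esub> y \<otimes>\<^bsub>C\<^esub> z = x \<otimes>\<^bsub>C\<^esub> (y \<otimes>\<^bsub>C\<^esub> z)" by (simp add: a b c cs_mult mult.assoc)
  qed
  fix x y z assume "x \<in> carrier C" "y \<in> carrier C" "z \<in> carrier C"
  then obtain a b c where "x = cs a" "y = cs b" "z = cs c" by (metis carrier_cs)
  then show "(x \<oplus>\<^bsub>C\<^esub> y) \<otimes>\<^bsub>C\<^esub> z = x \<otimes>\<^bsub>C\<^esub> z \<oplus>\<^bsub>C\<^esub> y \<otimes>\<^bsub>C\<^esub> z"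
    by (simp add: cs_add cs_mult distrib_right)
qed

lemma to_completion_pi: "to_completion R I (\<pi> x) = cs (\<lambda>_. x)"
  by (simp add: to_completion_def cs_def)

end

text \<open>\<open>\<phi>\<close> lifts the canonical map from \<open>R\<close> to its completion to
  the presenting rings, so that ideals are extended between ambient rings.\<close>

locale completion_setup = adic_presentation R \<pi> K I
  for R (structure) and \<pi> :: "'p::comm_ring_1 \<Rightarrow> 'a" and K and I +
  fixes \<pi>' :: "'q::comm_ring_1 \<Rightarrow> nat \<Rightarrow> 'a set" and K' and \<phi> :: "'p \<Rightarrow> 'q"
  assumes C_presentation: "presentation (adic_completion R I) \<pi>' K'"
    and phi_add: "\<phi> (a + b) = \<phi> a + \<phi> b"
    and phi_mult: "\<phi> (a * b) = \<phi> a * \<phi> b"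
    and phi_one: "\<phi> 1 = 1"
    and pi'_phi: "\<pi>' (\<phi> x) = to_completion R I (\<pi> x)"
    and I_jacobson: "I \<subseteq> jacobson_radical R"
begin

sublocale C: presentation "adic_completion R I" \<pi>' K' by (rule C_presentation)

definition ext where "ext J = gen (K' \<union> \<phi> ` J)"

lemma pi'_cs: obtains a where "cauchy a" "\<pi>' y = cs a"
  by (rule carrier_cs[OF C.pi_closed[of y]])

lemma pi'_phi_cs: "\<pi>' (\<phi> x) = cs (\<lambda>_. x)"
  by (simp add: pi'_phi to_completion_pi)

lemma cs_pi': assumes "cauchy a" obtains y where "\<pi>' y = cs a"
  using C.pi_surj[of "cs a"] assms cs_carrier_iff by blast

lemma pi'_add_cs: "\<pi>' x = cs a \<Longrightarrow> \<pi>' y = cs b \<Longrightarrow> \<pi>' (x + y) = cs (\<lambda>n. a n + b n)"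
  by (simp add: C.pi_add cs_add)

lemma pi'_mult_cs: "\<pi>' x = cs a \<Longrightarrow> \<pi>' y = cs b \<Longrightarrow> \<pi>' (x * y) = cs (\<lambda>n. a n * b n)"
  by (simp add: C.pi_mult cs_mult)

lemma pi'_uminus_cs: assumes "\<pi>' x = cs a" shows "\<pi>' (- x) = cs (\<lambda>n. - a n)"
proof -
  have "\<pi>' (- 1) = cs (\<lambda>_. - 1)"
  proof -
    have "\<phi> 0 = 0" using phi_add[of 0 0] by simp
    then have "\<phi> (- 1) = - 1" using phi_add[of "- 1" 1] by (simp add: phi_one eq_neg_iff_add_eq_0)
    then show ?thesis using pi'_phi_cs[of "-1"] by simp
  qed
  from pi'_mult_cs[OF this assms] show ?thesis by simp
qed

lemma pi'_diff_cs: "\<pi>' x = cs a \<Longrightarrow> \<pi>' y = cs b \<Longrightarrow> \<pi>' (x - y) = cs (\<lambda>n. a n - b n)"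
  using pi'_add_cs[OF _ pi'_uminus_cs, of x a y b] by simp

lemma mem_K'_iff: "\<pi>' y = cs a \<Longrightarrow> y \<in> K' \<longleftrightarrow> (\<forall>n. a n \<in> V n)"
  unfolding C.mem_K cs_zero by (simp add: cs_eq_iff)

lemma phi_K: "\<phi> ` K \<subseteq> K'"
proof
  fix y assume "y \<in> \<phi> ` K"
  then obtain k where k: "k \<in> K" "y = \<phi> k" by blast
  then show "y \<in> K'" using mem_K'_iff[OF pi'_phi_cs] K_V by blast
qed

lemma rideal_phi_vimage: "rideal J \<Longrightarrow> rideal {a. \<phi> a \<in> J}"
  using phi_add[of 0 0] unfolding rideal_def by (simp add: phi_add phi_mult)

lemma phi_gen: "a \<in> gen (K \<union> Z) \<Longrightarrow> \<phi> a \<in> gen (K' \<union> \<phi> ` Z)"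
proof -
  assume a: "a \<in> gen (K \<union> Z)"
  have "K \<union> Z \<subseteq> {a. \<phi> a \<in> gen (K' \<union> \<phi> ` Z)}"
  proof
    fix w assume "w \<in> K \<union> Z"
    then have "\<phi> w \<in> K' \<union> \<phi> ` Z" using phi_K by blast
    then show "w \<in> {a. \<phi> a \<in> gen (K' \<union> \<phi> ` Z)}" by (simp add: gen_base)
  qed
  then have "gen (K \<union> Z) \<subseteq> {a. \<phi> a \<in> gen (K' \<union> \<phi> ` Z)}"
    by (rule gen_least[OF rideal_phi_vimage[OF rideal_gen]])
  then show ?thesis using a by blast
qed

text \<open>The coefficients of the \<open>c m\<close> at one generator \<open>g\<close> lie in
  \<open>I ^ m\<close>, so their partial sums are Cauchy and converge to some \<open>z\<close>; then
  \<open>y - z * \<phi> g\<close> involves one generator less.\<close>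

lemma partial_sums_mem:
  assumes "finite G" "\<And>m. c m \<in> gen (K \<union> prods (ipow II m) G)"
    and "\<pi>' y = cs (\<lambda>k. \<Sum>m<k. c m)"
  shows "y \<in> gen (K' \<union> \<phi> ` G)"
  using assms
proof (induction G arbitrary: c y)
  case empty
  have "c m \<in> K" for m using empty(1)[of m] gen_rideal[OF rideal_K] by simp
  then have "(\<Sum>m<k. c m) \<in> K" for k
    by (induction k) (simp_all add: rideal_0[OF rideal_K] rideal_add[OF rideal_K])
  then have "y \<in> K'" using mem_K'_iff[OF empty(2)] K_V by blast
  then show ?case by (simp add: gen_base)
next
  case (insert g G)
  have "\<forall>m. \<exists>u. u \<in> ipow II m \<and> c m - u * g \<in> gen (K \<union> prods (ipow II m) G)"
    using gen_insert_prod[OF insert.prems(1) rideal_ipow] unfolding Bex_def by (rule allI)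
  from choice[OF this] obtain u where u: "u m \<in> ipow II m"
    "c m - u m * g \<in> gen (K \<union> prods (ipow II m) G)" for m by blast
  have "cauchy (\<lambda>k. \<Sum>m<k. u m)" unfolding cauchy_def using u(1) ipow_V by auto
  then obtain z where z: "\<pi>' z = cs (\<lambda>k. \<Sum>m<k. u m)" by (rule cs_pi')
  have "\<pi>' (y - z * \<phi> g) = cs (\<lambda>k. (\<Sum>m<k. c m) - (\<Sum>m<k. u m) * g)"
    by (rule pi'_diff_cs[OF insert.prems(2) pi'_mult_cs[OF z pi'_phi_cs]])
  also have "(\<lambda>k. (\<Sum>m<k. c m) - (\<Sum>m<k. u m) * g) = (\<lambda>k. \<Sum>m<k. c m - u m * g)"
    by (simp add: sum_subtractf sum_distrib_right)
  finally have "y - z * \<phi> g \<in> gen (K' \<union> \<phi> ` G)" by (rule insert.IH[OF u(2)])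
  then show ?case unfolding image_insert Un_insert_right gen_insert_iff by blast
qed

text \<open>The kernel of the projection to \<open>R / I\<^sup>n\<close> is \<open>I\<^sup>n\<close> times the completion, because \<open>I\<^sup>n\<close> is finitely
  generated: the increments of a sequence in the kernel are written in terms of generators of
  \<open>I\<^sup>n\<close> with coefficients in \<open>I\<^sup>m\<close>, and these coefficients are summed up.\<close>

lemma kernel_mem_ext:
  assumes a: "cauchy a" "\<pi>' y = cs a" "a n \<in> V n"
  shows "y \<in> ext (ipow II n)"
proof -
  obtain G where G: "finite G" "G \<subseteq> ipow II n" "ipow II n \<subseteq> gen (K \<union> G)"
    using noeth_finite_subset[OF noeth_K[OF noeth_R]] by metis
  \<comment> \<open>The increments from index \<open>n\<close> on: modulo \<open>K\<close>,
    \<open>c m\<close> lies in \<open>I ^ (m + n)\<close>, hence is a combination of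
    \<open>G\<close> with coefficients in \<open>I ^ m\<close>.\<close>
  define c where "c m = a (n + Suc m) - a (n + m)" for m
  have cG: "c m \<in> gen (K \<union> prods (ipow II m) G)" (is "_ \<in> ?T m") for m
  proof -
    have "ipow II (m + n) \<subseteq> ?T m"
    proof (rule ipow_add_subset[OF rideal_gen])
      fix u b assume u: "u \<in> ipow II m" and b: "b \<in> ipow II n"
      show "u * b \<in> ?T m" by (rule gen_prod_mult[OF u rideal_ipow]) (use G(3) b in blast)
    qed
    moreover have "K \<subseteq> ?T m" using gen_superset[of "K \<union> prods (ipow II m) G"] by simp
    ultimately have "V (m + n) \<subseteq> ?T m" unfolding V_def by (intro gen_least[OF rideal_gen] Un_least)
    moreover have "c m \<in> V (m + n)" using a(1) unfolding c_def cauchy_def by (simp add: add.commute)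
    ultimately show ?thesis by blast
  qed
  have S: "(\<Sum>m<k. c m) = a (n + k) - a n" for k
    by (induction k) (simp_all add: c_def)
  \<comment> \<open>Shifting the index by \<open>n\<close> does not change the element of the
    limit.\<close>
  have "\<pi>' y = cs (\<lambda>k. a (n + k))"
    unfolding a(2) cs_eq_iff
  proof
    fix k
    show "a k - a (n + k) \<in> V k"
      using rideal_uminus[OF rideal_V cauchy_diff[OF a(1), of k "n + k"]] by simp
  qed
  then have "\<pi>' (y - \<phi> (a n)) = cs (\<lambda>k. a (n + k) - a n)" by (rule pi'_diff_cs[OF _ pi'_phi_cs])
  then have "y - \<phi> (a n) \<in> gen (K' \<union> \<phi> ` G)" using partial_sums_mem[OF G(1) cG] unfolding S by blast
  moreover have "gen (K' \<union> \<phi> ` G) \<subseteq> ext (ipow II n)"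
    unfolding ext_def by (intro gen_mono Un_mono order_refl image_mono G(2))
  moreover have "\<phi> (a n) \<in> ext (ipow II n)" unfolding ext_def
    by (rule phi_gen) (use a(3) in \<open>simp add: V_def\<close>)
  ultimately show ?thesis unfolding ext_def using rideal_diffD[OF rideal_gen] by blast
qed

text \<open>The elements whose component at \<open>n\<close> vanishes form an ideal containing
  \<open>K'\<close> and the images of \<open>I ^ n\<close>, and components do not depend on the
  chosen lift.\<close>

lemma ext_mem_kernel:
  assumes y: "y \<in> ext (ipow II n)" and a: "\<pi>' y = cs a"
  shows "a n \<in> V n"
proof -
  let ?E = "{y. \<exists>a. \<pi>' y = cs a \<and> a n \<in> V n}"
  have E: "y \<in> ?E" if "\<pi>' y = cs a" "a n \<in> V n" for y a using that by blast
  have "ext (ipow II n) \<subseteq> ?E"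
    unfolding ext_def
  proof (rule gen_least)
    show "rideal ?E"
    proof (rule ridealI)
      have "\<pi>' 0 = cs (\<lambda>_. 0)" using C.pi_zero cs_zero by simp
      then show "0 \<in> ?E" by (rule E) (rule rideal_0[OF rideal_V])
    next
      fix x y assume "x \<in> ?E" "y \<in> ?E"
      then obtain a b where ab: "\<pi>' x = cs a" "a n \<in> V n" "\<pi>' y = cs b" "b n \<in> V n" by blast
      show "x + y \<in> ?E" by (rule E[OF pi'_add_cs[OF ab(1,3)] rideal_add[OF rideal_V ab(2,4)]])
    next
      fix r x assume "x \<in> ?E"
      then obtain a where a: "\<pi>' x = cs a" "a n \<in> V n" by blast
      obtain b where b: "\<pi>' r = cs b" by (rule pi'_cs)
      show "r * x \<in> ?E" by (rule E[OF pi'_mult_cs[OF b a(1)] rideal_mult[OF rideal_V a(2)]])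
    qed
    show "K' \<union> \<phi> ` ipow II n \<subseteq> ?E"
    proof (rule Un_least; rule subsetI)
      fix y assume y: "y \<in> K'"
      obtain a where a: "\<pi>' y = cs a" by (rule pi'_cs)
      show "y \<in> ?E" by (rule E[OF a]) (use mem_K'_iff[OF a] y in simp)
    next
      fix y assume "y \<in> \<phi> ` ipow II n"
      then obtain x where x: "x \<in> ipow II n" "y = \<phi> x" by blast
      show "y \<in> ?E" unfolding x(2) by (rule E[OF pi'_phi_cs]) (use x(1) ipow_V in blast)
    qed
  qed
  then obtain b where b: "\<pi>' y = cs b" "b n \<in> V n" using y by blast
  have "cs a = cs b" using a b(1) by simp
  then have "a n - b n \<in> V n" by (simp add: cs_eq_iff)
  then show ?thesis by (rule rideal_diffD[OF rideal_V _ b(2)])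
qed

text \<open>\<open>T k j n\<close> is the truncated power series \<open>(\<Sum>i<j. \<alpha> (n + i) k * \<xi> k ^ i)\<close>, read modulo \<open>V k\<close>.\<close>

lemma complete_C:
  assumes x: "x \<in> ext II"
  shows "\<exists>b. \<forall>n::nat. b n - a n - x * b (Suc n) \<in> K'"
proof -
  obtain \<xi> where \<xi>: "cauchy \<xi>" "\<pi>' x = cs \<xi>" by (rule pi'_cs)
  have "\<xi> (Suc 0) \<in> V (Suc 0)"
    by (rule ext_mem_kernel[OF _ \<xi>(2)]) (use x in \<open>simp only: ipow_1[OF rideal_II]\<close>)
  \<comment> \<open>Nothing is known about \<open>\<xi> 0\<close>, as \<open>V 0\<close> is the
    whole ring; hence the restriction to positive \<open>k\<close>.\<close>
  then have \<xi>II: "\<xi> k \<in> II" if "k > 0" for k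
    using cauchy_diff[OF \<xi>(1), of "Suc 0" k] that V_1 rideal_diffD[OF rideal_II] by (metis Suc_leI)
  have "\<forall>n. \<exists>\<alpha>. cauchy \<alpha> \<and> \<pi>' (a n) = cs \<alpha>" using pi'_cs by metis
  from choice[OF this] obtain \<alpha> where \<alpha>: "\<And>n. cauchy (\<alpha> n)" "\<And>n. \<pi>' (a n) = cs (\<alpha> n)" by blast
  define T where "T k = rec_nat (\<lambda>_. 0) (\<lambda>_ t n. \<alpha> n k + \<xi> k * t (Suc n))" for k
  have T0: "T k 0 n = 0" and TS: "T k (Suc j) n = \<alpha> n k + \<xi> k * T k j (Suc n)" for k j n
    by (simp_all add: T_def)
  \<comment> \<open>The additional summand of the longer truncation carries the factor
    \<open>\<xi> k ^ j\<close>.\<close>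
  have incr: "T k (Suc j) n - T k j n \<in> ipow II j" if "k > 0" for k j n
  proof (induction j arbitrary: n)
    case (Suc j)
    have "\<xi> k * (T k (Suc j) (Suc n) - T k j (Suc n)) \<in> ipow II (Suc j)"
      by (rule ipow_mult[OF \<xi>II[OF that] Suc.IH])
    also have "\<xi> k * (T k (Suc j) (Suc n) - T k j (Suc n)) = T k (Suc (Suc j)) n - T k (Suc j) n"
      unfolding TS[of k "Suc j" n] TS[of k j n] by (simp add: right_diff_distrib)
    finally show ?case .
  qed simp
  have cong: "T (Suc k) j n - T k j n \<in> V k" for k j n
  proof (induction j arbitrary: n)
    case 0
    then show ?case by (simp add: T0 rideal_0[OF rideal_V])
  next
    case (Suc j)
    have "\<alpha> n (Suc k) - \<alpha> n k \<in> V k" "\<xi> (Suc k) - \<xi> k \<in> V k"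
      using \<alpha>(1)[of n] \<xi>(1) unfolding cauchy_def by simp_all
    then have "(\<alpha> n (Suc k) - \<alpha> n k) + (\<xi> (Suc k) - \<xi> k) * T (Suc k) j (Suc n)
        + \<xi> k * (T (Suc k) j (Suc n) - T k j (Suc n)) \<in> V k"
      by (intro rideal_add[OF rideal_V] rideal_mult2[OF rideal_V, of "\<xi> (Suc k) - \<xi> k"]
          rideal_mult[OF rideal_V Suc.IH])
    also have "(\<alpha> n (Suc k) - \<alpha> n k) + (\<xi> (Suc k) - \<xi> k) * T (Suc k) j (Suc n)
        + \<xi> k * (T (Suc k) j (Suc n) - T k j (Suc n)) = T (Suc k) (Suc j) n - T k (Suc j) n"
      unfolding TS by (simp add: algebra_simps)
    finally show ?case .
  qed
  \<comment> \<open>Diagonal choice: modulo \<open>V k\<close> the terms from index \<open>k\<close>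
    on vanish, so \<open>k\<close> terms give the component at \<open>k\<close>.\<close>
  define \<beta> where "\<beta> n k = T k k n" for n k
  have "cauchy (\<beta> n)" for n
    unfolding cauchy_def
  proof
    fix k
    have "T (Suc k) (Suc k) n - T (Suc k) k n \<in> V k" using incr[of "Suc k" k n] ipow_V[of k] by blast
    then have "(T (Suc k) (Suc k) n - T (Suc k) k n) + (T (Suc k) k n - T k k n) \<in> V k"
      by (rule rideal_add[OF rideal_V _ cong])
    then show "\<beta> n (Suc k) - \<beta> n k \<in> V k" unfolding \<beta>_def by simp
  qed
  then have "\<forall>n. \<exists>y. \<pi>' y = cs (\<beta> n)" using cs_pi' by metis
  from choice[OF this] obtain b where b: "\<And>n. \<pi>' (b n) = cs (\<beta> n)" by blast
  have "b n - a n - x * b (Suc n) \<in> K'" for n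
  proof -
    have "\<pi>' (b n - a n - x * b (Suc n)) = cs (\<lambda>k. \<beta> n k - \<alpha> n k - \<xi> k * \<beta> (Suc n) k)"
      by (intro pi'_diff_cs pi'_mult_cs b \<alpha>(2) \<xi>(2))
    moreover have "\<beta> n k - \<alpha> n k - \<xi> k * \<beta> (Suc n) k \<in> V k" for k
    proof (cases "k = 0")
      case True
      then show ?thesis by (simp add: V_0)
    next
      case False
      then have "T k (Suc k) n - T k k n \<in> V k" using incr[of k k n] ipow_V[of k] by blast
      then have "- (T k (Suc k) n - T k k n) \<in> V k" by (rule rideal_uminus[OF rideal_V])
      then show ?thesis unfolding \<beta>_def TS by (simp add: algebra_simps)
    qed
    ultimately show ?thesis using mem_K'_iff by blast
  qed
  then show ?thesis by blast
qed

lemma completion_pair: "completion_pair K II K' \<phi>"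
proof
  show "noeth K" by (rule noeth_K[OF noeth_R])
  show "K \<subseteq> II" by (rule K_vim[OF I_ideal])
  show "rideal K'" by (rule C.rideal_K)
  show "II \<subseteq> m" if m: "rmaximal m" "K \<subseteq> m" for m
  proof -
    have "I \<subseteq> \<pi> ` m" using I_jacobson maximalideal_image[OF m] unfolding jacobson_radical_def by blast
    then have "II \<subseteq> vim (\<pi> ` m)" by blast
    then show ?thesis using vim_image[OF rprime_rideal[OF rmaximal_rprime[OF m(1)]] m(2)] by simp
  qed
  show "\<exists>x. y - \<phi> x \<in> gen (K' \<union> \<phi> ` ipow II n)" for y n
  proof -
    obtain a where a: "cauchy a" "\<pi>' y = cs a" by (rule pi'_cs)
    have "y - \<phi> (a n) \<in> ext (ipow II n)"
    proof (rule kernel_mem_ext)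
      show "cauchy (\<lambda>k. a k - a n)"
        using cauchy_add[OF a(1) cauchy_const[of "- a n"]] by simp
      show "\<pi>' (y - \<phi> (a n)) = cs (\<lambda>k. a k - a n)" by (rule pi'_diff_cs[OF a(2) pi'_phi_cs])
    qed (simp add: rideal_0[OF rideal_V])
    then show ?thesis unfolding ext_def by blast
  qed
  show "x \<in> gen (K \<union> ipow II n)" if "\<phi> x \<in> gen (K' \<union> \<phi> ` ipow II n)" for x n
    using ext_mem_kernel[OF _ pi'_phi_cs, of x n] that unfolding ext_def V_def by simp
  show "y \<in> K'" if y: "\<And>n. y \<in> gen (K' \<union> \<phi> ` ipow II n)" for y
  proof -
    obtain a where a: "cauchy a" "\<pi>' y = cs a" by (rule pi'_cs)
    have "a n \<in> V n" for n using ext_mem_kernel[OF _ a(2), of n] y[of n] unfolding ext_def by simp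
    then show ?thesis using mem_K'_iff[OF a(2)] by simp
  qed
  show "\<exists>b. \<forall>n. b n - a n - x * b (Suc n) \<in> K'" if "x \<in> gen (K' \<union> \<phi> ` II)" for x a
    using complete_C that unfolding ext_def by blast
qed (use rideal_II phi_add phi_mult phi_one phi_K in \<open>simp_all add: ext_def\<close>)

sublocale completion_pair K II K' \<phi> ext
  by (rule completion_pair) (rule eq_reflection[OF ext_def])

text \<open>\<open>(R / I) \<rightarrow> (C / I C)\<close> is again a completion, with respect to the zero ideal.\<close>

lemma completion_pair_quotient: "completion_pair II II (ext II) \<phi>"
proof
  have n1: "ext (ipow II n) \<subseteq> ext II" if "n > 0" for n
    using ipow_subset[OF rideal_II that] by (rule ext_mono)
  have E: "gen (ext II \<union> \<phi> ` ipow II n) = ext II" if n: "n > 0" for n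
  proof
    show "gen (ext II \<union> \<phi> ` ipow II n) \<subseteq> ext II"
      by (rule gen_least[OF rideal_ext]) (use n1[OF n] image_ext in blast)
    show "ext II \<subseteq> gen (ext II \<union> \<phi> ` ipow II n)"
      using gen_superset[of "ext II \<union> \<phi> ` ipow II n"] by simp
  qed
  have E1: "gen (ext II \<union> \<phi> ` II) = ext II" using E[of "Suc 0"] unfolding ipow_1[OF rideal_II] by simp
  show "noeth II" by (rule noeth_mono[OF nK rideal_II KI])
  show "\<exists>x. y - \<phi> x \<in> gen (ext II \<union> \<phi> ` ipow II n)" for y n
  proof -
    obtain x where "y - \<phi> x \<in> ext (ipow II n)" using dense by blast
    moreover have "ext (ipow II n) \<subseteq> gen (ext II \<union> \<phi> ` ipow II n)"
      unfolding ext_def[of "ipow II n"] by (rule gen_mono) (use K'_ext[of II] in blast)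
    ultimately show ?thesis by blast
  qed
  show "x \<in> gen (II \<union> ipow II n)" if x: "\<phi> x \<in> gen (ext II \<union> \<phi> ` ipow II n)" for x n
  proof (cases "n = 0")
    case True
    then show ?thesis by (intro gen_base) simp
  next
    case False
    then have "\<phi> x \<in> ext II" using x E by simp
    then have "x \<in> II" by (rule contract_closed[OF rideal_II KI])
    then show ?thesis by (intro gen_base) simp
  qed
  show "y \<in> ext II" if "\<And>n. y \<in> gen (ext II \<union> \<phi> ` ipow II n)" for y
    using that[of "Suc 0"] E[of "Suc 0"] by (simp del: ipow.simps)
  \<comment> \<open>\<open>x\<close> is zero modulo \<open>I C\<close>, so \<open>b = a\<close>
    solves the equations.\<close>
  show "\<exists>b. \<forall>n. b n - a n - x * b (Suc n) \<in> ext II" if "x \<in> gen (ext II \<union> \<phi> ` II)" for x a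
  proof (intro exI[of _ a] allI)
    fix n
    have "- (a (Suc n) * x) \<in> ext II"
      using that unfolding E1 by (intro rideal_uminus[OF rideal_ext] rideal_mult[OF rideal_ext])
    then show "a n - a n - x * a (Suc n) \<in> ext II" by (simp add: mult.commute)
  qed
qed (use rideal_II rideal_ext image_ext phi_add phi_mult phi_one in auto)

lemma vim_extended_ideal: "C.vim (extended_ideal R I) = ext II"
proof -
  have "to_completion R I ` I = \<pi>' ` \<phi> ` II"
    unfolding image_image pi'_phi using image_vim[OF ideal_subset[OF I_ideal]] by (metis image_image)
  then show ?thesis unfolding extended_ideal_def ext_def using C.vim_Idl[of "\<phi> ` II"] by simp
qed

lemma ideal_extended: "ideal (extended_ideal R I) C"
proof -
  have "to_completion R I ` I \<subseteq> carrier C"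
  proof (rule image_subsetI)
    fix a assume "a \<in> I"
    then obtain x where "a = \<pi> x" using pi_surj ideal_subset[OF I_ideal] by (metis subsetD)
    then show "to_completion R I a \<in> carrier C" using pi'_phi C.pi_closed by metis
  qed
  then show ?thesis unfolding extended_ideal_def by (rule C.genideal_ideal)
qed

lemma extended_ideal_proper: "extended_ideal R I = carrier C \<longleftrightarrow> I = carrier R"
  using C.one_vim_iff[OF ideal_extended] one_vim_iff[OF I_ideal] ext_UNIV_iff
  unfolding vim_extended_ideal by simp

lemma krull_dim_completion: "krull_dim C = krull_dim R"
  by (rule enat_eqI) (use dim_le_ext in \<open>simp add: C.krull_dim_le_iff krull_dim_le_iff dim_le_def\<close>)

lemma krull_dim_quotient: "krull_dim (C Quot extended_ideal R I) = krull_dim (R Quot I)"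
proof (rule enat_eqI)
  fix d
  have q: "krull_dim (R Quot I) \<le> enat d \<longleftrightarrow> dim_le II d"
    using presentation.krull_dim_le_iff[OF quotient_presentation[OF I_ideal]] by (simp add: dim_le_def)
  have q': "krull_dim (C Quot extended_ideal R I) \<le> enat d \<longleftrightarrow> dim_le (ext II) d"
    using presentation.krull_dim_le_iff[OF C.quotient_presentation[OF ideal_extended]]
    unfolding vim_extended_ideal by (simp add: dim_le_def)
  show "krull_dim (C Quot extended_ideal R I) \<le> enat d \<longleftrightarrow> krull_dim (R Quot I) \<le> enat d"
    unfolding q q' by (rule completion_pair.dim_le_ext[OF completion_pair_quotient])
qed

lemma grade_completion:
  assumes "I \<noteq> carrier R"
  shows "grade (extended_ideal R I) C = grade I R"
proof -
  have "1 \<notin> II" using one_vim_iff[OF I_ideal] assms by blast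
  then obtain xs where xs: "maxreg II K xs" using ex_maxreg[OF nK rideal_II _ KI] by blast
  have "grade I R = length xs" by (rule grade_eq[OF nK I_ideal assms xs])
  moreover have "extended_ideal R I \<noteq> carrier C" using extended_ideal_proper assms by simp
  moreover have "maxreg (C.vim (extended_ideal R I)) K' (map \<phi> xs)"
    unfolding vim_extended_ideal by (rule maxreg_ext[OF xs])
  ultimately have "grade I R = length xs" "grade (extended_ideal R I) C = length (map \<phi> xs)"
    using C.grade_eq[OF noeth_K' ideal_extended] by simp_all
  then show ?thesis by simp
qed

end

theorem theorem2p18:
  fixes R :: "('a, 'b) ring_scheme" and I :: "'a set"
  assumes "cring R" and "noetherian_ring R"
    and "ideal I R" and "I \<subseteq> jacobson_radical R"
  shows "cohen_macaulay_wrt I R \<longleftrightarrow>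
    cohen_macaulay_wrt (extended_ideal R I) (adic_completion R I) \<and>
    grade I R = grade (extended_ideal R I) (adic_completion R I)"
proof -
  let ?C = "adic_completion R I"
  obtain \<pi> :: "'a free_cring \<Rightarrow> 'a" and K where "presentation R \<pi> K"
    using free_presentation[OF assms(1)] by blast
  then interpret R: adic_presentation R \<pi> K I
    by (intro adic_presentation.intro adic_presentation_axioms.intro assms)
  obtain \<pi>' :: "(nat \<Rightarrow> 'a set) free_cring \<Rightarrow> nat \<Rightarrow> 'a set" and K' where C: "presentation ?C \<pi>' K'"
    using free_presentation[OF R.completion_cring] by blast
  interpret C: presentation ?C \<pi>' K' by (rule C)
  \<comment> \<open>Lifts are chosen for the images of the variables only; freeness extends them to
    the homomorphism \<open>\<phi>\<close>.\<close>
  have "\<exists>y. \<pi>' y = to_completion R I (\<pi> (free_var a))" for a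
    by (rule C.pi_surj) (simp add: R.to_completion_pi R.cs_carrier_iff R.cauchy_const)
  then obtain w where w: "\<And>a. \<pi>' (w a) = to_completion R I (\<pi> (free_var a))" by metis
  define \<phi> where "\<phi> = free_hom w"
  have \<phi>: "\<pi>' (\<phi> x) = to_completion R I (\<pi> x)" for x
  proof (rule free_cring_hom_unique)
    show "class_hom ?C (\<lambda>x. \<pi>' (\<phi> x))"
      by unfold_locales (simp_all add: \<phi>_def free_hom_hom C.pi_add C.pi_mult C.pi_one)
    show "class_hom ?C (\<lambda>x. to_completion R I (\<pi> x))"
      unfolding R.to_completion_pi
      by unfold_locales (simp_all add: R.cs_carrier_iff R.cauchy_const R.cs_add R.cs_mult R.cs_one)
    show "\<pi>' (\<phi> (free_var a)) = to_completion R I (\<pi> (free_var a))" for a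
      by (simp add: \<phi>_def free_hom_hom w)
  qed
  interpret completion_setup R \<pi> K I \<pi>' K' \<phi>
    by (intro completion_setup.intro completion_setup_axioms.intro R.adic_presentation_axioms C \<phi> assms(4))
      (simp_all add: \<phi>_def free_hom_hom)
  show ?thesis
  proof (cases "I = carrier R")
    \<comment> \<open>Neither ideal is proper here, so \<open>cohen_macaulay_wrt\<close> fails on
      both sides.\<close>
    case True
    then show ?thesis using extended_ideal_proper by (simp add: cohen_macaulay_wrt_def)
  next
    case False
    then show ?thesis
      using extended_ideal_proper ideal_extended assms(3) grade_completion[OF False]
        krull_dim_completion krull_dim_quotient by (simp add: cohen_macaulay_wrt_def)
  qed
qed

end
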